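(* For all integers $m\ge1$ and $n\ge1$, the dimension of the vector space $\mathfrak{P}^{(m)}_n$ defined in the context is equal to the $n$-th Fuss--Catalan number $c^{(m)}_n=\frac{1}{mn+1}\binom{(m+1)n}{n}$.
   Context: All vector spaces and algebras are over $\mathbb{C}$; algebras are unital and associative; modules are right modules. For $m\ge1$, $\mathfrak{A}^{(m)}$ is the associative algebra with generators $e[i]$ ($i\in\mathbb{Z}$) and relations $$\sum_{i=0}^m(-1)^i\binom{m}{i}\,[e[r-i],e[s+i]]_m=0\quad\text{for all } r,s\in\mathbb{Z},$$ where $[a,b]_m=ab-(-1)^m ba$. Let $\mathfrak{A}^{(m)}_+$ be the subalgebra generated by all $e[i]$ with $i>0$, and let $\mathfrak{M}^{(m)}=\mathbb{C}v\otimes_{\mathfrak{A}^{(m)}_+}\mathfrak{A}^{(m)}$ be the right module induced from the trivial one-dimensional right $\mathfrak{A}^{(m)}_+$-module $\mathbb{C}v$, where $v e[i]=0$ for all $i>0$. Let $\mathfrak{A}^{(m)}_{\ge0}$ be the linear span of the $e[i]$ with $i\ge0$. Then $\mathfrak{P}^{(m)}_n\subset\mathfrak{M}^{(m)}$ is the image of the linear map $(\mathfrak{A}^{(m)}_{\ge0})^{\otimes n}\to\mathfrak{M}^{(m)}$, $e[i_1]\otimes\cdots\otimes e[i_n]\mapsto v e[i_1]\cdots e[i_n]$. *)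

theory Defs
  imports
    Complex_Main
    "HOL-Algebra.QuotRing"
    "HOL-Algebra.Subrings"
    "Jordan_Normal_Form.Missing_VectorSpace"
begin

section \<open>Linear algebra over the complex numbers\<close>

text \<open>
  Complex vector spaces and complex algebras are records of type \<open>(complex, 'a) module\<close> over the field \<open>CC\<close>; for a bare vector
  space the fields \<open>mult\<close> and \<open>one\<close> carry no meaning.
\<close>

definition CC :: "complex ring"
  where "CC = \<lparr>carrier = UNIV, mult = (*), one = 1, zero = 0, add = (+)\<rparr>"

definition free_vs :: "'a set \<Rightarrow> (complex, 'a \<Rightarrow> complex) module"
  where "free_vs S =
    \<lparr>carrier = {f. finite {x. f x \<noteq> 0} \<and> {x. f x \<noteq> 0} \<subseteq> S},
     mult = undefined, one = undefined,
     zero = (\<lambda>x. 0), add = (\<lambda>f g x. f x + g x), smult = (\<lambda>c f x. c * f x)\<rparr>"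

definition delta :: "'a \<Rightarrow> 'a \<Rightarrow> complex"
  where "delta x = (\<lambda>y. if y = x then 1 else 0)"

definition lin_ext :: "(complex, 'b) module \<Rightarrow> ('a \<Rightarrow> 'b) \<Rightarrow> ('a \<Rightarrow> complex) \<Rightarrow> 'b"
  where "lin_ext V \<phi> f = (\<Oplus>\<^bsub>V\<^esub>x\<in>{x. f x \<noteq> 0}. f x \<odot>\<^bsub>V\<^esub> \<phi> x)"

text \<open>
  Quotient of a vector space by a subspace, and at the same time quotient of an algebra by a
  two-sided ideal.
\<close>

definition quot :: "(complex, 'a) module \<Rightarrow> 'a set \<Rightarrow> (complex, 'a set) module"
  where "quot V U =
    ring.extend (V Quot U) (module.fields (\<lambda>c X. \<Union>x\<in>X. U +>\<^bsub>V\<^esub> (c \<odot>\<^bsub>V\<^esub> x)))"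

text \<open>The map induced on classes \<open>X\<close> by a map \<open>\<phi>\<close> that is constant on each class.\<close>

definition quot_map :: "('a \<Rightarrow> 'b) \<Rightarrow> 'a set \<Rightarrow> 'b"
  where "quot_map \<phi> X = the_elem (\<phi> ` X)"

abbreviation lspan :: "(complex, 'a) module \<Rightarrow> 'a set \<Rightarrow> 'a set"
  where "lspan V S \<equiv> LinearCombinations.module.span CC V S"


section \<open>Tensor products\<close>

definition multilin_rels :: "nat \<Rightarrow> (complex, 'a) module \<Rightarrow> ('a list \<Rightarrow> complex) set"
  where "multilin_rels n V =
    (let T = free_vs {xs. length xs = n \<and> set xs \<subseteq> carrier V} in
      {delta (xs[i := x \<oplus>\<^bsub>V\<^esub> y]) \<ominus>\<^bsub>T\<^esub> (delta (xs[i := x]) \<oplus>\<^bsub>T\<^esub> delta (xs[i := y])) | xs i x y.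
         length xs = n \<and> set xs \<subseteq> carrier V \<and> i < n \<and> x \<in> carrier V \<and> y \<in> carrier V} \<union>
      {delta (xs[i := c \<odot>\<^bsub>V\<^esub> x]) \<ominus>\<^bsub>T\<^esub> (c \<odot>\<^bsub>T\<^esub> delta (xs[i := x])) | xs i c x.
         length xs = n \<and> set xs \<subseteq> carrier V \<and> i < n \<and> x \<in> carrier V})"

definition tensor_power :: "nat \<Rightarrow> (complex, 'a) module \<Rightarrow> (complex, ('a list \<Rightarrow> complex) set) module"
  where "tensor_power n V =
    (let T = free_vs {xs. length xs = n \<and> set xs \<subseteq> carrier V}
     in quot T (lspan T (multilin_rels n V)))"

text \<open>
  The tensor product \<open>N \<otimes>\<^sub>B A\<close>, where \<open>B\<close> is (the carrier of) a subalgebra of the algebra \<open>A\<close>,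
  and \<open>act\<close> is a right action of \<open>B\<close> on the vector space \<open>N\<close>.
\<close>

definition balanced_rels ::
    "(complex, 'n) module \<Rightarrow> ('n \<Rightarrow> 'b \<Rightarrow> 'n) \<Rightarrow> 'b set \<Rightarrow> (complex, 'b) module \<Rightarrow> ('n \<times> 'b \<Rightarrow> complex) set"
  where "balanced_rels N act B A =
    (let T = free_vs (carrier N \<times> carrier A) in
      {delta (x \<oplus>\<^bsub>N\<^esub> y, a) \<ominus>\<^bsub>T\<^esub> (delta (x, a) \<oplus>\<^bsub>T\<^esub> delta (y, a)) | x y a.
         x \<in> carrier N \<and> y \<in> carrier N \<and> a \<in> carrier A} \<union>
      {delta (x, a \<oplus>\<^bsub>A\<^esub> b) \<ominus>\<^bsub>T\<^esub> (delta (x, a) \<oplus>\<^bsub>T\<^esub> delta (x, b)) | x a b.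
         x \<in> carrier N \<and> a \<in> carrier A \<and> b \<in> carrier A} \<union>
      {delta (c \<odot>\<^bsub>N\<^esub> x, a) \<ominus>\<^bsub>T\<^esub> (c \<odot>\<^bsub>T\<^esub> delta (x, a)) | c x a.
         x \<in> carrier N \<and> a \<in> carrier A} \<union>
      {delta (x, c \<odot>\<^bsub>A\<^esub> a) \<ominus>\<^bsub>T\<^esub> (c \<odot>\<^bsub>T\<^esub> delta (x, a)) | c x a.
         x \<in> carrier N \<and> a \<in> carrier A} \<union>
      {delta (act x b, a) \<ominus>\<^bsub>T\<^esub> delta (x, b \<otimes>\<^bsub>A\<^esub> a) | x b a.
         x \<in> carrier N \<and> b \<in> B \<and> a \<in> carrier A})"

definition tensor_null ::
    "(complex, 'n) module \<Rightarrow> ('n \<Rightarrow> 'b \<Rightarrow> 'n) \<Rightarrow> 'b set \<Rightarrow> (complex, 'b) module \<Rightarrow> ('n \<times> 'b \<Rightarrow> complex) set"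
  where "tensor_null N act B A = lspan (free_vs (carrier N \<times> carrier A)) (balanced_rels N act B A)"

definition tensor_prod ::
    "(complex, 'n) module \<Rightarrow> ('n \<Rightarrow> 'b \<Rightarrow> 'n) \<Rightarrow> 'b set \<Rightarrow> (complex, 'b) module
      \<Rightarrow> (complex, ('n \<times> 'b \<Rightarrow> complex) set) module"
  where "tensor_prod N act B A = quot (free_vs (carrier N \<times> carrier A)) (tensor_null N act B A)"

definition pure_tensor ::
    "(complex, 'n) module \<Rightarrow> ('n \<Rightarrow> 'b \<Rightarrow> 'n) \<Rightarrow> 'b set \<Rightarrow> (complex, 'b) module
      \<Rightarrow> 'n \<Rightarrow> 'b \<Rightarrow> ('n \<times> 'b \<Rightarrow> complex) set"
  where "pure_tensor N act B A x a =
    tensor_null N act B A +>\<^bsub>free_vs (carrier N \<times> carrier A)\<^esub> delta (x, a)"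

text \<open>The right action of \<open>A\<close> on \<open>N \<otimes>\<^sub>B A\<close>, determined by \<open>(x \<otimes> a) \<cdot> b = x \<otimes> (a b)\<close>.\<close>

definition tensor_act ::
    "(complex, 'n) module \<Rightarrow> ('n \<Rightarrow> 'b \<Rightarrow> 'n) \<Rightarrow> 'b set \<Rightarrow> (complex, 'b) module
      \<Rightarrow> ('n \<times> 'b \<Rightarrow> complex) set \<Rightarrow> 'b \<Rightarrow> ('n \<times> 'b \<Rightarrow> complex) set"
  where "tensor_act N act B A X b =
    quot_map (lin_ext (tensor_prod N act B A) (\<lambda>(x, a). pure_tensor N act B A x (a \<otimes>\<^bsub>A\<^esub> b))) X"


section \<open>The algebras and their induced modules\<close>

text \<open>
  The free unital associative algebra on \<open>'x\<close>, with basis the words \<open>delta w\<close>; the product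
  satisfies \<open>delta u \<otimes> delta v = delta (u @ v)\<close>.
\<close>

definition free_alg :: "(complex, 'x list \<Rightarrow> complex) module"
  where "free_alg = (free_vs UNIV)
    \<lparr>mult := (\<lambda>f g w. \<Sum>k\<le>length w. f (take k w) * g (drop k w)), one := delta []\<rparr>"

definition gen_subalg :: "(complex, 'a) module \<Rightarrow> 'a set \<Rightarrow> 'a set"
  where "gen_subalg A S = \<Inter>{B. S \<subseteq> B \<and> subring B A \<and> submodule CC B A}"

abbreviation \<FF> :: "(complex, int list \<Rightarrow> complex) module"
  where "\<FF> \<equiv> free_alg"

abbreviation free_gen :: "int \<Rightarrow> int list \<Rightarrow> complex"
  where "free_gen i \<equiv> delta [i]"

definition bracket :: "nat \<Rightarrow> (int list \<Rightarrow> complex) \<Rightarrow> (int list \<Rightarrow> complex) \<Rightarrow> (int list \<Rightarrow> complex)"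
  where "bracket m a b = a \<otimes>\<^bsub>\<FF>\<^esub> b \<ominus>\<^bsub>\<FF>\<^esub> ((-1) ^ m \<odot>\<^bsub>\<FF>\<^esub> (b \<otimes>\<^bsub>\<FF>\<^esub> a))"

definition gen_rel :: "nat \<Rightarrow> int \<Rightarrow> int \<Rightarrow> int list \<Rightarrow> complex"
  where "gen_rel m r s =
    (\<Oplus>\<^bsub>\<FF>\<^esub>i\<in>{0..m}. ((-1) ^ i * of_nat (m choose i)) \<odot>\<^bsub>\<FF>\<^esub> bracket m (free_gen (r - int i)) (free_gen (s + int i)))"

definition rel_ideal :: "nat \<Rightarrow> (int list \<Rightarrow> complex) set"
  where "rel_ideal m = Idl\<^bsub>\<FF>\<^esub> {gen_rel m r s | r s. True}"

definition \<AA> :: "nat \<Rightarrow> (complex, (int list \<Rightarrow> complex) set) module"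
  where "\<AA> m = quot \<FF> (rel_ideal m)"

definition gen :: "nat \<Rightarrow> int \<Rightarrow> (int list \<Rightarrow> complex) set"
  where "gen m i = rel_ideal m +>\<^bsub>\<FF>\<^esub> free_gen i"

definition \<AA>_pos :: "nat \<Rightarrow> (int list \<Rightarrow> complex) set set"
  where "\<AA>_pos m = gen_subalg (\<AA> m) {gen m i | i. 0 < i}"

text \<open>
  The trivial module \<open>\<complex> v\<close> has \<open>v = 1\<close>. An element of \<open>\<AA>_pos m\<close> acts by the constant term
  (coefficient of the empty word) of any representative in the free algebra; this is the unique
  unital linear action of \<open>\<AA>_pos m\<close> with \<open>v \<cdot> gen m i = 0\<close> for all \<open>i > 0\<close>.
\<close>

definition triv :: "(complex, complex) module"
  where "triv = ring.extend CC (module.fields (*))"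

definition triv_act :: "complex \<Rightarrow> (int list \<Rightarrow> complex) set \<Rightarrow> complex"
  where "triv_act z X = z * quot_map (\<lambda>f. f []) X"

type_synonym ind_elt = "(complex \<times> (int list \<Rightarrow> complex) set \<Rightarrow> complex) set"

definition \<MM> :: "nat \<Rightarrow> (complex, ind_elt) module"
  where "\<MM> m = tensor_prod triv triv_act (\<AA>_pos m) (\<AA> m)"

definition vac :: "nat \<Rightarrow> ind_elt"
  where "vac m = pure_tensor triv triv_act (\<AA>_pos m) (\<AA> m) 1 \<one>\<^bsub>\<AA> m\<^esub>"

definition \<MM>_act :: "nat \<Rightarrow> ind_elt \<Rightarrow> (int list \<Rightarrow> complex) set \<Rightarrow> ind_elt"
  where "\<MM>_act m = tensor_act triv triv_act (\<AA>_pos m) (\<AA> m)"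

definition \<AA>_nonneg :: "nat \<Rightarrow> (complex, (int list \<Rightarrow> complex) set) module"
  where "\<AA>_nonneg m = (\<AA> m)\<lparr>carrier := lspan (\<AA> m) {gen m i | i. 0 \<le> i}\<rparr>"

text \<open>The linear map with \<open>a\<^sub>1 \<otimes> \<dots> \<otimes> a\<^sub>n \<mapsto> v a\<^sub>1 \<cdots> a\<^sub>n\<close>.\<close>

definition mult_map :: "nat \<Rightarrow> ((int list \<Rightarrow> complex) set list \<Rightarrow> complex) set \<Rightarrow> ind_elt"
  where "mult_map m = quot_map (lin_ext (\<MM> m) (\<lambda>as. foldl (\<MM>_act m) (vac m) as))"

definition \<PP> :: "nat \<Rightarrow> nat \<Rightarrow> (complex, ind_elt) module"
  where "\<PP> m n = (\<MM> m)\<lparr>carrier := mult_map m ` carrier (tensor_power n (\<AA>_nonneg m))\<rparr>"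

definition fuss_catalan :: "nat \<Rightarrow> nat \<Rightarrow> rat"
  where "fuss_catalan m n = 1 / of_nat (m * n + 1) * of_nat (((m + 1) * n) choose n)"


section \<open>Well-definedness\<close>

text \<open>
  The facts below justify the encodings: all quotient maps above are independent of
  representatives (\<open>triv_act_coset\<close>, \<open>tensor_act_pure\<close>, \<open>mult_map_pure\<close>), \<open>triv_act\<close> is a unital
  action in which every generator acts by zero (\<open>triv_act_gen\<close>, \<open>triv_act_one\<close>, \<open>triv_act_mult\<close>,
  \<open>triv_act_linear\<close>), \<open>\<MM>_act\<close> is a right action of \<open>\<AA> m\<close>, and \<open>\<PP> m n\<close> is a vector space.
\<close>

lemma CC_simps [simp]:
  "carrier CC = UNIV" "mult CC = (*)" "one CC = 1" "zero CC = 0" "add CC = (+)"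
  by (simp_all add: CC_def)

lemma field_CC: "field CC"
proof -
  have "cring CC"
    by (rule cringI; (rule abelian_groupI | rule comm_monoidI)?)
       (auto simp: algebra_simps intro: exI[of _ "- _"] add.left_inverse)
  then show ?thesis
    by (rule cring.cring_fieldI)
       (auto simp: Units_def, metis left_inverse mult.commute)
qed

lemma cring_CC: "cring CC"
  using field_CC field.axioms(1) domain.axioms(1) by blast

lemma free_vs_simps [simp]:
  "zero (free_vs S) = (\<lambda>x. 0)" "add (free_vs S) = (\<lambda>f g x. f x + g x)"
  "smult (free_vs S) = (\<lambda>c f x. c * f x)"
  by (simp_all add: free_vs_def)

lemma free_vs_carrier: "f \<in> carrier (free_vs S) \<longleftrightarrow> finite {x. f x \<noteq> 0} \<and> {x. f x \<noteq> 0} \<subseteq> S"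
  by (simp add: free_vs_def)

lemma free_vs_add_closed:
  assumes "f \<in> carrier (free_vs S)" "g \<in> carrier (free_vs S)"
  shows "(\<lambda>x. f x + g x) \<in> carrier (free_vs S)"
proof -
  have "{x. f x + g x \<noteq> 0} \<subseteq> {x. f x \<noteq> 0} \<union> {x. g x \<noteq> 0}" by auto
  with assms show ?thesis unfolding free_vs_carrier
    by (meson finite_UnI finite_subset le_sup_iff order_trans)
qed

lemma free_vs_smult_closed:
  assumes "f \<in> carrier (free_vs S)"
  shows "(\<lambda>x. c * f x) \<in> carrier (free_vs S)"
proof -
  have "{x. c * f x \<noteq> 0} \<subseteq> {x. f x \<noteq> 0}" by auto
  with assms show ?thesis unfolding free_vs_carrier
    by (meson finite_subset order_trans)
qed

lemma module_free_vs: "module CC (free_vs S)"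
proof (rule moduleI[OF cring_CC])
  show "abelian_group (free_vs S)"
  proof (rule abelian_groupI)
    fix f assume "f \<in> carrier (free_vs S)"
    then have "(\<lambda>x. (-1) * f x) \<in> carrier (free_vs S)" by (rule free_vs_smult_closed)
    then show "\<exists>g\<in>carrier (free_vs S). g \<oplus>\<^bsub>free_vs S\<^esub> f = \<zero>\<^bsub>free_vs S\<^esub>"
      by (rule rev_bexI) (simp add: fun_eq_iff)
  qed (auto simp: free_vs_add_closed algebra_simps fun_eq_iff, simp add: free_vs_carrier)
qed (auto simp: free_vs_smult_closed algebra_simps fun_eq_iff)

lemma delta_in_free_vs: "x \<in> S \<Longrightarrow> delta x \<in> carrier (free_vs S)"
  by (auto simp: free_vs_carrier delta_def)


lemma module_abelian_group: "module R V \<Longrightarrow> abelian_group V"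
  by (simp add: module_def)

lemma submodule_abelian_subgroup:
  assumes "submodule R U V"
  shows "abelian_subgroup U V"
proof -
  interpret submodule R U V by fact
  interpret V: module R V by (rule module)
  have "\<ominus>\<^bsub>V\<^esub> x \<in> U" if "x \<in> U" for x
    using that subset smult_closed[of "\<ominus>\<^bsub>R\<^esub> \<one>\<^bsub>R\<^esub>" x] V.smult_minus_1[of x] by (auto simp: subset_iff)
  then show ?thesis
    using V.abelian_group_axioms subset zero_closed m_closed
    by (intro abelian_subgroupI3 additive_subgroup.intro V.add.subgroupI)
       (auto simp: a_inv_def simp del: zero_closed)
qed

lemma quot_simps:
  "carrier (quot V U) = a_rcosets\<^bsub>V\<^esub> U" "zero (quot V U) = U" "add (quot V U) = set_add V"
  "mult (quot V U) = rcoset_mult V U" "one (quot V U) = U +>\<^bsub>V\<^esub> \<one>\<^bsub>V\<^esub>"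
  "smult (quot V U) = (\<lambda>c X. \<Union>x\<in>X. U +>\<^bsub>V\<^esub> (c \<odot>\<^bsub>V\<^esub> x))"
  by (simp_all add: quot_def FactRing_def ring.defs module.defs)

lemma quot_carrier: "carrier (quot V U) = (\<lambda>x. U +>\<^bsub>V\<^esub> x) ` carrier V"
  by (auto simp: quot_simps A_RCOSETS_def' )


lemma module_homI:
  assumes "\<And>x. x \<in> carrier M \<Longrightarrow> f x \<in> carrier N"
    and "\<And>x y. x \<in> carrier M \<Longrightarrow> y \<in> carrier M \<Longrightarrow> f (x \<oplus>\<^bsub>M\<^esub> y) = f x \<oplus>\<^bsub>N\<^esub> f y"
    and "\<And>r x. r \<in> carrier R \<Longrightarrow> x \<in> carrier M \<Longrightarrow> f (r \<odot>\<^bsub>M\<^esub> x) = r \<odot>\<^bsub>N\<^esub> f x"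
  shows "f \<in> module_hom R M N"
  using assms by (simp add: module_hom_def)

lemma quot_mapI:
  assumes "x \<in> C" "\<And>y. y \<in> C \<Longrightarrow> h y = h x"
  shows "quot_map h C = h x"
proof -
  have "h ` C = (\<lambda>_. h x) ` C" by (rule image_cong[OF refl assms(2)])
  also have "\<dots> = {h x}" using assms(1) by blast
  finally show ?thesis by (simp add: quot_map_def)
qed

context
  fixes V :: "(complex, 'a) module" and U
  assumes U: "submodule CC U V"
begin

interpretation V: module CC V using U by (rule submodule.module)
interpretation U: submodule CC U V by (rule U)
interpretation AS: abelian_subgroup U V using U by (rule submodule_abelian_subgroup)

lemma in_coset_iff: "y \<in> U +>\<^bsub>V\<^esub> x \<longleftrightarrow> (\<exists>u\<in>U. y = u \<oplus>\<^bsub>V\<^esub> x)"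
  by (auto simp: a_r_coset_def')

lemma coset_eqI:
  assumes "x \<in> carrier V" "u \<in> U"
  shows "U +>\<^bsub>V\<^esub> (u \<oplus>\<^bsub>V\<^esub> x) = U +>\<^bsub>V\<^esub> x"
  using assms by (metis AS.a_repr_independence' in_coset_iff)

lemma coset_eqI':
  assumes "x \<in> carrier V" "y \<in> carrier V" "x \<ominus>\<^bsub>V\<^esub> y \<in> U"
  shows "U +>\<^bsub>V\<^esub> x = U +>\<^bsub>V\<^esub> y"
proof -
  have "x = (x \<ominus>\<^bsub>V\<^esub> y) \<oplus>\<^bsub>V\<^esub> y"
    using assms(1,2) by (simp add: a_minus_def V.M.a_assoc V.M.l_neg)
  then show ?thesis using coset_eqI[OF assms(2,3)] by simp
qed

lemma quot_add:
  assumes "x \<in> carrier V" "y \<in> carrier V"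
  shows "(U +>\<^bsub>V\<^esub> x) \<oplus>\<^bsub>quot V U\<^esub> (U +>\<^bsub>V\<^esub> y) = U +>\<^bsub>V\<^esub> (x \<oplus>\<^bsub>V\<^esub> y)"
  using assms by (simp add: quot_simps AS.a_rcos_sum)

lemma quot_smult:
  assumes "x \<in> carrier V"
  shows "c \<odot>\<^bsub>quot V U\<^esub> (U +>\<^bsub>V\<^esub> x) = U +>\<^bsub>V\<^esub> (c \<odot>\<^bsub>V\<^esub> x)"
proof -
  have *: "U +>\<^bsub>V\<^esub> (c \<odot>\<^bsub>V\<^esub> y) = U +>\<^bsub>V\<^esub> (c \<odot>\<^bsub>V\<^esub> x)" if "y \<in> U +>\<^bsub>V\<^esub> x" for y
  proof -
    from that obtain u where u: "u \<in> U" "y = u \<oplus>\<^bsub>V\<^esub> x" by (auto simp: in_coset_iff)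
    then have "c \<odot>\<^bsub>V\<^esub> y = (c \<odot>\<^bsub>V\<^esub> u) \<oplus>\<^bsub>V\<^esub> (c \<odot>\<^bsub>V\<^esub> x)"
      using assms U.subset by (auto simp: V.smult_r_distr subset_iff)
    then show ?thesis using u assms U.smult_closed[of c u] by (simp add: coset_eqI)
  qed
  have x: "x \<in> U +>\<^bsub>V\<^esub> x" using assms by (rule AS.a_rcos_self)
  have "(\<Union>y\<in>U +>\<^bsub>V\<^esub> x. U +>\<^bsub>V\<^esub> (c \<odot>\<^bsub>V\<^esub> y)) = (\<Union>y\<in>U +>\<^bsub>V\<^esub> x. U +>\<^bsub>V\<^esub> (c \<odot>\<^bsub>V\<^esub> x))"
    by (rule SUP_cong[OF refl *])
  also have "\<dots> = U +>\<^bsub>V\<^esub> (c \<odot>\<^bsub>V\<^esub> x)"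
    using x by blast
  finally show ?thesis by (simp add: quot_simps)
qed

lemma quot_zero: "\<zero>\<^bsub>quot V U\<^esub> = U +>\<^bsub>V\<^esub> \<zero>\<^bsub>V\<^esub>"
  using AS.a_rcos_const[OF U.zero_closed] by (simp add: quot_simps)

lemma module_quot: "module CC (quot V U)"
proof (rule moduleI[OF cring_CC])
  show "abelian_group (quot V U)"
  proof (rule abelian_groupI)
    fix X assume "X \<in> carrier (quot V U)"
    then obtain x where x: "x \<in> carrier V" "X = U +>\<^bsub>V\<^esub> x" by (auto simp: quot_carrier)
    then have "(U +>\<^bsub>V\<^esub> (\<ominus>\<^bsub>V\<^esub> x)) \<oplus>\<^bsub>quot V U\<^esub> X = \<zero>\<^bsub>quot V U\<^esub>"
      by (simp add: quot_add quot_zero V.M.l_neg)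
    then show "\<exists>Y\<in>carrier (quot V U). Y \<oplus>\<^bsub>quot V U\<^esub> X = \<zero>\<^bsub>quot V U\<^esub>"
      using x by (auto simp: quot_carrier)
  qed (auto simp: quot_carrier quot_add quot_zero V.M.a_ac)
next
  fix c X assume "X \<in> carrier (quot V U)"
  then show "c \<odot>\<^bsub>quot V U\<^esub> X \<in> carrier (quot V U)"
    by (auto simp: quot_carrier quot_smult)
next
  fix c d X assume "X \<in> carrier (quot V U)"
  then obtain x where x: "x \<in> carrier V" "X = U +>\<^bsub>V\<^esub> x" by (auto simp: quot_carrier)
  then show "(c \<oplus>\<^bsub>CC\<^esub> d) \<odot>\<^bsub>quot V U\<^esub> X = c \<odot>\<^bsub>quot V U\<^esub> X \<oplus>\<^bsub>quot V U\<^esub> d \<odot>\<^bsub>quot V U\<^esub> X"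
    using V.smult_l_distr[of c d x] by (simp add: quot_smult quot_add)
  show "(c \<otimes>\<^bsub>CC\<^esub> d) \<odot>\<^bsub>quot V U\<^esub> X = c \<odot>\<^bsub>quot V U\<^esub> (d \<odot>\<^bsub>quot V U\<^esub> X)"
    using x V.smult_assoc1[of c d x] by (simp add: quot_smult)
next
  fix c X Y assume "X \<in> carrier (quot V U)" "Y \<in> carrier (quot V U)"
  then obtain x y where x: "x \<in> carrier V" "X = U +>\<^bsub>V\<^esub> x" "y \<in> carrier V" "Y = U +>\<^bsub>V\<^esub> y"
    by (auto simp: quot_carrier)
  then show "c \<odot>\<^bsub>quot V U\<^esub> (X \<oplus>\<^bsub>quot V U\<^esub> Y) = c \<odot>\<^bsub>quot V U\<^esub> X \<oplus>\<^bsub>quot V U\<^esub> c \<odot>\<^bsub>quot V U\<^esub> Y"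
    using V.smult_r_distr[of c x y] by (simp add: quot_smult quot_add)
next
  fix X assume "X \<in> carrier (quot V U)"
  then obtain x where x: "x \<in> carrier V" "X = U +>\<^bsub>V\<^esub> x" by (auto simp: quot_carrier)
  then show "\<one>\<^bsub>CC\<^esub> \<odot>\<^bsub>quot V U\<^esub> X = X"
    using V.smult_one[of x] by (simp add: quot_smult)
qed

lemma coset_hom: "(+>\<^bsub>V\<^esub>) U \<in> module_hom CC V (quot V U)"
proof (rule module_homI)
  show "U +>\<^bsub>V\<^esub> x \<in> carrier (quot V U)" if "x \<in> carrier V" for x
    using that by (simp add: quot_carrier)
qed (simp_all add: quot_add quot_smult)

lemma quot_map_coset:
  assumes "h \<in> module_hom CC V W" "module CC W" "h ` U \<subseteq> {\<zero>\<^bsub>W\<^esub>}" "x \<in> carrier V"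
  shows "quot_map h (U +>\<^bsub>V\<^esub> x) = h x"
proof -
  interpret W: module CC W by fact
  note h = module_hom_closed[OF assms(1)] module_hom_add[OF assms(1)]
  have "h y = h x" if "y \<in> U +>\<^bsub>V\<^esub> x" for y
  proof -
    from that obtain u where u: "u \<in> U" "y = u \<oplus>\<^bsub>V\<^esub> x" unfolding in_coset_iff by blast
    have "u \<in> carrier V" using u(1) U.subset by blast
    then have "h y = h u \<oplus>\<^bsub>W\<^esub> h x" unfolding u(2) using assms(4) by (rule h(2))
    moreover have "h u = \<zero>\<^bsub>W\<^esub>" using u assms(3) by blast
    moreover have "h x \<in> carrier W" using h(1) assms(4) by (rule Pi_mem)
    ultimately show ?thesis by (simp only: W.M.l_zero)
  qed
  moreover have "x \<in> U +>\<^bsub>V\<^esub> x" using assms(4) by (rule AS.a_rcos_self)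
  ultimately show ?thesis by (rule quot_mapI[rotated])
qed

lemma quot_map_hom:
  assumes "h \<in> module_hom CC V W" "module CC W" "h ` U \<subseteq> {\<zero>\<^bsub>W\<^esub>}"
  shows "quot_map h \<in> module_hom CC (quot V U) W"
proof -
  note h = module_hom_closed[OF assms(1)] module_hom_add[OF assms(1)] module_hom_smult[OF assms(1)]
  note q = quot_map_coset[OF assms]
  show ?thesis
  proof (rule module_homI)
    fix X assume "X \<in> carrier (quot V U)"
    then obtain x where x: "x \<in> carrier V" "X = U +>\<^bsub>V\<^esub> x" by (auto simp: quot_carrier)
    show "quot_map h X \<in> carrier W" unfolding x(2) q[OF x(1)] using h(1) x(1) by (rule Pi_mem)
    show "quot_map h (c \<odot>\<^bsub>quot V U\<^esub> X) = c \<odot>\<^bsub>W\<^esub> quot_map h X" for c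
      using x h(3)[of c x] V.smult_closed[of c x] by (simp add: q quot_smult)
    fix Y assume "Y \<in> carrier (quot V U)"
    then obtain y where y: "y \<in> carrier V" "Y = U +>\<^bsub>V\<^esub> y" by (auto simp: quot_carrier)
    show "quot_map h (X \<oplus>\<^bsub>quot V U\<^esub> Y) = quot_map h X \<oplus>\<^bsub>W\<^esub> quot_map h Y"
      using x y h(2)[of x y] by (simp add: q quot_add)
  qed
qed

end

lemma lspan_submodule:
  assumes "module CC V" "S \<subseteq> carrier V"
  shows "submodule CC (lspan V S) V"
  using assms by (rule module.span_is_submodule)

lemma hom_lspan_zero:
  assumes "module CC V" "module CC W" "h \<in> module_hom CC V W" "S \<subseteq> carrier V" "h ` S \<subseteq> {\<zero>\<^bsub>W\<^esub>}"
  shows "h ` lspan V S \<subseteq> {\<zero>\<^bsub>W\<^esub>}"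
proof -
  interpret mod_hom CC V W h
    using assms by (simp add: mod_hom_def mod_hom_axioms_def)
  have "S \<subseteq> ker" using assms(4,5) unfolding ker_def by blast
  then have "lspan V S \<subseteq> ker"
    by (rule M.span_is_subset[OF _ ker_is_submodule])
  then show ?thesis unfolding ker_def by blast
qed

lemma lin_ext_superset:
  assumes "module CC V" "\<phi> \<in> S \<rightarrow> carrier V" "finite T" "{x. f x \<noteq> 0} \<subseteq> T" "T \<subseteq> S"
  shows "lin_ext V \<phi> f = (\<Oplus>\<^bsub>V\<^esub>x\<in>T. f x \<odot>\<^bsub>V\<^esub> \<phi> x)"
proof -
  interpret V: module CC V by fact
  have ph: "\<phi> x \<in> carrier V" if "x \<in> T" for x using that assms(2,5) by auto
  have "f x \<odot>\<^bsub>V\<^esub> \<phi> x = \<zero>\<^bsub>V\<^esub>" if "x \<in> T - {x. f x \<noteq> 0}" for x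
    using that V.smult_l_null[OF ph[of x]] by simp
  moreover have "(\<lambda>x. f x \<odot>\<^bsub>V\<^esub> \<phi> x) \<in> T \<rightarrow> carrier V"
    by (intro Pi_I V.smult_closed ph) simp_all
  ultimately show ?thesis unfolding lin_ext_def
    using assms(3,4) by (intro V.M.add.finprod_mono_neutral_cong_left) simp_all
qed

lemma lin_ext_hom:
  assumes V: "module CC V" and phi: "\<phi> \<in> S \<rightarrow> carrier V"
  shows "lin_ext V \<phi> \<in> module_hom CC (free_vs S) V"
proof -
  interpret V: module CC V by fact
  have ph: "\<phi> x \<in> carrier V" if "x \<in> S" for x using that phi by auto
  have closed: "(\<lambda>x. f x \<odot>\<^bsub>V\<^esub> \<phi> x) \<in> T \<rightarrow> carrier V" if "T \<subseteq> S" for T and f :: "_ \<Rightarrow> complex"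
    using that by (intro Pi_I V.smult_closed ph) auto
  show ?thesis
  proof (rule module_homI, goal_cases)
    case (1 f)
    then have "{x. f x \<noteq> 0} \<subseteq> S" by (simp add: free_vs_carrier)
    then show ?case unfolding lin_ext_def by (intro V.M.finsum_closed closed)
  next
    case (2 f g)
    let ?T = "{x. f x \<noteq> 0} \<union> {x. g x \<noteq> 0}"
    from 2 have T: "finite ?T" "?T \<subseteq> S" by (auto simp: free_vs_carrier)
    have "lin_ext V \<phi> (f \<oplus>\<^bsub>free_vs S\<^esub> g) = (\<Oplus>\<^bsub>V\<^esub>x\<in>?T. (f x + g x) \<odot>\<^bsub>V\<^esub> \<phi> x)"
      by (subst lin_ext_superset[OF V phi T(1) _ T(2)]) auto
    also have "\<dots> = (\<Oplus>\<^bsub>V\<^esub>x\<in>?T. f x \<odot>\<^bsub>V\<^esub> \<phi> x \<oplus>\<^bsub>V\<^esub> g x \<odot>\<^bsub>V\<^esub> \<phi> x)"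
    proof (rule V.M.finsum_cong'[OF refl])
      fix x assume "x \<in> ?T"
      then have "\<phi> x \<in> carrier V" using T(2) by (intro ph) blast
      then show "(f x + g x) \<odot>\<^bsub>V\<^esub> \<phi> x = f x \<odot>\<^bsub>V\<^esub> \<phi> x \<oplus>\<^bsub>V\<^esub> g x \<odot>\<^bsub>V\<^esub> \<phi> x"
        using V.smult_l_distr[of "f x" "g x" "\<phi> x"] by simp
    qed (use closed[OF T(2)] in \<open>simp add: Pi_iff\<close>)
    also have "\<dots> = (\<Oplus>\<^bsub>V\<^esub>x\<in>?T. f x \<odot>\<^bsub>V\<^esub> \<phi> x) \<oplus>\<^bsub>V\<^esub> (\<Oplus>\<^bsub>V\<^esub>x\<in>?T. g x \<odot>\<^bsub>V\<^esub> \<phi> x)"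
      by (rule V.M.finsum_addf[OF closed[OF T(2)] closed[OF T(2)]])
    also have "(\<Oplus>\<^bsub>V\<^esub>x\<in>?T. f x \<odot>\<^bsub>V\<^esub> \<phi> x) = lin_ext V \<phi> f"
      by (rule lin_ext_superset[OF V phi T(1) _ T(2), symmetric]) auto
    also have "(\<Oplus>\<^bsub>V\<^esub>x\<in>?T. g x \<odot>\<^bsub>V\<^esub> \<phi> x) = lin_ext V \<phi> g"
      by (rule lin_ext_superset[OF V phi T(1) _ T(2), symmetric]) auto
    finally show ?case .
  next
    case (3 c f)
    let ?T = "{x. f x \<noteq> 0}"
    from 3 have T: "finite ?T" "?T \<subseteq> S" by (auto simp: free_vs_carrier)
    have "lin_ext V \<phi> (c \<odot>\<^bsub>free_vs S\<^esub> f) = (\<Oplus>\<^bsub>V\<^esub>x\<in>?T. (c * f x) \<odot>\<^bsub>V\<^esub> \<phi> x)"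
      by (subst lin_ext_superset[OF V phi T(1) _ T(2)]) auto
    also have "\<dots> = (\<Oplus>\<^bsub>V\<^esub>x\<in>?T. c \<odot>\<^bsub>V\<^esub> (f x \<odot>\<^bsub>V\<^esub> \<phi> x))"
    proof (rule V.M.finsum_cong'[OF refl])
      fix x assume "x \<in> ?T"
      then have "\<phi> x \<in> carrier V" using T(2) by (intro ph) blast
      then show "(c * f x) \<odot>\<^bsub>V\<^esub> \<phi> x = c \<odot>\<^bsub>V\<^esub> (f x \<odot>\<^bsub>V\<^esub> \<phi> x)"
        using V.smult_assoc1[of c "f x" "\<phi> x"] by simp
    qed (use T(2) in \<open>intro Pi_I V.smult_closed ph, auto\<close>)
    also have "\<dots> = c \<odot>\<^bsub>V\<^esub> lin_ext V \<phi> f"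
      unfolding lin_ext_def
      by (rule V.finsum_smult[symmetric]) (use T(1) closed[OF T(2)] in auto)
    finally show ?case .
  qed
qed

lemma lin_ext_delta:
  assumes "module CC V" "\<phi> x \<in> carrier V"
  shows "lin_ext V \<phi> (delta x) = \<phi> x"
proof -
  interpret V: module CC V by fact
  have "{y. delta x y \<noteq> 0} = {x}" by (auto simp: delta_def)
  moreover have "1 \<odot>\<^bsub>V\<^esub> \<phi> x = \<phi> x" using V.smult_one[OF assms(2)] by simp
  ultimately show ?thesis using assms(2) by (simp add: lin_ext_def, simp add: delta_def)
qed

subsection \<open>The free algebra\<close>

lemma free_alg_simps [simp]:
  "carrier free_alg = carrier (free_vs UNIV)"
  "zero free_alg = (\<lambda>x. 0)" "add free_alg = (\<lambda>f g x. f x + g x)"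
  "smult free_alg = (\<lambda>c f x. c * f x)" "one free_alg = delta []"
  "mult free_alg = (\<lambda>f g w. \<Sum>k\<le>length w. f (take k w) * g (drop k w))"
  by (simp_all add: free_alg_def)

lemma module_free_alg: "module CC (free_alg :: (complex, 'x list \<Rightarrow> complex) module)"
proof -
  show ?thesis
  proof (rule moduleI[OF cring_CC])
    show "abelian_group (free_alg :: (complex, 'x list \<Rightarrow> complex) module)"
    proof (rule abelian_groupI)
      fix f :: "'x list \<Rightarrow> complex" assume "f \<in> carrier free_alg"
      then have "(\<lambda>x. (-1) * f x) \<in> carrier (free_vs UNIV)"
        by (intro free_vs_smult_closed) simp
      then show "\<exists>g\<in>carrier free_alg. g \<oplus>\<^bsub>free_alg\<^esub> f = \<zero>\<^bsub>free_alg\<^esub>"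
        by (intro bexI[where x = "\<lambda>x. (-1) * f x"]) (simp_all add: fun_eq_iff)
    qed (auto simp: free_vs_add_closed algebra_simps fun_eq_iff, simp add: free_vs_carrier)
  qed (auto simp: free_vs_smult_closed algebra_simps fun_eq_iff)
qed

lemma ring_free_alg: "ring (free_alg :: (complex, 'x list \<Rightarrow> complex) module)"
proof (rule ringI)
  show "abelian_group (free_alg :: (complex, 'x list \<Rightarrow> complex) module)" by (rule module_abelian_group[OF module_free_alg])
  show "Group.monoid (free_alg :: (complex, 'x list \<Rightarrow> complex) module)"
  proof (rule monoidI)
    fix f g :: "'x list \<Rightarrow> complex"
    assume fg: "f \<in> carrier free_alg" "g \<in> carrier free_alg"
    have "{w. (f \<otimes>\<^bsub>free_alg\<^esub> g) w \<noteq> 0} \<subseteq> (\<lambda>(u, v). u @ v) ` ({x. f x \<noteq> 0} \<times> {x. g x \<noteq> 0})"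
    proof
      fix w assume "w \<in> {w. (f \<otimes>\<^bsub>free_alg\<^esub> g) w \<noteq> 0}"
      then have "(\<Sum>k\<le>length w. f (take k w) * g (drop k w)) \<noteq> 0" by simp
      then obtain k where "f (take k w) * g (drop k w) \<noteq> 0" by (meson sum.not_neutral_contains_not_neutral)
      then show "w \<in> (\<lambda>(u, v). u @ v) ` ({x. f x \<noteq> 0} \<times> {x. g x \<noteq> 0})"
        by (intro image_eqI[of _ _ "(take k w, drop k w)"]) auto
    qed
    moreover have "finite ((\<lambda>(u, v). u @ v) ` ({x. f x \<noteq> 0} \<times> {x. g x \<noteq> 0}))"
      using fg by (simp add: free_vs_carrier)
    ultimately show "f \<otimes>\<^bsub>free_alg\<^esub> g \<in> carrier free_alg"
      by (auto simp: free_vs_carrier intro: finite_subset)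
  next
    show "\<one>\<^bsub>free_alg\<^esub> \<in> carrier (free_alg :: (complex, 'x list \<Rightarrow> complex) module)"
      by (simp add: delta_in_free_vs)
  next
    fix f g h :: "'x list \<Rightarrow> complex"
    show "f \<otimes>\<^bsub>free_alg\<^esub> g \<otimes>\<^bsub>free_alg\<^esub> h = f \<otimes>\<^bsub>free_alg\<^esub> (g \<otimes>\<^bsub>free_alg\<^esub> h)"
    proof
      fix w :: "'x list"
      let ?n = "length w"
      have "(f \<otimes>\<^bsub>free_alg\<^esub> g \<otimes>\<^bsub>free_alg\<^esub> h) w =
          (\<Sum>k\<le>?n. \<Sum>j\<le>k. f (take j w) * g (drop j (take k w)) * h (drop k w))"
        by (auto simp: sum_distrib_right min_def intro!: sum.cong)
      also have "\<dots> = (\<Sum>(k, j)\<in>(SIGMA k:{..?n}. {..k}). f (take j w) * g (drop j (take k w)) * h (drop k w))"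
        by (simp add: sum.Sigma)
      also have "\<dots> = (\<Sum>(j, l)\<in>(SIGMA j:{..?n}. {..?n - j}). f (take j w) * g (drop j (take (j + l) w)) * h (drop (j + l) w))"
        by (rule sum.reindex_bij_witness[of _ "\<lambda>(j, l). (j + l, j)" "\<lambda>(k, j). (j, k - j)"]) auto
      also have "\<dots> = (\<Sum>j\<le>?n. \<Sum>l\<le>?n - j. f (take j w) * g (drop j (take (j + l) w)) * h (drop (j + l) w))"
        by (simp add: sum.Sigma)
      also have "\<dots> = (f \<otimes>\<^bsub>free_alg\<^esub> (g \<otimes>\<^bsub>free_alg\<^esub> h)) w"
        by (auto simp: sum_distrib_left drop_take algebra_simps intro!: sum.cong)
      finally show "(f \<otimes>\<^bsub>free_alg\<^esub> g \<otimes>\<^bsub>free_alg\<^esub> h) w = (f \<otimes>\<^bsub>free_alg\<^esub> (g \<otimes>\<^bsub>free_alg\<^esub> h)) w" .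
    qed
  next
    fix f :: "'x list \<Rightarrow> complex"
    show "\<one>\<^bsub>free_alg\<^esub> \<otimes>\<^bsub>free_alg\<^esub> f = f"
    proof
      fix w :: "'x list"
      have "(\<Sum>k\<le>length w. delta [] (take k w) * f (drop k w)) = (\<Sum>k\<le>length w. if k = 0 then f w else 0)"
        by (intro sum.cong) (auto simp: delta_def)
      then show "(\<one>\<^bsub>free_alg\<^esub> \<otimes>\<^bsub>free_alg\<^esub> f) w = f w" by simp
    qed
    show "f \<otimes>\<^bsub>free_alg\<^esub> \<one>\<^bsub>free_alg\<^esub> = f"
    proof
      fix w :: "'x list"
      have "(\<Sum>k\<le>length w. f (take k w) * delta [] (drop k w)) = (\<Sum>k\<le>length w. if k = length w then f w else 0)"
        by (intro sum.cong) (auto simp: delta_def)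
      then show "(f \<otimes>\<^bsub>free_alg\<^esub> \<one>\<^bsub>free_alg\<^esub>) w = f w" by simp
    qed
  qed
qed (auto simp: algebra_simps sum.distrib fun_eq_iff)

lemma free_alg_smult_mult:
  "(c \<odot>\<^bsub>free_alg\<^esub> f) \<otimes>\<^bsub>free_alg\<^esub> g = c \<odot>\<^bsub>free_alg\<^esub> (f \<otimes>\<^bsub>free_alg\<^esub> g)"
  "f \<otimes>\<^bsub>free_alg\<^esub> (c \<odot>\<^bsub>free_alg\<^esub> g) = c \<odot>\<^bsub>free_alg\<^esub> (f \<otimes>\<^bsub>free_alg\<^esub> g)"
  by (simp_all add: fun_eq_iff sum_distrib_left algebra_simps)

lemma delta_append: "delta u \<otimes>\<^bsub>free_alg\<^esub> delta v = delta (u @ v)"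
proof
  fix w
  have "(\<Sum>k\<le>length w. delta u (take k w) * delta v (drop k w)) =
      (\<Sum>k\<le>length w. if k = length u then delta (u @ v) w else 0)"
  proof (rule sum.cong[OF refl])
    fix k assume "k \<in> {..length w}"
    then have k: "length (take k w) = k" by simp
    show "delta u (take k w) * delta v (drop k w) = (if k = length u then delta (u @ v) w else 0)"
    proof (cases "k = length u")
      case True
      have "w = u @ v \<longleftrightarrow> take k w = u \<and> drop k w = v"
        using append_eq_conv_conj[of u v w] unfolding True by auto
      then show ?thesis using True by (simp add: delta_def)
    next
      case False
      then have "take k w \<noteq> u" using k by metis
      then show ?thesis using False by (simp add: delta_def)
    qed
  qed
  moreover have "delta (u @ v) w = 0" if "\<not> length u \<le> length w"
    using that by (auto simp: delta_def)
  ultimately show "(delta u \<otimes>\<^bsub>free_alg\<^esub> delta v) w = delta (u @ v) w"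
    by simp
qed

lemma finsum_free_alg:
  fixes f :: "'i \<Rightarrow> 'x list \<Rightarrow> complex"
  assumes "finite T" "\<And>i. i \<in> T \<Longrightarrow> f i \<in> carrier free_alg"
  shows "(\<Oplus>\<^bsub>free_alg\<^esub>i\<in>T. f i) = (\<lambda>x. \<Sum>i\<in>T. f i x)"
proof -
  interpret ring "free_alg :: (complex, 'x list \<Rightarrow> complex) module" by (rule ring_free_alg)
  from assms show ?thesis
    by (induction T rule: finite_induct) (auto simp: Pi_def simp del: free_alg_simps(1))
qed

lemma free_gen_carrier: "free_gen i \<in> carrier \<FF>"
  by (simp add: delta_in_free_vs)

lemma bracket_carrier: "a \<in> carrier \<FF> \<Longrightarrow> b \<in> carrier \<FF> \<Longrightarrow> bracket m a b \<in> carrier \<FF>"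
proof -
  interpret ring \<FF> by (rule ring_free_alg)
  interpret M: module CC \<FF> by (rule module_free_alg)
  show "a \<in> carrier \<FF> \<Longrightarrow> b \<in> carrier \<FF> \<Longrightarrow> bracket m a b \<in> carrier \<FF>"
    unfolding bracket_def by (intro minus_closed m_closed M.smult_closed) auto
qed

lemma gen_rel_carrier: "gen_rel m r s \<in> carrier \<FF>"
proof -
  interpret ring \<FF> by (rule ring_free_alg)
  interpret M: module CC \<FF> by (rule module_free_alg)
  show ?thesis unfolding gen_rel_def
    by (intro finsum_closed Pi_I M.smult_closed bracket_carrier free_gen_carrier) auto
qed


lemma free_vs_minus:
  assumes "f \<in> carrier (free_vs S)" "g \<in> carrier (free_vs S)"
  shows "f \<ominus>\<^bsub>free_vs S\<^esub> g = (\<lambda>x. f x - g x)"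
proof -
  interpret M: module CC "free_vs S" by (rule module_free_vs)
  have "(\<lambda>x. (-1) * g x) \<in> carrier (free_vs S)" using assms(2) by (rule free_vs_smult_closed)
  then have "\<ominus>\<^bsub>free_vs S\<^esub> g = (\<lambda>x. - g x)"
    using assms(2) by (intro M.M.minus_equality) auto
  then show ?thesis by (simp add: a_minus_def)
qed

lemma free_alg_minus:
  assumes "f \<in> carrier free_alg" "g \<in> carrier free_alg"
  shows "f \<ominus>\<^bsub>free_alg\<^esub> g = (\<lambda>x. f x - g x)"
proof -
  interpret M: module CC free_alg by (rule module_free_alg)
  have "(\<lambda>x. (-1) * g x) \<in> carrier free_alg"
    using assms(2) free_vs_smult_closed[of g UNIV "-1"] by simp
  then have "\<ominus>\<^bsub>free_alg\<^esub> g = (\<lambda>x. - g x)"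
    using assms(2) by (intro M.M.minus_equality) auto
  then show ?thesis by (simp add: a_minus_def)
qed

lemma gen_rel_eq:
  "gen_rel m r s = (\<lambda>w. \<Sum>i\<le>m. (-1) ^ i * of_nat (m choose i) *
     (delta [r - int i, s + int i] w - (-1) ^ m * delta [s + int i, r - int i] w))"
proof -
  interpret ring \<FF> by (rule ring_free_alg)
  interpret M: module CC \<FF> by (rule module_free_alg)
  have "bracket m (free_gen i) (free_gen j) = (\<lambda>w. delta [i, j] w - (-1) ^ m * delta [j, i] w)" for i j
    unfolding bracket_def delta_append
    by (subst free_alg_minus) (auto simp: delta_in_free_vs free_vs_smult_closed)
  moreover have "((-1) ^ i * of_nat (m choose i)) \<odot>\<^bsub>\<FF>\<^esub> bracket m (free_gen (r - int i)) (free_gen (s + int i)) \<in> carrier \<FF>" for i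
    by (intro M.smult_closed bracket_carrier free_gen_carrier) auto
  ultimately show ?thesis
    unfolding gen_rel_def by (subst finsum_free_alg) (simp_all add: atLeast0AtMost)
qed

lemma rel_ideal: "ideal (rel_ideal m) \<FF>"
  unfolding rel_ideal_def using gen_rel_carrier
  by (intro ring.genideal_ideal[OF ring_free_alg]) blast

lemma rel_ideal_submodule: "submodule CC (rel_ideal m) \<FF>"
proof -
  interpret ideal "rel_ideal m" \<FF> by (rule rel_ideal)
  show ?thesis
  proof (rule submodule.intro[OF module_free_alg])
    fix c f assume f: "f \<in> rel_ideal m"
    then have "f \<in> carrier \<FF>" using a_subset by blast
    then have "c \<odot>\<^bsub>\<FF>\<^esub> f = (c \<odot>\<^bsub>\<FF>\<^esub> \<one>\<^bsub>\<FF>\<^esub>) \<otimes>\<^bsub>\<FF>\<^esub> f"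
      unfolding free_alg_smult_mult by (simp only: l_one)
    moreover have "c \<odot>\<^bsub>\<FF>\<^esub> \<one>\<^bsub>\<FF>\<^esub> \<in> carrier \<FF>"
      by (simp add: free_vs_smult_closed delta_in_free_vs)
    ultimately show "c \<odot>\<^bsub>\<FF>\<^esub> f \<in> rel_ideal m" using I_l_closed[OF f] by metis
  qed (use a_subset a_closed additive_subgroup.zero_closed[OF is_additive_subgroup] in blast)+
qed

lemma rel_ideal_Nil:
  assumes "f \<in> rel_ideal m"
  shows "f [] = 0"
proof -
  interpret ring \<FF> by (rule ring_free_alg)
  let ?J = "{f \<in> carrier \<FF>. f [] = 0}"
  have "ideal ?J \<FF>"
  proof (rule idealI[OF ring_axioms])
    show "subgroup ?J (add_monoid \<FF>)"
    proof (rule add.subgroupI)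
      fix f assume "f \<in> ?J"
      then have f: "f \<in> carrier \<FF>" "f [] = 0" by blast+
      then have "\<ominus>\<^bsub>\<FF>\<^esub> f = (\<lambda>x. - f x)"
        using free_alg_minus[OF zero_closed f(1)] a_inv_closed[OF f(1)] l_zero[of "\<ominus>\<^bsub>\<FF>\<^esub> f"]
        by (simp add: a_minus_def)
      then have "(\<ominus>\<^bsub>\<FF>\<^esub> f) [] = 0" using f(2) by simp
      then show "\<ominus>\<^bsub>\<FF>\<^esub> f \<in> ?J"
        using a_inv_closed[OF f(1)] by blast
    next
      have "\<zero>\<^bsub>\<FF>\<^esub> \<in> ?J" using zero_closed by simp
      then show "?J \<noteq> {}" by blast
    qed (auto simp: free_vs_add_closed)
  next
    fix a x assume "a \<in> ?J" "x \<in> carrier \<FF>"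
    then show "x \<otimes>\<^bsub>\<FF>\<^esub> a \<in> ?J" "a \<otimes>\<^bsub>\<FF>\<^esub> x \<in> ?J"
      using m_closed[of x a] m_closed[of a x] by auto
  qed
  moreover have "{gen_rel m r s | r s. True} \<subseteq> ?J"
    using gen_rel_carrier by (auto simp: gen_rel_eq delta_def)
  ultimately show ?thesis using assms unfolding rel_ideal_def genideal_def by blast
qed

lemma module_\<AA>: "module CC (\<AA> m)"
  unfolding \<AA>_def by (rule module_quot[OF rel_ideal_submodule])

lemma \<AA>_mult:
  assumes "f \<in> carrier \<FF>" "g \<in> carrier \<FF>"
  shows "(rel_ideal m +>\<^bsub>\<FF>\<^esub> f) \<otimes>\<^bsub>\<AA> m\<^esub> (rel_ideal m +>\<^bsub>\<FF>\<^esub> g) = rel_ideal m +>\<^bsub>\<FF>\<^esub> (f \<otimes>\<^bsub>\<FF>\<^esub> g)"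
  unfolding \<AA>_def quot_simps by (rule ideal.rcoset_mult_add[OF rel_ideal assms])

lemma ring_\<AA>: "ring (\<AA> m)"
proof -
  interpret Q: ring "\<FF> Quot rel_ideal m" by (rule ideal.quotient_is_ring[OF rel_ideal])
  have eqs: "carrier (\<AA> m) = carrier (\<FF> Quot rel_ideal m)" "mult (\<AA> m) = mult (\<FF> Quot rel_ideal m)"
    "add (\<AA> m) = add (\<FF> Quot rel_ideal m)" "one (\<AA> m) = one (\<FF> Quot rel_ideal m)"
    by (simp_all add: \<AA>_def quot_simps FactRing_def)
  show ?thesis
    by (rule ringI[OF module_abelian_group[OF module_\<AA>] monoidI])
       (simp_all add: eqs Q.m_assoc Q.l_distr Q.r_distr)
qed

lemma \<AA>_carrier: "carrier (\<AA> m) = (\<lambda>f. rel_ideal m +>\<^bsub>\<FF>\<^esub> f) ` carrier \<FF>"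
  unfolding \<AA>_def by (rule quot_carrier)

lemma \<AA>_smult:
  "f \<in> carrier \<FF> \<Longrightarrow> c \<odot>\<^bsub>\<AA> m\<^esub> (rel_ideal m +>\<^bsub>\<FF>\<^esub> f) = rel_ideal m +>\<^bsub>\<FF>\<^esub> (c \<odot>\<^bsub>\<FF>\<^esub> f)"
  unfolding \<AA>_def by (rule quot_smult[OF rel_ideal_submodule])

lemma \<AA>_add:
  "f \<in> carrier \<FF> \<Longrightarrow> g \<in> carrier \<FF> \<Longrightarrow>
   (rel_ideal m +>\<^bsub>\<FF>\<^esub> f) \<oplus>\<^bsub>\<AA> m\<^esub> (rel_ideal m +>\<^bsub>\<FF>\<^esub> g) = rel_ideal m +>\<^bsub>\<FF>\<^esub> (f \<oplus>\<^bsub>\<FF>\<^esub> g)"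
  unfolding \<AA>_def by (rule quot_add[OF rel_ideal_submodule])

lemma \<AA>_one: "\<one>\<^bsub>\<AA> m\<^esub> = rel_ideal m +>\<^bsub>\<FF>\<^esub> \<one>\<^bsub>\<FF>\<^esub>"
  unfolding \<AA>_def quot_simps by simp

lemma \<AA>_smult_mult:
  assumes "a \<in> carrier (\<AA> m)" "b \<in> carrier (\<AA> m)"
  shows "(c \<odot>\<^bsub>\<AA> m\<^esub> a) \<otimes>\<^bsub>\<AA> m\<^esub> b = c \<odot>\<^bsub>\<AA> m\<^esub> (a \<otimes>\<^bsub>\<AA> m\<^esub> b)"
    "a \<otimes>\<^bsub>\<AA> m\<^esub> (c \<odot>\<^bsub>\<AA> m\<^esub> b) = c \<odot>\<^bsub>\<AA> m\<^esub> (a \<otimes>\<^bsub>\<AA> m\<^esub> b)"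
proof -
  interpret F: ring \<FF> by (rule ring_free_alg)
  interpret M: module CC \<FF> by (rule module_free_alg)
  obtain f g where fg: "f \<in> carrier \<FF>" "g \<in> carrier \<FF>"
      "a = rel_ideal m +>\<^bsub>\<FF>\<^esub> f" "b = rel_ideal m +>\<^bsub>\<FF>\<^esub> g"
    using assms by (auto simp: \<AA>_carrier simp del: free_alg_simps)
  have cl: "c \<odot>\<^bsub>\<FF>\<^esub> h \<in> carrier \<FF>" if "h \<in> carrier \<FF>" for h
    using that by (intro M.smult_closed) auto
  show "(c \<odot>\<^bsub>\<AA> m\<^esub> a) \<otimes>\<^bsub>\<AA> m\<^esub> b = c \<odot>\<^bsub>\<AA> m\<^esub> (a \<otimes>\<^bsub>\<AA> m\<^esub> b)"
       "a \<otimes>\<^bsub>\<AA> m\<^esub> (c \<odot>\<^bsub>\<AA> m\<^esub> b) = c \<odot>\<^bsub>\<AA> m\<^esub> (a \<otimes>\<^bsub>\<AA> m\<^esub> b)"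
    using fg cl by (simp_all add: \<AA>_smult \<AA>_mult free_alg_smult_mult del: free_alg_simps)
qed

lemma gen_carrier: "gen m i \<in> carrier (\<AA> m)"
  using free_gen_carrier unfolding gen_def \<AA>_carrier by blast

lemma \<AA>_pos_subset: "\<AA>_pos m \<subseteq> carrier (\<AA> m)"
proof -
  interpret M: module CC "\<AA> m" by (rule module_\<AA>)
  have "submodule CC (carrier (\<AA> m)) (\<AA> m)"
    by (rule submodule.intro[OF module_\<AA>]) auto
  then show ?thesis
    unfolding \<AA>_pos_def gen_subalg_def
    using ring.carrier_is_subring[OF ring_\<AA>[of m]] gen_carrier by blast
qed

lemma triv_act_coset:
  assumes "f \<in> carrier \<FF>"
  shows "triv_act z (rel_ideal m +>\<^bsub>\<FF>\<^esub> f) = z * f []"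
proof -
  interpret ideal "rel_ideal m" \<FF> by (rule rel_ideal)
  have "g [] = f []" if "g \<in> rel_ideal m +>\<^bsub>\<FF>\<^esub> f" for g
    using that by (auto simp: a_r_coset_def' rel_ideal_Nil)
  moreover have "f \<in> rel_ideal m +>\<^bsub>\<FF>\<^esub> f" using assms by (rule a_rcos_self)
  ultimately have "quot_map (\<lambda>f. f []) (rel_ideal m +>\<^bsub>\<FF>\<^esub> f) = f []"
    by (rule quot_mapI[rotated])
  then show ?thesis by (simp add: triv_act_def)
qed

lemma triv_act_gen: "triv_act z (gen m i) = 0"
  unfolding gen_def by (subst triv_act_coset[OF free_gen_carrier]) (simp add: delta_def)

lemma triv_act_one: "triv_act z \<one>\<^bsub>\<AA> m\<^esub> = z"
  unfolding \<AA>_one by (subst triv_act_coset) (auto simp: delta_in_free_vs, simp add: delta_def)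

lemma triv_act_mult:
  assumes "a \<in> carrier (\<AA> m)" "b \<in> carrier (\<AA> m)"
  shows "triv_act z (a \<otimes>\<^bsub>\<AA> m\<^esub> b) = triv_act (triv_act z a) b"
proof -
  interpret F: ring \<FF> by (rule ring_free_alg)
  obtain f g where fg: "f \<in> carrier \<FF>" "g \<in> carrier \<FF>"
      "a = rel_ideal m +>\<^bsub>\<FF>\<^esub> f" "b = rel_ideal m +>\<^bsub>\<FF>\<^esub> g"
    using assms by (auto simp: \<AA>_carrier simp del: free_alg_simps)
  have "(f \<otimes>\<^bsub>\<FF>\<^esub> g) [] = f [] * g []" by simp
  then show ?thesis using fg F.m_closed[of f g] by (simp add: \<AA>_mult triv_act_coset del: free_alg_simps)
qed

lemma triv_act_linear:
  assumes "a \<in> carrier (\<AA> m)" "b \<in> carrier (\<AA> m)"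
  shows "triv_act z (a \<oplus>\<^bsub>\<AA> m\<^esub> b) = triv_act z a + triv_act z b"
    "triv_act z (c \<odot>\<^bsub>\<AA> m\<^esub> a) = c * triv_act z a"
proof -
  interpret F: ring \<FF> by (rule ring_free_alg)
  interpret M: module CC \<FF> by (rule module_free_alg)
  obtain f g where fg: "f \<in> carrier \<FF>" "g \<in> carrier \<FF>"
      "a = rel_ideal m +>\<^bsub>\<FF>\<^esub> f" "b = rel_ideal m +>\<^bsub>\<FF>\<^esub> g"
    using assms by (auto simp: \<AA>_carrier simp del: free_alg_simps)
  have cl: "c \<odot>\<^bsub>\<FF>\<^esub> f \<in> carrier \<FF>" "f \<oplus>\<^bsub>\<FF>\<^esub> g \<in> carrier \<FF>"
    using fg by (auto intro!: M.smult_closed simp del: free_alg_simps)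
  show "triv_act z (a \<oplus>\<^bsub>\<AA> m\<^esub> b) = triv_act z a + triv_act z b"
    using fg cl by (simp add: \<AA>_add triv_act_coset del: free_alg_simps) (simp add: algebra_simps)
  show "triv_act z (c \<odot>\<^bsub>\<AA> m\<^esub> a) = c * triv_act z a"
    using fg cl by (simp add: \<AA>_smult triv_act_coset del: free_alg_simps) simp
qed

lemma triv_simps [simp]:
  "carrier triv = UNIV" "zero triv = 0" "add triv = (+)" "smult triv = (*)"
  by (simp_all add: triv_def CC_def ring.defs module.defs)

lemma module_triv: "module CC triv"
proof (rule moduleI[OF cring_CC])
  show "abelian_group triv"
    by (rule abelian_groupI) (auto simp: algebra_simps intro: exI[of _ "- _"] add.left_inverse)
qed (auto simp: algebra_simps)


subsection \<open>Well-definedness of tensor products\<close>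

lemma hom_delta_unique:
  assumes W: "module CC W" and h: "h \<in> module_hom CC (free_vs S) W" and f: "f \<in> carrier (free_vs S)"
  shows "h f = lin_ext W (\<lambda>x. h (delta x)) f"
proof -
  interpret W: module CC W by fact
  interpret F: module CC "free_vs S" by (rule module_free_vs)
  note h' = module_hom_closed[OF h] module_hom_add[OF h] module_hom_smult[OF h]
  let ?\<phi> = "\<lambda>x. h (delta x)"
  have ph: "?\<phi> \<in> S \<rightarrow> carrier W"
    using h'(1) delta_in_free_vs[of _ S] by blast
  note g = lin_ext_hom[OF W ph]
  note g' = module_hom_closed[OF g] module_hom_add[OF g] module_hom_smult[OF g]
  have "h f = lin_ext W ?\<phi> f" if "finite T" "{x. f x \<noteq> 0} \<subseteq> T" "T \<subseteq> S" for T f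
    using that
  proof (induction T arbitrary: f rule: finite_induct)
    case empty
    then have "f = \<zero>\<^bsub>free_vs S\<^esub>" by auto
    then have "f = 0 \<odot>\<^bsub>free_vs S\<^esub> f" by auto
    moreover have fc: "f \<in> carrier (free_vs S)" using empty by (auto simp: free_vs_carrier)
    ultimately show ?case
      using h'(3)[of 0 f] g'(3)[of 0 f] W.smult_l_null[of "h f"] W.smult_l_null[of "lin_ext W ?\<phi> f"]
        Pi_mem[OF h'(1) fc] Pi_mem[OF g'(1) fc] by simp
  next
    case (insert t T)
    define f1 where "f1 = f(t := 0)"
    have 1: "{x. f1 x \<noteq> 0} \<subseteq> T" using insert.prems by (auto simp: f1_def)
    have fc: "f1 \<in> carrier (free_vs S)"
      using 1 insert.prems insert.hyps finite_subset[OF 1] by (auto simp: free_vs_carrier)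
    have dt: "delta t \<in> carrier (free_vs S)" using insert.prems by (intro delta_in_free_vs) blast
    have fd: "f t \<odot>\<^bsub>free_vs S\<^esub> delta t \<in> carrier (free_vs S)" using dt by (intro F.smult_closed) simp_all
    have eq: "f = f1 \<oplus>\<^bsub>free_vs S\<^esub> (f t \<odot>\<^bsub>free_vs S\<^esub> delta t)"
      by (auto simp: f1_def delta_def fun_eq_iff)
    have "h f1 = lin_ext W ?\<phi> f1" using insert.IH[OF 1] insert.prems by blast
    moreover have "lin_ext W ?\<phi> (delta t) = h (delta t)"
      by (rule lin_ext_delta[OF W]) (use h'(1) dt in blast)
    ultimately show ?case
      using h'(2)[OF fc fd] g'(2)[OF fc fd] h'(3)[of "f t" "delta t"] g'(3)[of "f t" "delta t"] dt
      unfolding eq[symmetric] by simp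
  qed
  then show ?thesis using f unfolding free_vs_carrier by blast
qed

lemma hom_free_eqI:
  fixes W :: "(complex, 'w) module"
  assumes "module CC W" "h \<in> module_hom CC (free_vs S) W" "g \<in> module_hom CC (free_vs S) W"
    and "\<And>x. x \<in> S \<Longrightarrow> h (delta x) = g (delta x)" "f \<in> carrier (free_vs S)"
  shows "h f = g f"
proof -
  interpret W: module CC W by fact
  have *: "{x. f x \<noteq> 0} \<subseteq> S" using assms(5) by (simp add: free_vs_carrier)
  have "lin_ext W (\<lambda>x. h (delta x)) f = lin_ext W (\<lambda>x. g (delta x)) f"
    unfolding lin_ext_def
  proof (rule W.M.finsum_cong'[OF refl])
    have "g (delta x) \<in> carrier W" if "f x \<noteq> 0" for x
      using that * delta_in_free_vs[of x S] module_hom_closed[OF assms(3)] by blast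
    then show "(\<lambda>x. f x \<odot>\<^bsub>W\<^esub> g (delta x)) \<in> {x. f x \<noteq> 0} \<rightarrow> carrier W"
      by (intro Pi_I W.smult_closed) auto
  qed (use * assms(4) in auto)
  then show ?thesis
    using hom_delta_unique[OF assms(1,2,5)] hom_delta_unique[OF assms(1,3,5)] by simp
qed

context
  fixes N :: "(complex, 'n) module" and act :: "'n \<Rightarrow> 'b \<Rightarrow> 'n" and B :: "'b set"
    and A :: "(complex, 'b) module"
  assumes N: "module CC N" and AM: "module CC A" and AR: "ring A"
    and A1: "\<And>c a b. a \<in> carrier A \<Longrightarrow> b \<in> carrier A \<Longrightarrow> (c \<odot>\<^bsub>A\<^esub> a) \<otimes>\<^bsub>A\<^esub> b = c \<odot>\<^bsub>A\<^esub> (a \<otimes>\<^bsub>A\<^esub> b)"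
    and A2: "\<And>c a b. a \<in> carrier A \<Longrightarrow> b \<in> carrier A \<Longrightarrow> a \<otimes>\<^bsub>A\<^esub> (c \<odot>\<^bsub>A\<^esub> b) = c \<odot>\<^bsub>A\<^esub> (a \<otimes>\<^bsub>A\<^esub> b)"
    and B: "B \<subseteq> carrier A"
    and act_closed: "\<And>x b. x \<in> carrier N \<Longrightarrow> b \<in> B \<Longrightarrow> act x b \<in> carrier N"
begin

interpretation N: module CC N by (rule N)
interpretation AM: module CC A by (rule AM)
interpretation AR: ring A by (rule AR)

private abbreviation (input) "T \<equiv> free_vs (carrier N \<times> carrier A)"
private abbreviation (input) "Mt \<equiv> tensor_prod N act B A"
private abbreviation (input) "pt \<equiv> pure_tensor N act B A"

interpretation T: module CC T by (rule module_free_vs)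

lemma delta_T: "x \<in> carrier N \<Longrightarrow> a \<in> carrier A \<Longrightarrow> delta (x, a) \<in> carrier T"
  by (rule delta_in_free_vs) simp

lemma balanced_rels_subset: "balanced_rels N act B A \<subseteq> carrier T"
proof -
  have s: "c \<odot>\<^bsub>N\<^esub> x \<in> carrier N" if "x \<in> carrier N" for c x
    using that by (intro N.smult_closed) simp_all
  have s': "c \<odot>\<^bsub>A\<^esub> x \<in> carrier A" if "x \<in> carrier A" for c x
    using that by (intro AM.smult_closed) simp_all
  show ?thesis
    unfolding balanced_rels_def Let_def
    by (intro Un_least subsetI; elim CollectE exE conjE; hypsubst;
        (assumption | rule T.M.minus_closed T.M.a_closed T.smult_closed delta_T N.M.a_closed
          AM.M.a_closed s s' act_closed AR.m_closed | erule subsetD[OF B] | simp)+)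
qed

lemma null_sub: "submodule CC (tensor_null N act B A) T"
  unfolding tensor_null_def by (rule lspan_submodule[OF module_free_vs balanced_rels_subset])

lemma rel_null: "f \<in> balanced_rels N act B A \<Longrightarrow> f \<in> tensor_null N act B A"
  unfolding tensor_null_def using T.in_own_span[OF balanced_rels_subset] by blast

lemma module_tensor_prod: "module CC (tensor_prod N act B A)"
  unfolding tensor_prod_def by (rule module_quot[OF null_sub])

lemma pure_tensor_closed:
  "x \<in> carrier N \<Longrightarrow> a \<in> carrier A \<Longrightarrow> pure_tensor N act B A x a \<in> carrier (tensor_prod N act B A)"
  unfolding tensor_prod_def pure_tensor_def quot_carrier using delta_T by blast

lemma pure_tensor_add_left:
  assumes "x \<in> carrier N" "y \<in> carrier N" "a \<in> carrier A"
  shows "pt (x \<oplus>\<^bsub>N\<^esub> y) a = pt x a \<oplus>\<^bsub>Mt\<^esub> pt y a"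
proof -
  have "delta (x \<oplus>\<^bsub>N\<^esub> y, a) \<ominus>\<^bsub>T\<^esub> (delta (x, a) \<oplus>\<^bsub>T\<^esub> delta (y, a)) \<in> balanced_rels N act B A"
    unfolding balanced_rels_def Let_def using assms by blast
  from coset_eqI'[OF null_sub _ _ rel_null[OF this]] show ?thesis
    unfolding pure_tensor_def tensor_prod_def
    using assms delta_T by (simp only: quot_add[OF null_sub] N.M.a_closed T.M.a_closed)
qed

lemma pure_tensor_add_right:
  assumes "x \<in> carrier N" "a \<in> carrier A" "b \<in> carrier A"
  shows "pt x (a \<oplus>\<^bsub>A\<^esub> b) = pt x a \<oplus>\<^bsub>Mt\<^esub> pt x b"
proof -
  have "delta (x, a \<oplus>\<^bsub>A\<^esub> b) \<ominus>\<^bsub>T\<^esub> (delta (x, a) \<oplus>\<^bsub>T\<^esub> delta (x, b)) \<in> balanced_rels N act B A"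
    unfolding balanced_rels_def Let_def using assms by blast
  from coset_eqI'[OF null_sub _ _ rel_null[OF this]] show ?thesis
    unfolding pure_tensor_def tensor_prod_def
    using assms delta_T by (simp only: quot_add[OF null_sub] AM.M.a_closed T.M.a_closed)
qed

lemma pure_tensor_smult_left:
  assumes "x \<in> carrier N" "a \<in> carrier A"
  shows "pt (c \<odot>\<^bsub>N\<^esub> x) a = c \<odot>\<^bsub>Mt\<^esub> pt x a"
proof -
  have "delta (c \<odot>\<^bsub>N\<^esub> x, a) \<ominus>\<^bsub>T\<^esub> (c \<odot>\<^bsub>T\<^esub> delta (x, a)) \<in> balanced_rels N act B A"
    unfolding balanced_rels_def Let_def using assms by blast
  from coset_eqI'[OF null_sub _ _ rel_null[OF this]] show ?thesis
    unfolding pure_tensor_def tensor_prod_def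
    using assms delta_T N.smult_closed[of c x] T.smult_closed[of c "delta (x, a)"]
    by (simp only: quot_smult[OF null_sub] CC_simps UNIV_I)
qed

lemma pure_tensor_smult_right:
  assumes "x \<in> carrier N" "a \<in> carrier A"
  shows "pt x (c \<odot>\<^bsub>A\<^esub> a) = c \<odot>\<^bsub>Mt\<^esub> pt x a"
proof -
  have "delta (x, c \<odot>\<^bsub>A\<^esub> a) \<ominus>\<^bsub>T\<^esub> (c \<odot>\<^bsub>T\<^esub> delta (x, a)) \<in> balanced_rels N act B A"
    unfolding balanced_rels_def Let_def using assms by blast
  from coset_eqI'[OF null_sub _ _ rel_null[OF this]] show ?thesis
    unfolding pure_tensor_def tensor_prod_def
    using assms delta_T AM.smult_closed[of c a] T.smult_closed[of c "delta (x, a)"]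
    by (simp only: quot_smult[OF null_sub] CC_simps UNIV_I)
qed

lemma pure_tensor_balanced:
  assumes "x \<in> carrier N" "b \<in> B" "a \<in> carrier A"
  shows "pt (act x b) a = pt x (b \<otimes>\<^bsub>A\<^esub> a)"
proof -
  have "delta (act x b, a) \<ominus>\<^bsub>T\<^esub> delta (x, b \<otimes>\<^bsub>A\<^esub> a) \<in> balanced_rels N act B A"
    unfolding balanced_rels_def Let_def using assms by blast
  from coset_eqI'[OF null_sub _ _ rel_null[OF this]] show ?thesis
    unfolding pure_tensor_def
    using assms delta_T act_closed B AR.m_closed by (simp only: subsetD)
qed

lemma lin_ext_balanced:
  assumes W: "module CC W"
    and cl: "\<And>x a. x \<in> carrier N \<Longrightarrow> a \<in> carrier A \<Longrightarrow> \<phi> x a \<in> carrier W"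
    and "\<And>x y a. x \<in> carrier N \<Longrightarrow> y \<in> carrier N \<Longrightarrow> a \<in> carrier A \<Longrightarrow> \<phi> (x \<oplus>\<^bsub>N\<^esub> y) a = \<phi> x a \<oplus>\<^bsub>W\<^esub> \<phi> y a"
    and "\<And>x a b. x \<in> carrier N \<Longrightarrow> a \<in> carrier A \<Longrightarrow> b \<in> carrier A \<Longrightarrow> \<phi> x (a \<oplus>\<^bsub>A\<^esub> b) = \<phi> x a \<oplus>\<^bsub>W\<^esub> \<phi> x b"
    and "\<And>c x a. x \<in> carrier N \<Longrightarrow> a \<in> carrier A \<Longrightarrow> \<phi> (c \<odot>\<^bsub>N\<^esub> x) a = c \<odot>\<^bsub>W\<^esub> \<phi> x a"
    and "\<And>c x a. x \<in> carrier N \<Longrightarrow> a \<in> carrier A \<Longrightarrow> \<phi> x (c \<odot>\<^bsub>A\<^esub> a) = c \<odot>\<^bsub>W\<^esub> \<phi> x a"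
    and "\<And>x b a. x \<in> carrier N \<Longrightarrow> b \<in> B \<Longrightarrow> a \<in> carrier A \<Longrightarrow> \<phi> (act x b) a = \<phi> x (b \<otimes>\<^bsub>A\<^esub> a)"
  defines "h \<equiv> lin_ext W (\<lambda>(x, a). \<phi> x a)"
  shows "h \<in> module_hom CC T W" "h ` tensor_null N act B A \<subseteq> {\<zero>\<^bsub>W\<^esub>}"
proof -
  interpret W: module CC W by fact
  show h: "h \<in> module_hom CC T W" unfolding h_def using cl by (intro lin_ext_hom[OF W]) auto
  interpret h: mod_hom CC T W h
    by (intro mod_hom.intro mod_hom_axioms.intro module_free_vs W h)
  have hd: "h (delta (x, a)) = \<phi> x a" if "x \<in> carrier N" "a \<in> carrier A" for x a
    unfolding h_def using cl[OF that] by (subst lin_ext_delta[OF W]) simp_all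
  have s: "c \<odot>\<^bsub>N\<^esub> x \<in> carrier N" if "x \<in> carrier N" for c x
    using that by (intro N.smult_closed) simp_all
  have s': "c \<odot>\<^bsub>A\<^esub> x \<in> carrier A" if "x \<in> carrier A" for c x
    using that by (intro AM.smult_closed) simp_all
  have sT: "c \<odot>\<^bsub>T\<^esub> x \<in> carrier T" if "x \<in> carrier T" for c x
    using that by (intro T.smult_closed) simp_all
  have sW: "c \<odot>\<^bsub>W\<^esub> x \<in> carrier W" if "x \<in> carrier W" for c x
    using that by (intro W.smult_closed) simp_all
  have z: "w \<ominus>\<^bsub>W\<^esub> w = \<zero>\<^bsub>W\<^esub>" if "w \<in> carrier W" for w
    using that by (simp add: a_minus_def W.M.r_neg)
  have hs: "h (c \<odot>\<^bsub>T\<^esub> f) = c \<odot>\<^bsub>W\<^esub> h f" if "f \<in> carrier T" for c f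
    using module_hom_smult[OF h, of c f] that by simp
  have bc: "b \<in> carrier A" if "b \<in> B" for b using that B by blast
  have "h ` balanced_rels N act B A \<subseteq> {\<zero>\<^bsub>W\<^esub>}"
    unfolding balanced_rels_def Let_def
    by (rule image_subsetI, elim UnE CollectE exE conjE; hypsubst)
       (simp_all only: h.f_minus module_hom_add[OF h] hs hd assms(3-7) s s' sT sW cl z delta_T
         T.M.a_closed N.M.a_closed AM.M.a_closed W.M.a_closed AR.m_closed act_closed bc singleton_iff)
  then show "h ` tensor_null N act B A \<subseteq> {\<zero>\<^bsub>W\<^esub>}"
    unfolding tensor_null_def by (rule hom_lspan_zero[OF module_free_vs W h balanced_rels_subset])
qed

lemma tensor_act_lin_ext:
  assumes b: "b \<in> carrier A"
  defines "h \<equiv> lin_ext Mt (\<lambda>(x, a). pt x (a \<otimes>\<^bsub>A\<^esub> b))"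
  shows "h \<in> module_hom CC T Mt" "h ` tensor_null N act B A \<subseteq> {\<zero>\<^bsub>Mt\<^esub>}"
  unfolding h_def
  by (rule lin_ext_balanced[OF module_tensor_prod, where \<phi> = "\<lambda>x a. pt x (a \<otimes>\<^bsub>A\<^esub> b)"];
      use b B AM.smult_closed in \<open>simp add: pure_tensor_closed pure_tensor_add_left pure_tensor_add_right
         pure_tensor_smult_left pure_tensor_smult_right pure_tensor_balanced AR.l_distr A1 AR.m_assoc subset_iff\<close>)+

lemma tensor_act_coset:
  assumes "b \<in> carrier A" "f \<in> carrier T"
  shows "tensor_act N act B A (tensor_null N act B A +>\<^bsub>T\<^esub> f) b =
    lin_ext Mt (\<lambda>(x, a). pt x (a \<otimes>\<^bsub>A\<^esub> b)) f"
  unfolding tensor_act_def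
  by (rule quot_map_coset[OF null_sub tensor_act_lin_ext(1)[OF assms(1)] module_tensor_prod
        tensor_act_lin_ext(2)[OF assms(1)] assms(2)])

lemma tensor_act_pure:
  assumes "x \<in> carrier N" "a \<in> carrier A" "b \<in> carrier A"
  shows "tensor_act N act B A (pt x a) b = pt x (a \<otimes>\<^bsub>A\<^esub> b)"
  unfolding pure_tensor_def[of _ _ _ _ x a] tensor_act_coset[OF assms(3) delta_T[OF assms(1,2)]]
  using assms by (subst lin_ext_delta[OF module_tensor_prod]) (simp_all add: pure_tensor_closed)

lemma tensor_act_hom:
  assumes "b \<in> carrier A"
  shows "(\<lambda>X. tensor_act N act B A X b) \<in> module_hom CC Mt Mt"
proof -
  have "quot_map (lin_ext Mt (\<lambda>(x, a). pt x (a \<otimes>\<^bsub>A\<^esub> b))) \<in> module_hom CC (quot T (tensor_null N act B A)) Mt"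
    by (rule quot_map_hom[OF null_sub tensor_act_lin_ext(1)[OF assms(1)] module_tensor_prod
        tensor_act_lin_ext(2)[OF assms(1)]])
  then show ?thesis by (simp add: tensor_act_def[abs_def] tensor_prod_def)
qed

lemma tensor_prod_hom_eqI:
  fixes W :: "(complex, 'w) module"
  assumes "module CC W" "h \<in> module_hom CC Mt W" "g \<in> module_hom CC Mt W"
    and "\<And>x a. x \<in> carrier N \<Longrightarrow> a \<in> carrier A \<Longrightarrow> h (pt x a) = g (pt x a)" "X \<in> carrier Mt"
  shows "h X = g X"
proof -
  let ?q = "\<lambda>f. tensor_null N act B A +>\<^bsub>T\<^esub> f"
  have q: "?q \<in> module_hom CC T Mt" unfolding tensor_prod_def by (rule coset_hom[OF null_sub])
  have comp: "(\<lambda>f. k (?q f)) \<in> module_hom CC T W" if "k \<in> module_hom CC Mt W" for k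
    using q that unfolding module_hom_def by (simp add: Pi_iff)
  from assms(5) obtain f where f: "f \<in> carrier T" "X = ?q f"
    unfolding tensor_prod_def quot_carrier by blast
  show ?thesis unfolding f(2)
    by (rule hom_free_eqI[OF assms(1) comp[OF assms(2)] comp[OF assms(3)] _ f(1)])
       (use assms(4) in \<open>auto simp: pure_tensor_def\<close>)
qed

lemma tensor_act_linear_right:
  assumes X: "X \<in> carrier Mt" and b: "b \<in> carrier A" and b': "b' \<in> carrier A"
  shows "tensor_act N act B A X (b \<oplus>\<^bsub>A\<^esub> b') = tensor_act N act B A X b \<oplus>\<^bsub>Mt\<^esub> tensor_act N act B A X b'"
    "tensor_act N act B A X (c \<odot>\<^bsub>A\<^esub> b) = c \<odot>\<^bsub>Mt\<^esub> tensor_act N act B A X b"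
proof -
  interpret M: module CC Mt by (rule module_tensor_prod)
  have cb: "c \<odot>\<^bsub>A\<^esub> b \<in> carrier A" using b by (intro AM.smult_closed) simp_all
  have bb: "b \<oplus>\<^bsub>A\<^esub> b' \<in> carrier A" using b b' by (rule AM.M.a_closed)
  note h = tensor_act_hom[OF b] tensor_act_hom[OF b']
  note hc = Pi_mem[OF module_hom_closed[OF h(1)]] Pi_mem[OF module_hom_closed[OF h(2)]]
  have "(\<lambda>X. tensor_act N act B A X b \<oplus>\<^bsub>Mt\<^esub> tensor_act N act B A X b') \<in> module_hom CC Mt Mt"
    using hc module_hom_add[OF h(1)] module_hom_add[OF h(2)] module_hom_smult[OF h(1)] module_hom_smult[OF h(2)]
    by (intro module_homI) (simp_all add: M.M.a_ac M.smult_r_distr)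
  then show "tensor_act N act B A X (b \<oplus>\<^bsub>A\<^esub> b') = tensor_act N act B A X b \<oplus>\<^bsub>Mt\<^esub> tensor_act N act B A X b'"
    by (rule tensor_prod_hom_eqI[OF module_tensor_prod tensor_act_hom[OF bb] _ _ X])
       (simp add: tensor_act_pure b b' bb AR.r_distr pure_tensor_add_right)
  have "(\<lambda>X. c \<odot>\<^bsub>Mt\<^esub> tensor_act N act B A X b) \<in> module_hom CC Mt Mt"
  proof (rule module_homI)
    fix r X assume X: "X \<in> carrier Mt" "r \<in> carrier CC"
    show "c \<odot>\<^bsub>Mt\<^esub> tensor_act N act B A (r \<odot>\<^bsub>Mt\<^esub> X) b = r \<odot>\<^bsub>Mt\<^esub> (c \<odot>\<^bsub>Mt\<^esub> tensor_act N act B A X b)"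
      using X hc(1)[OF X(1)] module_hom_smult[OF h(1) X(2,1)] M.smult_assoc1[of c r "tensor_act N act B A X b"]
        M.smult_assoc1[of r c "tensor_act N act B A X b"]
      by (simp add: mult.commute)
  qed (use hc module_hom_add[OF h(1)] in \<open>simp_all add: M.smult_r_distr\<close>)
  then show "tensor_act N act B A X (c \<odot>\<^bsub>A\<^esub> b) = c \<odot>\<^bsub>Mt\<^esub> tensor_act N act B A X b"
    by (rule tensor_prod_hom_eqI[OF module_tensor_prod tensor_act_hom[OF cb] _ _ X])
       (simp add: tensor_act_pure b cb A2 pure_tensor_smult_right)
qed

lemma tensor_act_mult:
  assumes X: "X \<in> carrier Mt" and b: "b \<in> carrier A" and b': "b' \<in> carrier A"
  shows "tensor_act N act B A X (b \<otimes>\<^bsub>A\<^esub> b') = tensor_act N act B A (tensor_act N act B A X b) b'"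
proof -
  note h = tensor_act_hom[OF b] tensor_act_hom[OF b']
  have "(\<lambda>X. tensor_act N act B A (tensor_act N act B A X b) b') \<in> module_hom CC Mt Mt"
    using h unfolding module_hom_def by (simp add: Pi_iff)
  then show ?thesis
    by (rule tensor_prod_hom_eqI[OF module_tensor_prod tensor_act_hom[OF AR.m_closed[OF b b']] _ _ X])
       (simp add: tensor_act_pure b b' AR.m_assoc)
qed

lemma tensor_act_one:
  assumes X: "X \<in> carrier Mt"
  shows "tensor_act N act B A X \<one>\<^bsub>A\<^esub> = X"
proof -
  have "(\<lambda>X. X) \<in> module_hom CC Mt Mt" by (simp add: module_hom_def)
  then show ?thesis
    by (rule tensor_prod_hom_eqI[OF module_tensor_prod tensor_act_hom[OF AR.one_closed] _ _ X])
       (simp add: tensor_act_pure)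
qed

end


lemma multilin_rels_subset:
  assumes V: "module CC V"
  shows "multilin_rels n V \<subseteq> carrier (free_vs {xs. length xs = n \<and> set xs \<subseteq> carrier V})"
    (is "_ \<subseteq> carrier ?T")
proof -
  interpret V: module CC V by fact
  interpret T: module CC ?T by (rule module_free_vs)
  have d: "delta (xs[i := x]) \<in> carrier ?T"
    if "length xs = n" "set xs \<subseteq> carrier V" "x \<in> carrier V" for xs i x
    using that set_update_subset_insert[of xs i x] by (intro delta_in_free_vs) auto
  have s: "c \<odot>\<^bsub>V\<^esub> x \<in> carrier V" if "x \<in> carrier V" for c x
    using that by (intro V.smult_closed) simp_all
  have sT: "c \<odot>\<^bsub>?T\<^esub> x \<in> carrier ?T" if "x \<in> carrier ?T" for c x
    using that by (intro T.smult_closed) simp_all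
  show ?thesis
    unfolding multilin_rels_def Let_def
  proof (rule Un_least; rule subsetI; elim CollectE exE conjE)
    fix f xs i x y
    assume f: "f = delta (xs[i := x \<oplus>\<^bsub>V\<^esub> y]) \<ominus>\<^bsub>?T\<^esub> (delta (xs[i := x]) \<oplus>\<^bsub>?T\<^esub> delta (xs[i := y]))"
      and "length xs = n" "set xs \<subseteq> carrier V" "x \<in> carrier V" "y \<in> carrier V"
    then show "f \<in> carrier ?T"
      unfolding f by (intro T.M.minus_closed T.M.a_closed d V.M.a_closed)
  next
    fix f xs i c x
    assume f: "f = delta (xs[i := c \<odot>\<^bsub>V\<^esub> x]) \<ominus>\<^bsub>?T\<^esub> (c \<odot>\<^bsub>?T\<^esub> delta (xs[i := x]))"
      and "length xs = n" "set xs \<subseteq> carrier V" "x \<in> carrier V"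
    then show "f \<in> carrier ?T"
      unfolding f by (intro T.M.minus_closed sT d s)
  qed
qed

lemma lin_ext_multilin:
  fixes V :: "(complex, 'v) module" and W :: "(complex, 'w) module" and n
  defines "S \<equiv> {xs. length xs = n \<and> set xs \<subseteq> carrier V}"
  assumes V: "module CC V" and W: "module CC W" and cl: "\<And>xs. xs \<in> S \<Longrightarrow> \<phi> xs \<in> carrier W"
    and add: "\<And>xs i x y. xs \<in> S \<Longrightarrow> i < n \<Longrightarrow> x \<in> carrier V \<Longrightarrow> y \<in> carrier V \<Longrightarrow>
        \<phi> (xs[i := x \<oplus>\<^bsub>V\<^esub> y]) = \<phi> (xs[i := x]) \<oplus>\<^bsub>W\<^esub> \<phi> (xs[i := y])"
    and smult: "\<And>xs i x c. xs \<in> S \<Longrightarrow> i < n \<Longrightarrow> x \<in> carrier V \<Longrightarrow>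
        \<phi> (xs[i := c \<odot>\<^bsub>V\<^esub> x]) = c \<odot>\<^bsub>W\<^esub> \<phi> (xs[i := x])"
  shows "lin_ext W \<phi> \<in> module_hom CC (free_vs S) W"
    and "lin_ext W \<phi> ` lspan (free_vs S) (multilin_rels n V) \<subseteq> {\<zero>\<^bsub>W\<^esub>}"
proof -
  interpret V: module CC V by fact
  interpret W: module CC W by fact
  let ?h = "lin_ext W \<phi>" and ?T = "free_vs S"
  show h: "?h \<in> module_hom CC ?T W" using cl by (intro lin_ext_hom[OF W]) auto
  interpret h: mod_hom CC ?T W ?h
    by (intro mod_hom.intro mod_hom_axioms.intro module_free_vs W h)
  have upd: "xs[i := x] \<in> S" if "xs \<in> S" "x \<in> carrier V" for xs i x
    using that set_update_subset_insert[of xs i x] unfolding S_def by auto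
  have d: "delta (xs[i := x]) \<in> carrier ?T" if "xs \<in> S" "x \<in> carrier V" for xs i x
    by (rule delta_in_free_vs[OF upd[OF that]])
  have hd: "?h (delta (xs[i := x])) = \<phi> (xs[i := x])" if "xs \<in> S" "x \<in> carrier V" for xs i x
    by (rule lin_ext_delta[OF W, of \<phi> "xs[i := x]", OF cl[OF upd[OF that]]])
  have s: "c \<odot>\<^bsub>V\<^esub> x \<in> carrier V" if "x \<in> carrier V" for c x
    using that by (intro V.smult_closed) simp_all
  have sT: "c \<odot>\<^bsub>?T\<^esub> x \<in> carrier ?T" if "x \<in> carrier ?T" for c x
    using that h.M.smult_closed[of c x] by simp
  have sW: "c \<odot>\<^bsub>W\<^esub> x \<in> carrier W" if "x \<in> carrier W" for c x
    using that by (intro W.smult_closed) simp_all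
  have z: "w \<ominus>\<^bsub>W\<^esub> w = \<zero>\<^bsub>W\<^esub>" if "w \<in> carrier W" for w
    using that by (simp add: a_minus_def W.M.r_neg)
  have hs: "?h (c \<odot>\<^bsub>?T\<^esub> f) = c \<odot>\<^bsub>W\<^esub> ?h f" if "f \<in> carrier ?T" for c f
    using module_hom_smult[OF h, of c f] that by simp
  have 1: "?h (delta (xs[i := x \<oplus>\<^bsub>V\<^esub> y]) \<ominus>\<^bsub>?T\<^esub> (delta (xs[i := x]) \<oplus>\<^bsub>?T\<^esub> delta (xs[i := y]))) = \<zero>\<^bsub>W\<^esub>"
    if "xs \<in> S" "i < n" "x \<in> carrier V" "y \<in> carrier V" for xs i x y
    using that
    by (simp only: h.f_minus module_hom_add[OF h] hd add d h.M.M.a_closed V.M.a_closed W.M.a_closed cl upd z)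
  have 2: "?h (delta (xs[i := c \<odot>\<^bsub>V\<^esub> x]) \<ominus>\<^bsub>?T\<^esub> (c \<odot>\<^bsub>?T\<^esub> delta (xs[i := x]))) = \<zero>\<^bsub>W\<^esub>"
    if "xs \<in> S" "i < n" "x \<in> carrier V" for xs i x c
    using that by (simp only: h.f_minus hs hd smult d s sT sW cl upd z)
  have "?h ` multilin_rels n V \<subseteq> {\<zero>\<^bsub>W\<^esub>}"
    unfolding multilin_rels_def Let_def S_def[symmetric]
  proof (rule image_subsetI, elim UnE CollectE exE conjE)
    fix f xs i x y
    assume f: "f = delta (xs[i := x \<oplus>\<^bsub>V\<^esub> y]) \<ominus>\<^bsub>?T\<^esub> (delta (xs[i := x]) \<oplus>\<^bsub>?T\<^esub> delta (xs[i := y]))"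
      and *: "length xs = n" "set xs \<subseteq> carrier V" "i < n" "x \<in> carrier V" "y \<in> carrier V"
    have "xs \<in> S" using * by (simp add: S_def)
    then show "?h f \<in> {\<zero>\<^bsub>W\<^esub>}" unfolding f singleton_iff using * by (intro 1)
  next
    fix f xs i c x
    assume f: "f = delta (xs[i := c \<odot>\<^bsub>V\<^esub> x]) \<ominus>\<^bsub>?T\<^esub> (c \<odot>\<^bsub>?T\<^esub> delta (xs[i := x]))"
      and *: "length xs = n" "set xs \<subseteq> carrier V" "i < n" "x \<in> carrier V"
    have "xs \<in> S" using * by (simp add: S_def)
    then show "?h f \<in> {\<zero>\<^bsub>W\<^esub>}" unfolding f singleton_iff using * by (intro 2)
  qed
  then show "?h ` lspan ?T (multilin_rels n V) \<subseteq> {\<zero>\<^bsub>W\<^esub>}"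
    using multilin_rels_subset[OF V, of n] unfolding S_def[symmetric]
    by (intro hom_lspan_zero[OF module_free_vs W h])
qed

subsection \<open>The induced module and its subspaces\<close>

lemma triv_act_closed: "x \<in> carrier triv \<Longrightarrow> b \<in> \<AA>_pos m \<Longrightarrow> triv_act x b \<in> carrier triv"
  by simp

lemmas ind_facts = module_triv module_\<AA> ring_\<AA> \<AA>_smult_mult \<AA>_pos_subset triv_act_closed

lemma module_\<MM>: "module CC (\<MM> m)"
  unfolding \<MM>_def by (rule module_tensor_prod[OF ind_facts])

lemma vac_carrier: "vac m \<in> carrier (\<MM> m)"
proof -
  interpret A: ring "\<AA> m" by (rule ring_\<AA>)
  show ?thesis unfolding \<MM>_def vac_def by (rule pure_tensor_closed[OF ind_facts]) auto
qed

lemma \<MM>_act_hom: "a \<in> carrier (\<AA> m) \<Longrightarrow> (\<lambda>X. \<MM>_act m X a) \<in> module_hom CC (\<MM> m) (\<MM> m)"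
  unfolding \<MM>_def \<MM>_act_def by (rule tensor_act_hom[OF ind_facts])

lemma \<MM>_act_linear:
  assumes "X \<in> carrier (\<MM> m)" "a \<in> carrier (\<AA> m)" "b \<in> carrier (\<AA> m)"
  shows "\<MM>_act m X (a \<oplus>\<^bsub>\<AA> m\<^esub> b) = \<MM>_act m X a \<oplus>\<^bsub>\<MM> m\<^esub> \<MM>_act m X b"
    "\<MM>_act m X (c \<odot>\<^bsub>\<AA> m\<^esub> a) = c \<odot>\<^bsub>\<MM> m\<^esub> \<MM>_act m X a"
proof -
  note X = assms(1)[unfolded \<MM>_def]
  show "\<MM>_act m X (a \<oplus>\<^bsub>\<AA> m\<^esub> b) = \<MM>_act m X a \<oplus>\<^bsub>\<MM> m\<^esub> \<MM>_act m X b"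
    unfolding \<MM>_def \<MM>_act_def
    by (rule tensor_act_linear_right(1)[OF ind_facts]) (assumption | rule X assms)+
  show "\<MM>_act m X (c \<odot>\<^bsub>\<AA> m\<^esub> a) = c \<odot>\<^bsub>\<MM> m\<^esub> \<MM>_act m X a"
    unfolding \<MM>_def \<MM>_act_def
    by (rule tensor_act_linear_right(2)[where b' = b, OF ind_facts]) (assumption | rule X assms)+
qed

lemma \<MM>_act_one: "X \<in> carrier (\<MM> m) \<Longrightarrow> \<MM>_act m X \<one>\<^bsub>\<AA> m\<^esub> = X"
  unfolding \<MM>_def \<MM>_act_def by (rule tensor_act_one[OF ind_facts])

lemma \<MM>_act_mult:
  "X \<in> carrier (\<MM> m) \<Longrightarrow> a \<in> carrier (\<AA> m) \<Longrightarrow> b \<in> carrier (\<AA> m) \<Longrightarrow>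
   \<MM>_act m X (a \<otimes>\<^bsub>\<AA> m\<^esub> b) = \<MM>_act m (\<MM>_act m X a) b"
  unfolding \<MM>_def \<MM>_act_def by (rule tensor_act_mult[OF ind_facts])

lemma vac_gen_pos:
  assumes "0 < i"
  shows "\<MM>_act m (vac m) (gen m i) = \<zero>\<^bsub>\<MM> m\<^esub>"
proof -
  interpret A: ring "\<AA> m" by (rule ring_\<AA>)
  interpret M: module CC "\<MM> m" by (rule module_\<MM>)
  let ?pt = "pure_tensor triv triv_act (\<AA>_pos m) (\<AA> m)"
  have g: "gen m i \<in> \<AA>_pos m" unfolding \<AA>_pos_def gen_subalg_def using assms by blast
  have "\<MM>_act m (vac m) (gen m i) = ?pt 1 (\<one>\<^bsub>\<AA> m\<^esub> \<otimes>\<^bsub>\<AA> m\<^esub> gen m i)"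
    unfolding \<MM>_act_def vac_def
    by (rule tensor_act_pure[OF ind_facts]) (simp_all add: gen_carrier)
  also have "\<dots> = ?pt 1 (gen m i \<otimes>\<^bsub>\<AA> m\<^esub> \<one>\<^bsub>\<AA> m\<^esub>)"
    by (simp add: gen_carrier)
  also have "\<dots> = ?pt (triv_act 1 (gen m i)) \<one>\<^bsub>\<AA> m\<^esub>"
    by (rule pure_tensor_balanced[OF ind_facts, symmetric]) (simp_all add: g)
  also have "\<dots> = ?pt (0 \<odot>\<^bsub>triv\<^esub> 1) \<one>\<^bsub>\<AA> m\<^esub>" by (simp add: triv_act_gen)
  also have "\<dots> = 0 \<odot>\<^bsub>\<MM> m\<^esub> vac m"
    unfolding \<MM>_def vac_def by (rule pure_tensor_smult_left[OF ind_facts]) simp_all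
  also have "\<dots> = \<zero>\<^bsub>\<MM> m\<^esub>" using M.smult_l_null[OF vac_carrier] by simp
  finally show ?thesis .
qed

lemma \<AA>_nonneg_sub: "submodule CC (carrier (\<AA>_nonneg m)) (\<AA> m)"
  unfolding \<AA>_nonneg_def using gen_carrier
  by (auto intro!: lspan_submodule[OF module_\<AA>])

lemma \<AA>_nonneg_simps:
  "add (\<AA>_nonneg m) = add (\<AA> m)" "smult (\<AA>_nonneg m) = smult (\<AA> m)"
  by (simp_all add: \<AA>_nonneg_def)

lemma module_\<AA>_nonneg: "module CC (\<AA>_nonneg m)"
  using module.submodule_is_module[OF module_\<AA> \<AA>_nonneg_sub] by (simp add: \<AA>_nonneg_def)

lemma foldl_act_hom:
  assumes "set as \<subseteq> carrier (\<AA> m)"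
  shows "(\<lambda>X. foldl (\<MM>_act m) X as) \<in> module_hom CC (\<MM> m) (\<MM> m)"
  using assms
proof (induction as)
  case Nil then show ?case by (simp add: module_hom_def)
next
  case (Cons a as)
  have "(\<lambda>X. \<MM>_act m X a) \<in> module_hom CC (\<MM> m) (\<MM> m)" using Cons.prems by (intro \<MM>_act_hom) simp
  moreover have "(\<lambda>X. foldl (\<MM>_act m) X as) \<in> module_hom CC (\<MM> m) (\<MM> m)" using Cons by simp
  ultimately show ?case unfolding module_hom_def by (simp add: Pi_iff)
qed

lemma foldl_act_closed:
  assumes "set as \<subseteq> carrier (\<AA> m)" "X \<in> carrier (\<MM> m)"
  shows "foldl (\<MM>_act m) X as \<in> carrier (\<MM> m)"
  using Pi_mem[OF module_hom_closed[OF foldl_act_hom[OF assms(1)]] assms(2)] .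

lemma \<MM>_act_closed: "X \<in> carrier (\<MM> m) \<Longrightarrow> a \<in> carrier (\<AA> m) \<Longrightarrow> \<MM>_act m X a \<in> carrier (\<MM> m)"
  using foldl_act_closed[of "[a]" m X] by simp

lemma foldl_act_add:
  assumes "set as \<subseteq> carrier (\<AA> m)" "i < length as" "a \<in> carrier (\<AA> m)" "b \<in> carrier (\<AA> m)"
    "X \<in> carrier (\<MM> m)"
  shows "foldl (\<MM>_act m) X (as[i := a \<oplus>\<^bsub>\<AA> m\<^esub> b]) =
      foldl (\<MM>_act m) X (as[i := a]) \<oplus>\<^bsub>\<MM> m\<^esub> foldl (\<MM>_act m) X (as[i := b])"
  using assms
proof (induction as arbitrary: i X)
  case (Cons d as)
  have as: "set as \<subseteq> carrier (\<AA> m)" using Cons.prems by simp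
  show ?case
  proof (cases i)
    case 0
    then show ?thesis
      using Cons.prems module_hom_add[OF foldl_act_hom[OF as], of "\<MM>_act m X a" "\<MM>_act m X b"]
      by (simp add: \<MM>_act_linear \<MM>_act_closed)
  next
    case (Suc j)
    then show ?thesis using Cons.prems Cons.IH[OF as, of j "\<MM>_act m X d"] by (simp add: \<MM>_act_closed)
  qed
qed simp

lemma foldl_act_smult:
  assumes "set as \<subseteq> carrier (\<AA> m)" "i < length as" "a \<in> carrier (\<AA> m)" "X \<in> carrier (\<MM> m)"
  shows "foldl (\<MM>_act m) X (as[i := c \<odot>\<^bsub>\<AA> m\<^esub> a]) = c \<odot>\<^bsub>\<MM> m\<^esub> foldl (\<MM>_act m) X (as[i := a])"
  using assms
proof (induction as arbitrary: i X)
  case (Cons d as)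
  have as: "set as \<subseteq> carrier (\<AA> m)" using Cons.prems by simp
  show ?case
  proof (cases i)
    case 0
    then show ?thesis
      using Cons.prems module_hom_smult[OF foldl_act_hom[OF as], of c "\<MM>_act m X a"]
      by (simp add: \<MM>_act_linear(2)[where b = a] \<MM>_act_closed)
  next
    case (Suc j)
    then show ?thesis using Cons.prems Cons.IH[OF as, of j "\<MM>_act m X d"] by (simp add: \<MM>_act_closed)
  qed
qed simp

lemma tensor_power_sub:
  "submodule CC (lspan (free_vs {xs. length xs = n \<and> set xs \<subseteq> carrier (\<AA>_nonneg m)}) (multilin_rels n (\<AA>_nonneg m)))
     (free_vs {xs. length xs = n \<and> set xs \<subseteq> carrier (\<AA>_nonneg m)})"
  by (rule lspan_submodule[OF module_free_vs multilin_rels_subset[OF module_\<AA>_nonneg]])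

lemma module_tensor_power: "module CC (tensor_power n (\<AA>_nonneg m))"
  unfolding tensor_power_def Let_def by (rule module_quot[OF tensor_power_sub])

lemma mult_map_lin_ext:
  fixes m n :: nat
  defines "h \<equiv> lin_ext (\<MM> m) (\<lambda>as. foldl (\<MM>_act m) (vac m) as)"
    and "T \<equiv> free_vs {xs. length xs = n \<and> set xs \<subseteq> carrier (\<AA>_nonneg m)}"
  shows "h \<in> module_hom CC T (\<MM> m)"
    "h ` lspan T (multilin_rels n (\<AA>_nonneg m)) \<subseteq> {\<zero>\<^bsub>\<MM> m\<^esub>}"
proof -
  have sub: "carrier (\<AA>_nonneg m) \<subseteq> carrier (\<AA> m)"
    by (rule submodule.subset[OF \<AA>_nonneg_sub])
  let ?S = "{xs. length xs = n \<and> set xs \<subseteq> carrier (\<AA>_nonneg m)}" and ?\<phi> = "foldl (\<MM>_act m) (vac m)"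
  have cl: "?\<phi> xs \<in> carrier (\<MM> m)" if "xs \<in> ?S" for xs
    using that sub by (intro foldl_act_closed vac_carrier) blast
  have add: "?\<phi> (xs[i := x \<oplus>\<^bsub>\<AA>_nonneg m\<^esub> y]) = ?\<phi> (xs[i := x]) \<oplus>\<^bsub>\<MM> m\<^esub> ?\<phi> (xs[i := y])"
    if "xs \<in> ?S" "i < n" "x \<in> carrier (\<AA>_nonneg m)" "y \<in> carrier (\<AA>_nonneg m)" for xs i x y
    unfolding \<AA>_nonneg_simps using that sub by (intro foldl_act_add vac_carrier) auto
  have smult: "?\<phi> (xs[i := c \<odot>\<^bsub>\<AA>_nonneg m\<^esub> x]) = c \<odot>\<^bsub>\<MM> m\<^esub> ?\<phi> (xs[i := x])"
    if "xs \<in> ?S" "i < n" "x \<in> carrier (\<AA>_nonneg m)" for xs i x c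
    unfolding \<AA>_nonneg_simps using that sub by (intro foldl_act_smult vac_carrier) auto
  show "h \<in> module_hom CC T (\<MM> m)"
    unfolding h_def T_def by (rule lin_ext_multilin(1)[OF module_\<AA>_nonneg module_\<MM> cl add smult])
  show "h ` lspan T (multilin_rels n (\<AA>_nonneg m)) \<subseteq> {\<zero>\<^bsub>\<MM> m\<^esub>}"
    unfolding h_def T_def by (rule lin_ext_multilin(2)[OF module_\<AA>_nonneg module_\<MM> cl add smult])
qed

lemma mult_map_hom: "mult_map m \<in> module_hom CC (tensor_power n (\<AA>_nonneg m)) (\<MM> m)"
  unfolding mult_map_def tensor_power_def Let_def
  by (rule quot_map_hom[OF tensor_power_sub mult_map_lin_ext(1) module_\<MM> mult_map_lin_ext(2)])

lemma mult_map_pure: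
  fixes m n :: nat
  assumes "length as = n" "set as \<subseteq> carrier (\<AA>_nonneg m)"
  defines "T \<equiv> free_vs {xs. length xs = n \<and> set xs \<subseteq> carrier (\<AA>_nonneg m)}"
  shows "mult_map m (lspan T (multilin_rels n (\<AA>_nonneg m)) +>\<^bsub>T\<^esub> delta as) =
    foldl (\<MM>_act m) (vac m) as"
proof -
  have "set as \<subseteq> carrier (\<AA> m)" using assms(2) submodule.subset[OF \<AA>_nonneg_sub] by blast
  then have "foldl (\<MM>_act m) (vac m) as \<in> carrier (\<MM> m)"
    using module_hom_closed[OF foldl_act_hom, of as m] vac_carrier by blast
  moreover have d: "delta as \<in> carrier T" unfolding T_def using assms by (intro delta_in_free_vs) simp
  moreover have "mult_map m (lspan T (multilin_rels n (\<AA>_nonneg m)) +>\<^bsub>T\<^esub> delta as) =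
      lin_ext (\<MM> m) (\<lambda>as. foldl (\<MM>_act m) (vac m) as) (delta as)"
    unfolding mult_map_def T_def
    by (rule quot_map_coset[OF tensor_power_sub mult_map_lin_ext(1) module_\<MM> mult_map_lin_ext(2) d[unfolded T_def]])
  ultimately show ?thesis by (simp add: lin_ext_delta[OF module_\<MM>])
qed

lemma \<PP>_subspace: "subspace CC (carrier (\<PP> m n)) (\<MM> m)"
proof -
  interpret mod_hom CC "tensor_power n (\<AA>_nonneg m)" "\<MM> m" "mult_map m"
    by (intro mod_hom.intro mod_hom_axioms.intro module_tensor_power module_\<MM> mult_map_hom)
  have "submodule CC (carrier (\<PP> m n)) (\<MM> m)"
    using im_is_submodule by (simp add: im_def \<PP>_def)
  then show ?thesis
    by (intro subspace.intro vectorspace.intro module_\<MM> field_CC)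
qed

lemma vectorspace_\<PP>: "vectorspace CC (\<PP> m n)"
proof -
  interpret vectorspace CC "\<MM> m" by (intro vectorspace.intro module_\<MM> field_CC)
  show ?thesis using subspace_is_vs[OF \<PP>_subspace[of m n]] by (simp add: \<PP>_def)
qed

end

theory Submission
  imports
    Defs
    "HOL-Computational_Algebra.Formal_Power_Series"
    "HOL-Library.List_Lexorder"
    "HOL-Combinatorics.Multiset_Permutations"
begin

text \<open>
  Write \<open>v w\<close> for the vector \<open>v e[i\<^sub>1] \<cdots> e[i\<^sub>n]\<close> of a word \<open>w = i\<^sub>1 \<dots> i\<^sub>n\<close>. The proof exhibits a basis of
  \<open>\<PP> m n\<close>: the vectors \<open>v w\<close> of the \<^emph>\<open>staircase words\<close>, those with \<open>i\<^sub>1 = 0\<close>, all \<open>i\<^sub>k \<ge> 0\<close> and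
  \<open>i\<^bsub>k+1\<^esub> \<le> i\<^sub>k + m\<close>.

  \<^emph>\<open>Spanning.\<close> If \<open>b > a + m\<close>, the defining relation with \<open>r = a + m\<close> and \<open>s = b - m\<close> expresses \<open>e[a] e[b]\<close> by
  products \<open>e[a'] e[b']\<close> with \<open>a' + b' = a + b\<close>, \<open>a \<le> a'\<close> and \<open>a \<le> b' < b\<close>. So the entries of a word stay nonnegative,
  while the sum of its entries weighted by their positions drops; a word that starts with a positive entry kills \<open>v\<close>.
  Hence every word with nonnegative entries reduces to staircase words (\<open>straightening\<close>).

  \<^emph>\<open>Independence.\<close> A linear functional on the degree \<open>n\<close> part of the module is encoded by the generating
  series \<open>F(z\<^sub>1, \<dots>, z\<^sub>n)\<close> whose coefficient at \<open>z\<^sub>1\<^sup>-\<^sup>i\<^sup>1 \<cdots> z\<^sub>n\<^sup>-\<^sup>i\<^sup>n\<close> is its value at \<open>v w\<close>. The relations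
  say that \<open>(z\<^sub>k - z\<^bsub>k+1\<^esub>)\<^sup>m F\<close> is symmetric in \<open>z\<^sub>k, z\<^bsub>k+1\<^esub>\<close>, and \<open>v e[i] = 0\<close> for \<open>i > 0\<close> says that
  \<open>z\<^sub>1\<close> has no negative exponents. Both hold for
  \<open>F = f \<cdot> (\<Prod>i<j. (z\<^sub>i - z\<^sub>j)\<^sup>-\<^sup>m)\<close> with a symmetric polynomial \<open>f\<close>, each factor being expanded in nonnegative powers of
  \<open>z\<^sub>i / z\<^sub>j\<close>. For every staircase word \<open>w\<close> the differences \<open>m (k - 1) - i\<^sub>k\<close> are nonnegative and weakly increasing;
  with \<open>f\<close> the monomial symmetric polynomial of these differences, the functional is nonzero on \<open>v w\<close> and vanishes
  on every staircase word that is lexicographically greater than \<open>w\<close>, since all further terms of the expansion move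
  exponents from later to earlier variables (\<open>sym_kernel_triangular\<close>). This triangularity gives independence.

  \<^emph>\<open>Counting.\<close> Let \<open>g(n, s)\<close> count the words with \<open>0 \<le> i\<^sub>1 \<le> s\<close> and otherwise the same conditions. Then
  \<open>g(n+1, s) = g(n+1, s-1) + g(n, s+m)\<close>, which by Pascal's rule has the ballot type solution
  \<open>(N choose n) - m (N choose (n-1))\<close> with \<open>N = (m+1) n + s\<close>; at \<open>s = 0\<close> this is the Fuss--Catalan number.
\<close>

section \<open>Expansion of products of poles\<close>

text \<open>The coefficients of \<open>(x - y)\<^sup>-\<^sup>m = (\<Sum>t. pole_coeff m t * x\<^sup>t * y\<^sup>-\<^sup>m\<^sup>-\<^sup>t)\<close>, expanded in nonnegative powers of \<open>x / y\<close>.\<close>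

definition pole_coeff :: "nat \<Rightarrow> nat \<Rightarrow> complex"
  where "pole_coeff m t = (-1) ^ m * fps_nth (inverse ((1 - fps_X) ^ m)) t"

lemma pole_coeff_0: "pole_coeff m 0 = (-1) ^ m"
  by (simp add: pole_coeff_def fps_power_zeroth)

lemma fps_one_minus_X_power_nth:
  "fps_nth ((1 - fps_X) ^ m :: complex fps) i = (-1) ^ i * of_nat (m choose i)"
proof (induction m arbitrary: i)
  case 0
  show ?case by (simp add: binomial_eq_0)
next
  case (Suc m)
  show ?case
    by (cases i) (simp_all add: Suc.IH algebra_simps)
qed

lemma pole_coeff_convolution:
  "(\<Sum>i\<le>s. (-1) ^ i * of_nat (m choose i) * pole_coeff m (s - i)) = (if s = 0 then (-1) ^ m else 0)"
proof -
  let ?P = "(1 - fps_X) ^ m :: complex fps"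
  have "fps_nth (?P * inverse ?P) s = (\<Sum>i\<le>s. (-1) ^ i * of_nat (m choose i) * fps_nth (inverse ?P) (s - i))"
    by (simp add: fps_mult_nth atLeast0AtMost fps_one_minus_X_power_nth)
  moreover have "?P * inverse ?P = 1"
    by (simp add: inverse_mult_eq_1')
  ultimately have "(\<Sum>i\<le>s. (-1) ^ i * of_nat (m choose i) * fps_nth (inverse ?P) (s - i)) = (if s = 0 then 1 else 0)"
    by simp
  then have "(-1) ^ m * (\<Sum>i\<le>s. (-1) ^ i * of_nat (m choose i) * fps_nth (inverse ?P) (s - i)) = (if s = 0 then (-1) ^ m else 0)"
    by simp
  then show ?thesis by (simp add: pole_coeff_def sum_distrib_left algebra_simps)
qed

text \<open>Multiplying the expansion of \<open>(x - y)\<^sup>-\<^sup>m\<close> by \<open>(x - y)\<^sup>m\<close> gives \<open>1\<close>, read on coefficients: \<open>g x\<close> stands for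
  the coefficient of the remaining factor when \<open>x\<close> powers have been moved between the two variables. The vanishing of
  \<open>g\<close> below \<open>m - N\<close> makes the truncation of the expansion at \<open>N\<close> harmless.\<close>

lemma sum_pole_coeff_cancel:
  fixes g :: "int \<Rightarrow> complex"
  assumes "\<And>x. x < int m - int N \<Longrightarrow> g x = 0"
  shows "(\<Sum>i\<le>m. (-1) ^ i * of_nat (m choose i) * (\<Sum>t\<le>N. pole_coeff m t * g (int i - int t))) = g (int m)"
proof -
  have flip: "(\<Sum>i\<le>m. (-1) ^ i * of_nat (m choose i) * (\<Sum>t\<le>N. pole_coeff m t * g (int i - int t)))
     = (-1) ^ m * (\<Sum>i\<le>m. (-1) ^ i * of_nat (m choose i) * (\<Sum>t\<le>N. pole_coeff m t * g (int m - int (i + t))))"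
    unfolding sum_distrib_left[of "(-1) ^ m"]
  proof (rule sum.reindex_bij_witness[of _ "\<lambda>i. m - i" "\<lambda>i. m - i"])
    fix i assume "i \<in> {..m}"
    then have i: "i \<le> m" by simp
    have e: "(-1) ^ m * (-1) ^ (m - i) = ((-1) ^ i :: complex)"
      using i by (simp add: minus_one_power_iff)
    have g: "int m - int (m - i + t) = int i - int t" for t using i by simp
    have c: "m choose (m - i) = m choose i" using i by (simp add: binomial_symmetric[symmetric])
    show "(-1) ^ m * ((-1) ^ (m - i) * of_nat (m choose (m - i)) * (\<Sum>t\<le>N. pole_coeff m t * g (int m - int (m - i + t)))) =
         (-1) ^ i * of_nat (m choose i) * (\<Sum>t\<le>N. pole_coeff m t * g (int i - int t))"
      unfolding g c mult.assoc[symmetric] e ..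
  qed auto
  have "(\<Sum>i\<le>m. (-1) ^ i * of_nat (m choose i) * (\<Sum>t\<le>N. pole_coeff m t * g (int m - int (i + t))))
      = (\<Sum>(i, t)\<in>{..m} \<times> {..N}. (-1) ^ i * of_nat (m choose i) * pole_coeff m t * g (int m - int (i + t)))"
    by (simp add: sum.cartesian_product sum_distrib_left mult.assoc)
  \<comment> \<open>Collecting by the total exponent \<open>s\<close> adds pairs whose terms vanish, by the binomial coefficient or by \<open>g\<close>.\<close>
  also have "\<dots> = (\<Sum>(s, i)\<in>(SIGMA s:{..m+N}. {..s}). (-1) ^ i * of_nat (m choose i) * pole_coeff m (s - i) * g (int m - int s))"
  proof (rule sum.reindex_bij_witness_not_neutral[where
        i = "\<lambda>(s, i). (i, s - i)" and j = "\<lambda>(i, t). (i + t, i)"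
        and S' = "{}" and T' = "{(s, i). i \<le> s \<and> s \<le> m + N \<and> (i > m \<or> s - i > N)}"])
    show "finite {(s, i). i \<le> s \<and> s \<le> m + N \<and> (i > m \<or> s - i > N)}"
      by (rule finite_subset[of _ "{..m+N} \<times> {..m+N}"]) auto
  next
    fix b assume "b \<in> {(s, i). i \<le> s \<and> s \<le> m + N \<and> (i > m \<or> s - i > N)}"
    then obtain s i where b: "b = (s, i)" "i \<le> s" "i > m \<or> s - i > N" by auto
    then have "m choose i = 0 \<or> g (int m - int s) = 0" by (auto simp: binomial_eq_0 intro!: assms)
    then show "(case b of (s, i) \<Rightarrow> (-1) ^ i * of_nat (m choose i) * pole_coeff m (s - i) * g (int m - int s)) = 0"
      unfolding b by auto
  qed auto
  also have "\<dots> = (\<Sum>s\<le>m+N. (\<Sum>i\<le>s. (-1) ^ i * of_nat (m choose i) * pole_coeff m (s - i)) * g (int m - int s))"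
    by (simp add: sum.Sigma[symmetric] sum_distrib_right)
  also have "\<dots> = (\<Sum>s\<le>m+N. if s = 0 then (-1) ^ m * g (int m) else 0)"
    by (intro sum.cong) (auto simp: pole_coeff_convolution)
  also have "\<dots> = (-1) ^ m * g (int m)" by simp
  finally show ?thesis unfolding flip by simp
qed

text \<open>A function \<open>\<psi>\<close> on words of length \<open>n\<close> stands for the series whose coefficient at
  \<open>z\<^sub>1\<^sup>-\<^sup>i\<^sup>1 \<cdots> z\<^sub>n\<^sup>-\<^sup>i\<^sup>n\<close> is \<open>\<psi> [i\<^sub>1, \<dots>, i\<^sub>n]\<close>. Then \<open>pole_product m d \<psi>\<close> is the coefficient of \<open>x\<^sup>d\<close> in
  \<open>(\<Prod>j. (x - z\<^sub>j)\<^sup>-\<^sup>m) \<cdot> \<psi>\<close>, where \<open>x\<close> is small against every \<open>z\<^sub>j\<close>.\<close>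

fun pole_product :: "nat \<Rightarrow> int \<Rightarrow> (int list \<Rightarrow> complex) \<Rightarrow> int list \<Rightarrow> complex" where
  "pole_product m d \<psi> [] = (if d = 0 then \<psi> [] else 0)"
| "pole_product m d \<psi> (j # r) =
     (\<Sum>t\<le>nat d. pole_coeff m t * pole_product m (d - int t) (\<lambda>r'. \<psi> ((j - int m - int t) # r')) r)"

lemma pole_product_neg: "d < 0 \<Longrightarrow> pole_product m d \<psi> r = 0"
  by (induction r arbitrary: d \<psi>) auto

text \<open>The summation bound can be any large enough number; a common bound is what allows sums to be exchanged.\<close>

lemma pole_product_Cons:
  assumes "nat d \<le> N"
  shows "pole_product m d \<psi> (j # r) =
    (\<Sum>t\<le>N. pole_coeff m t * pole_product m (d - int t) (\<lambda>r'. \<psi> ((j - int m - int t) # r')) r)"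
  unfolding pole_product.simps
  by (rule sum.mono_neutral_left) (use assms in \<open>auto simp: pole_product_neg\<close>)

lemma pole_product_sum:
  "pole_product m d (\<lambda>r. \<Sum>i\<in>I. c i * \<psi> i r) r = (\<Sum>i\<in>I. c i * pole_product m d (\<psi> i) r)"
proof (induction r arbitrary: d \<psi>)
  case (Cons j r)
  show ?case
    unfolding pole_product.simps Cons.IH sum_distrib_left
    by (subst sum.swap) (simp add: mult_ac)
qed (simp add: sum_distrib_left)

text \<open>The length of a word never changes, so only the values of the series on words of that length matter.\<close>

lemma pole_product_length:
  assumes "\<And>r'. length r' = length r \<Longrightarrow> \<psi> r' = \<phi> r'"
  shows "pole_product m d \<psi> r = pole_product m d \<phi> r"
  using assms
proof (induction r arbitrary: d \<psi> \<phi>)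
  case (Cons j r)
  show ?case
    unfolding pole_product.simps using Cons.prems
    by (intro sum.cong refl arg_cong2[where f = "(*)"] Cons.IH) simp
qed simp

lemma pole_product_zero: "pole_product m d (\<lambda>r. 0) r = 0"
  by (induction r arbitrary: d) auto

text \<open>Both sides multiply by the same product of poles in two new variables and extract the same coefficient.\<close>

lemma pole_product_commute:
  "pole_product m a (pole_product m b \<psi>) r = pole_product m b (pole_product m a \<psi>) r"
proof (induction r arbitrary: a b \<psi>)
  case (Cons j r)
  define N where "N = max (nat a) (nat b)"
  have expand: "pole_product m a (pole_product m b \<psi>) (j # r) =
      (\<Sum>t\<le>N. \<Sum>s\<le>N. pole_coeff m t * pole_coeff m s *
        pole_product m (a - int t) (pole_product m (b - int s) (\<lambda>r'. \<psi> ((j - 2 * int m - int (t + s)) # r'))) r)"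
    if "nat a \<le> N" "nat b \<le> N" for a b
  proof -
    have "pole_product m a (pole_product m b \<psi>) (j # r) =
      (\<Sum>t\<le>N. pole_coeff m t * pole_product m (a - int t)
         (\<lambda>r'. pole_product m b \<psi> ((j - int m - int t) # r')) r)"
      using that by (simp only: pole_product_Cons)
    also have "\<dots> = (\<Sum>t\<le>N. \<Sum>s\<le>N. pole_coeff m t * pole_coeff m s *
        pole_product m (a - int t) (pole_product m (b - int s) (\<lambda>r'. \<psi> ((j - 2 * int m - int (t + s)) # r'))) r)"
      unfolding pole_product_Cons[OF that(2)] pole_product_sum sum_distrib_left
      by (simp add: mult_ac algebra_simps)
    finally show ?thesis .
  qed
  have "(\<Sum>t\<le>N. \<Sum>s\<le>N. pole_coeff m t * pole_coeff m s *
        pole_product m (a - int t) (pole_product m (b - int s) (\<lambda>r'. \<psi> ((j - 2 * int m - int (t + s)) # r'))) r)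
     = (\<Sum>t\<le>N. \<Sum>s\<le>N. pole_coeff m t * pole_coeff m s *
        pole_product m (b - int t) (pole_product m (a - int s) (\<lambda>r'. \<psi> ((j - 2 * int m - int (t + s)) # r'))) r)"
    by (subst sum.swap) (simp add: Cons.IH[of "a - _"] mult_ac add.commute)
  then show ?case using expand[of a b] expand[of b a] by (simp add: N_def)
qed simp

section \<open>Mutual locality\<close>

text \<open>The coefficient of \<open>(z\<^sub>k - z\<^bsub>k+1\<^esub>)\<^sup>m \<phi>\<close> at the word \<open>u p q v\<close>, where \<open>k\<close> is the position of \<open>p\<close>.\<close>

definition cleared :: "nat \<Rightarrow> (int list \<Rightarrow> complex) \<Rightarrow> int list \<Rightarrow> int \<Rightarrow> int \<Rightarrow> int list \<Rightarrow> complex"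
  where "cleared m \<phi> u p q v =
    (\<Sum>i\<le>m. (-1) ^ i * of_nat (m choose i) * \<phi> (u @ [p + int m - int i, q + int i] @ v))"

text \<open>This symmetry is what a functional on words needs in order to respect the defining relations of \<open>\<AA> m\<close>
  (see \<open>sum_rel_word_eq_0\<close>).\<close>

definition mutually_local :: "nat \<Rightarrow> (int list \<Rightarrow> complex) \<Rightarrow> bool"
  where "mutually_local m \<phi> \<longleftrightarrow> (\<forall>u p q v. cleared m \<phi> u p q v = cleared m \<phi> u q p v)"

lemma cleared_Cons: "cleared m \<phi> (j # u) p q v = cleared m (\<lambda>r. \<phi> (j # r)) u p q v"
  by (simp add: cleared_def)

lemma mutually_local_Cons: "mutually_local m \<phi> \<Longrightarrow> mutually_local m (\<lambda>r. \<phi> (j # r))"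
  unfolding mutually_local_def cleared_Cons[symmetric] by blast

lemma cleared_sum:
  "cleared m (\<lambda>r. \<Sum>t\<in>T. c t * \<psi> t r) u p q v = (\<Sum>t\<in>T. c t * cleared m (\<psi> t) u p q v)"
  unfolding cleared_def sum_distrib_left
  by (subst sum.swap) (simp add: mult_ac)

text \<open>The factors \<open>(x - z\<^sub>k)\<^sup>-\<^sup>m (x - z\<^bsub>k+1\<^esub>)\<^sup>-\<^sup>m\<close> are expanded in the same direction, so they are symmetric in
  \<open>z\<^sub>k, z\<^bsub>k+1\<^esub>\<close> and multiplication by them preserves the symmetry.\<close>

lemma mutually_local_pole_product:
  assumes "mutually_local m \<phi>"
  shows "mutually_local m (pole_product m d \<phi>)"
proof -
  have "cleared m (pole_product m d \<phi>) u p q v = cleared m (pole_product m d \<phi>) u q p v"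
    if "mutually_local m \<phi>" for u p q v
    using that
  proof (induction u arbitrary: d \<phi>)
    case Nil
    define N where "N = nat d"
    have expand: "cleared m (pole_product m d \<phi>) [] p q v = (\<Sum>t\<le>N. \<Sum>s\<le>N. pole_coeff m t * pole_coeff m s *
        pole_product m (d - int t - int s) (cleared m \<phi> [] (p - int m - int t) (q - int m - int s)) v)" for p q
    proof -
      have two: "pole_product m d \<phi> (x # y # v) = (\<Sum>t\<le>N. \<Sum>s\<le>N. pole_coeff m t * pole_coeff m s *
          pole_product m (d - int t - int s) (\<lambda>r'. \<phi> ((x - int m - int t) # (y - int m - int s) # r')) v)" for x y
      proof -
        have le: "nat (d - int t) \<le> N" for t by (simp add: N_def)
        have "pole_product m d \<phi> (x # y # v) = (\<Sum>t\<le>N. pole_coeff m t *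
            pole_product m (d - int t) (\<lambda>r'. \<phi> ((x - int m - int t) # r')) (y # v))"
          by (rule pole_product_Cons) (simp add: N_def)
        then show ?thesis
          by (simp only: pole_product_Cons[OF le] sum_distrib_left mult.assoc)
      qed
      have "cleared m (pole_product m d \<phi>) [] p q v =
        (\<Sum>i\<le>m. \<Sum>t\<le>N. \<Sum>s\<le>N. pole_coeff m t * pole_coeff m s * ((-1) ^ i * of_nat (m choose i) *
          pole_product m (d - int t - int s) (\<lambda>r'. \<phi> ((p + int m - int i - int m - int t) # (q + int i - int m - int s) # r')) v))"
        by (simp add: cleared_def two sum_distrib_left mult_ac del: pole_product.simps)
      also have "\<dots> = (\<Sum>t\<le>N. \<Sum>s\<le>N. \<Sum>i\<le>m. pole_coeff m t * pole_coeff m s * ((-1) ^ i * of_nat (m choose i) *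
          pole_product m (d - int t - int s) (\<lambda>r'. \<phi> ((p + int m - int i - int m - int t) # (q + int i - int m - int s) # r')) v))"
        by (subst sum.swap, rule sum.cong[OF refl], subst sum.swap) simp
      also have "\<dots> = (\<Sum>t\<le>N. \<Sum>s\<le>N. pole_coeff m t * pole_coeff m s *
        pole_product m (d - int t - int s) (cleared m \<phi> [] (p - int m - int t) (q - int m - int s)) v)"
        unfolding cleared_def pole_product_sum sum_distrib_left
        by (intro sum.cong refl) (simp add: algebra_simps)
      finally show ?thesis .
    qed
    have sym: "cleared m \<phi> [] x y = cleared m \<phi> [] y x" for x y
      using Nil unfolding mutually_local_def by blast
    have comm: "d - int t - int s = d - int s - int t" for s t by simp
    show ?case
      unfolding expand
      by (subst sum.swap, subst sym, subst comm) (simp add: mult_ac)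
  next
    case (Cons j u)
    have *: "cleared m (pole_product m d \<phi>) (j # u) p q v = (\<Sum>t\<le>nat d. pole_coeff m t *
        cleared m (pole_product m (d - int t) (\<lambda>r'. \<phi> ((j - int m - int t) # r'))) u p q v)" for p q
      by (simp only: cleared_Cons pole_product.simps cleared_sum)
    show ?case
      unfolding * using Cons.IH[OF mutually_local_Cons[OF Cons.prems]] by simp
  qed
  then show ?thesis using assms unfolding mutually_local_def by blast
qed

section \<open>The universal kernel\<close>

text \<open>The coefficients of \<open>\<Prod>i<j. (z\<^sub>i - z\<^sub>j)\<^sup>-\<^sup>m\<close> in \<open>n\<close> variables, with value \<open>0\<close> on words of any other length;
  the recursion splits off the factors that contain \<open>z\<^sub>1\<close>.\<close>

fun pole_kernel :: "nat \<Rightarrow> nat \<Rightarrow> int list \<Rightarrow> complex" where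
  "pole_kernel m 0 w = (if w = [] then 1 else 0)"
| "pole_kernel m (Suc n) [] = 0"
| "pole_kernel m (Suc n) (i # r) = pole_product m (- i) (pole_kernel m n) r"

lemma pole_kernel_length: "length w \<noteq> n \<Longrightarrow> pole_kernel m n w = 0"
proof (induction n arbitrary: w)
  case (Suc n)
  show ?case
  proof (cases w)
    case (Cons i r)
    with Suc have "pole_product m (- i) (pole_kernel m n) r = pole_product m (- i) (\<lambda>r. 0) r"
      by (intro pole_product_length) simp
    with Cons show ?thesis by (simp add: pole_product_zero)
  qed simp
qed simp

text \<open>Away from the first two positions locality is inherited from the kernel in the remaining variables. At
  the first two positions, clearing \<open>(z\<^sub>1 - z\<^sub>2)\<^sup>-\<^sup>m\<close> leaves the poles of \<open>z\<^sub>1\<close> and of \<open>z\<^sub>2\<close> against the remaining variables,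
  and these two multiplications commute.\<close>

lemma mutually_local_pole_kernel: "mutually_local m (pole_kernel m n)"
proof (induction n)
  case 0
  show ?case by (simp add: mutually_local_def cleared_def)
next
  case (Suc n)
  have "cleared m (pole_kernel m (Suc n)) u p q v = cleared m (pole_kernel m (Suc n)) u q p v" for u p q v
  proof (cases u)
    case (Cons j u')
    have "(\<lambda>r. pole_kernel m (Suc n) (j # r)) = pole_product m (- j) (pole_kernel m n)" by (simp add: fun_eq_iff)
    then show ?thesis
      using mutually_local_pole_product[OF Suc] unfolding Cons cleared_Cons
      by (simp add: mutually_local_def)
  next
    case Nil
    show ?thesis
    proof (cases n)
      case 0
      then show ?thesis unfolding Nil cleared_def by (simp add: pole_kernel_length del: pole_kernel.simps)
    next
      case (Suc n')
      have "cleared m (pole_kernel m n'') [] p q v = pole_product m (- p) (pole_product m (- q) (pole_kernel m n')) v"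
        if n'': "n'' = Suc (Suc n')" for p q n''
      proof -
        \<comment> \<open>Large enough for all expansions in \<open>z\<^sub>1 / z\<^sub>2\<close> that occur, for every \<open>i \<le> m\<close>.\<close>
        define N where "N = nat (- p) + nat (- q) + m + m"
        define g where "g x = pole_product m (x - int m - p) (pole_product m (int m - x - q) (pole_kernel m n')) v" for x
        have expand: "pole_kernel m n'' ([] @ [p + int m - int i, q + int i] @ v) = (\<Sum>t\<le>N. pole_coeff m t * g (int i - int t))"
          if "i \<le> m" for i
        proof -
          have "nat (- (p + int m - int i)) \<le> N" using that by (simp add: N_def)
          from pole_product_Cons[OF this, of m "pole_kernel m (Suc n')" "q + int i" v] show ?thesis
            unfolding n'' by (simp add: g_def algebra_simps)
        qed
        have "g x = 0" if "x < int m - int N" for x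
          using that unfolding g_def by (intro pole_product_neg) (auto simp: N_def split: if_splits)
        then have "(\<Sum>i\<le>m. (-1) ^ i * of_nat (m choose i) * (\<Sum>t\<le>N. pole_coeff m t * g (int i - int t))) = g (int m)"
          by (rule sum_pole_coeff_cancel)
        then show ?thesis by (simp add: cleared_def expand[simplified] g_def)
      qed
      from this[of "Suc n" p q] this[of "Suc n" q p] show ?thesis
        unfolding Nil by (simp add: Suc pole_product_commute)
    qed
  qed
  then show ?case unfolding mutually_local_def by blast
qed

section \<open>Leading terms\<close>

text \<open>The entrywise difference between the steepest staircase \<open>s, s + m, s + 2 m, \<dots>\<close> and a word. At the steepest
  staircase \<open>0, m, 2 m, \<dots>\<close> the kernel takes the value of its leading coefficient.\<close>

fun slack :: "nat \<Rightarrow> int \<Rightarrow> int list \<Rightarrow> int list" where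
  "slack m s [] = []"
| "slack m s (x # xs) = (s - x) # slack m (s + int m) xs"

lemma length_slack [simp]: "length (slack m s xs) = length xs"
  by (induction xs arbitrary: s) auto

lemma slack_slack: "slack m s (slack m s xs) = xs"
  by (induction xs arbitrary: s) auto

lemma map_slack: "map (\<lambda>j. j - c) (slack m s d) = slack m (s - c) d"
  by (induction d arbitrary: s) (simp_all add: algebra_simps)

lemma map2_plus_slack:
  "length a = length b \<Longrightarrow> map2 (+) (slack m s b) a = slack m s (map2 (-) b a)"
  by (induction a b arbitrary: s rule: list_induct2) auto

lemma slack_antimono:
  "length xs = length ys \<Longrightarrow> slack m s xs \<le> slack m s ys \<longleftrightarrow> ys \<le> xs"
  by (induction xs ys arbitrary: s rule: list_induct2) auto

text \<open>The lowest power of \<open>x\<close> comes from the leading term of every pole.\<close>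

lemma pole_product_0:
  "pole_product m 0 \<psi> r = pole_coeff m 0 ^ length r * \<psi> (map (\<lambda>j. j - int m) r)"
  by (induction r arbitrary: \<psi>) simp_all

text \<open>Every term of the expansion after the leading one moves exponents from later variables to earlier ones.
  The proof compares the exponents of \<open>z\<^sub>1\<close>, and if they agree continues with the remaining variables.\<close>

lemma pole_kernel_slack_nonzero:
  assumes "pole_kernel m n (slack m 0 d) \<noteq> 0"
  shows "replicate n 0 \<le> d"
  using assms
proof (induction n arbitrary: d)
  case (Suc n)
  then obtain x d' where d: "d = x # d'" by (cases d) auto
  have nz: "pole_product m x (pole_kernel m n) (slack m (int m) d') \<noteq> 0"
    using Suc.prems by (simp add: d)
  then have "x \<ge> 0" using pole_product_neg by (meson not_le)
  moreover have "replicate n 0 \<le> d'" if "x = 0"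
    using nz that by (intro Suc.IH) (simp add: pole_product_0 map_slack)
  ultimately show ?case by (auto simp: d)
qed simp

lemma pole_kernel_slack_replicate: "pole_kernel m n (slack m 0 (replicate n 0)) \<noteq> 0"
  by (induction n) (simp_all add: pole_product_0 map_slack pole_coeff_0)

text \<open>The coefficients of the kernel in \<open>n = size M\<close> variables times the monomial symmetric polynomial whose exponents
  are the elements of \<open>M\<close>. The length is tested because \<open>map2\<close> truncates to the shorter list.\<close>

definition sym_kernel :: "nat \<Rightarrow> int multiset \<Rightarrow> int list \<Rightarrow> complex"
  where "sym_kernel m M w =
    (\<Sum>a\<in>permutations_of_multiset M. if length w = size M then pole_kernel m (size M) (map2 (+) w a) else 0)"

lemma length_permutation: "a \<in> permutations_of_multiset M \<Longrightarrow> length a = size M"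
  by (auto simp: permutations_of_multiset_def simp flip: size_mset)

lemma sym_kernel_length: "length w \<noteq> size M \<Longrightarrow> sym_kernel m M w = 0"
  by (simp add: sym_kernel_def)

text \<open>The variable \<open>z\<^sub>1\<close> occurs in the kernel only with nonnegative exponents, and a polynomial factor does not lower them.\<close>

lemma sym_kernel_pos:
  assumes "\<And>x. x \<in># M \<Longrightarrow> 0 \<le> x" "0 < i"
  shows "sym_kernel m M (i # r) = 0"
  unfolding sym_kernel_def
proof (rule sum.neutral, rule ballI)
  fix a assume "a \<in> permutations_of_multiset M"
  then have a: "mset a = M" by (simp add: permutations_of_multiset_def)
  show "(if length (i # r) = size M then pole_kernel m (size M) (map2 (+) (i # r) a) else 0) = 0"
  proof (cases a)
    case (Cons x a')
    with a have "0 \<le> x" "size M = Suc (length a')" using assms(1) by auto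
    with assms(2) Cons show ?thesis by (simp add: pole_product_neg)
  qed (use a in auto)
qed

text \<open>Exchanging two adjacent variables permutes the monomials of a symmetric polynomial, so the factor preserves locality.\<close>

lemma mutually_local_sym_kernel: "mutually_local m (sym_kernel m M)"
proof -
  have "cleared m (sym_kernel m M) u p q v = cleared m (sym_kernel m M) u q p v" for u p q v
  proof (cases "length u + length v + 2 = size M")
    case False
    then show ?thesis by (simp add: cleared_def sym_kernel_length)
  next
    case True
    define k where "k = length u"
    define swap :: "int list \<Rightarrow> int list" where "swap a = take k a @ [a ! Suc k, a ! k] @ drop (k + 2) a" for a
    \<comment> \<open>The contribution of the monomial with exponents \<open>a\<close>.\<close>
    define G where "G p q a = cleared m (pole_kernel m (size M)) (map2 (+) u (take k a)) (p + a ! k) (q + a ! Suc k)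
        (map2 (+) v (drop (k + 2) a))" for p q a
    let ?P = "permutations_of_multiset M"
    have split: "a = take k a @ [a ! k, a ! Suc k] @ drop (k + 2) a" if "a \<in> ?P" for a
    proof -
      have "Suc k < length a" using True length_permutation[OF that] by (simp add: k_def)
      then show ?thesis by (simp add: Cons_nth_drop_Suc)
    qed
    have swap_swap: "swap (swap a) = a" and G_swap: "G p q (swap a) = G q p a" if "a \<in> ?P" for a p q
    proof -
      have k: "Suc k < length a" using True length_permutation[OF that] by (simp add: k_def)
      have nths: "take k (swap a) = take k a" "swap a ! k = a ! Suc k" "swap a ! Suc k = a ! k"
          "drop (k + 2) (swap a) = drop (k + 2) a"
        using k by (auto simp: swap_def nth_append)
      show "swap (swap a) = a"
        using split[OF that] unfolding swap_def[of "swap a"] nths by simp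
      show "G p q (swap a) = G q p a"
        using mutually_local_pole_kernel[of m "size M"] unfolding G_def nths mutually_local_def by blast
    qed
    have swap_mem: "swap a \<in> ?P" if "a \<in> ?P" for a
    proof -
      have "mset (swap a) = mset (take k a @ [a ! k, a ! Suc k] @ drop (k + 2) a)"
        by (simp add: swap_def)
      also have "\<dots> = mset a" using split[OF that] by simp
      finally show ?thesis using that by (simp add: permutations_of_multiset_def)
    qed
    have expand: "cleared m (sym_kernel m M) u p q v = (\<Sum>a\<in>?P. G p q a)" for p q
    proof -
      have "map2 (+) (u @ [x, y] @ v) a = map2 (+) u (take k a) @ [x + a ! k, y + a ! Suc k] @ map2 (+) v (drop (k + 2) a)"
        if "a \<in> ?P" for a x y
      proof -
        have "length (take k a) = length u" using length_permutation[OF that] True by (simp add: k_def)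
        then show ?thesis by (subst split[OF that]) (simp add: zip_append)
      qed
      then have "cleared m (sym_kernel m M) u p q v = (\<Sum>i\<le>m. \<Sum>a\<in>?P. (-1) ^ i * of_nat (m choose i) *
          pole_kernel m (size M) (map2 (+) u (take k a) @ [p + int m - int i + a ! k, q + int i + a ! Suc k] @ map2 (+) v (drop (k + 2) a)))"
        using True by (simp add: cleared_def sym_kernel_def sum_distrib_left)
      then show ?thesis
        by (subst (asm) sum.swap) (simp add: G_def cleared_def algebra_simps)
    qed
    show ?thesis
      unfolding expand
      by (rule sum.reindex_bij_witness[of _ swap swap]) (use swap_swap swap_mem G_swap in auto)
  qed
  then show ?thesis unfolding mutually_local_def by blast
qed

text \<open>The bound \<open>s\<close> on the first entry is a parameter so that tails of staircase words are covered by the same predicate.\<close>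

fun staircase :: "nat \<Rightarrow> int \<Rightarrow> int list \<Rightarrow> bool" where
  "staircase m s [] \<longleftrightarrow> True"
| "staircase m s (x # xs) \<longleftrightarrow> 0 \<le> x \<and> x \<le> s \<and> staircase m (x + int m) xs"

lemma staircase_slack:
  assumes "staircase m t xs"
  shows "sorted (slack m s xs)" "\<And>y. y \<in> set (slack m s xs) \<Longrightarrow> s - t \<le> y"
proof -
  have "sorted (slack m s xs) \<and> (\<forall>y\<in>set (slack m s xs). s - t \<le> y)"
    using assms
  proof (induction xs arbitrary: s t)
    case (Cons x xs)
    from Cons.prems have "staircase m (x + int m) xs" by simp
    from Cons.IH[OF this, of "s + int m"] Cons.prems show ?case by force
  qed simp
  then show "sorted (slack m s xs)" "\<And>y. y \<in> set (slack m s xs) \<Longrightarrow> s - t \<le> y" by auto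
qed

lemma sorted_le_permutation:
  fixes xs ys :: "'a::linorder list"
  assumes "sorted xs" "mset xs = mset ys"
  shows "xs \<le> ys"
  using assms
proof (induction xs arbitrary: ys)
  case (Cons x xs)
  then obtain y ys' where ys: "ys = y # ys'" by (cases ys) auto
  have "y \<in> set (x # xs)" using Cons.prems(2) unfolding ys by (metis list.set_intros(1) set_mset_mset)
  then have "x \<le> y" using Cons.prems(1) by auto
  moreover have "xs \<le> ys'" if "x = y" using Cons that ys by auto
  ultimately show ?case unfolding ys by auto
qed simp

lemma replicate_le_map2_minus:
  fixes a b :: "int list"
  shows "length a = length b \<Longrightarrow> replicate (length a) 0 \<le> map2 (-) b a \<longleftrightarrow> a \<le> b"
  by (induction a b rule: list_induct2) auto

text \<open>A nonzero value at \<open>w'\<close> needs a permutation \<open>a\<close> of \<open>slack m 0 w\<close> that is lexicographically at most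
  \<open>slack m 0 w'\<close>. The list \<open>slack m 0 w\<close> is sorted, hence the least of its permutations, so \<open>slack m 0 w \<le> slack m 0 w'\<close>,
  and taking slacks reverses the order. For \<open>w' = w\<close> only \<open>a = slack m 0 w\<close> can contribute.\<close>

lemma sym_kernel_triangular:
  assumes w: "staircase m 0 w" and len: "length w' = length w"
  shows "sym_kernel m (mset (slack m 0 w)) w' \<noteq> 0 \<Longrightarrow> w' \<le> w"
    and "sym_kernel m (mset (slack m 0 w)) w \<noteq> 0"
proof -
  define n where "n = length w"
  define M where "M = mset (slack m 0 w)"
  let ?P = "permutations_of_multiset M"
  have size: "size M = n" by (simp add: M_def n_def)
  have le: "slack m 0 w \<le> a" if "a \<in> ?P" for a
    using that by (intro sorted_le_permutation staircase_slack[OF w]) (simp add: M_def permutations_of_multiset_def)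
  have expand: "sym_kernel m M x = (\<Sum>a\<in>?P. pole_kernel m n (slack m 0 (map2 (-) (slack m 0 x) a)))"
    if "length x = n" for x
  proof -
    have "map2 (+) x a = slack m 0 (map2 (-) (slack m 0 x) a)" if "a \<in> ?P" for a
      using map2_plus_slack[of a "slack m 0 x" m 0] length_permutation[OF that] \<open>length x = n\<close>
      by (simp add: slack_slack size)
    then show ?thesis using that by (simp add: sym_kernel_def size)
  qed
  have nz: "a \<le> slack m 0 x"
    if "a \<in> ?P" "length x = n" "pole_kernel m n (slack m 0 (map2 (-) (slack m 0 x) a)) \<noteq> 0" for a x
    using pole_kernel_slack_nonzero[OF that(3)] replicate_le_map2_minus[of a "slack m 0 x"]
      length_permutation[OF that(1)] that(2) by (simp add: size)
  show "w' \<le> w" if "sym_kernel m M w' \<noteq> 0"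
  proof -
    have "length w' = n" using len by (simp add: n_def)
    with that obtain a where "a \<in> ?P" "pole_kernel m n (slack m 0 (map2 (-) (slack m 0 w') a)) \<noteq> 0"
      unfolding expand[OF \<open>length w' = n\<close>] by (meson sum.not_neutral_contains_not_neutral)
    then have "slack m 0 w \<le> slack m 0 w'"
      using nz[of a w'] le[of a] \<open>length w' = n\<close> by simp
    then show ?thesis using slack_antimono[of w w' m 0] len by simp
  qed
  have mem: "slack m 0 w \<in> ?P" by (simp add: M_def permutations_of_multiset_def)
  have "(\<Sum>a\<in>?P. pole_kernel m n (slack m 0 (map2 (-) (slack m 0 w) a)))
      = (\<Sum>a\<in>?P. if a = slack m 0 w then pole_kernel m n (slack m 0 (replicate n 0)) else 0)"
  proof (rule sum.cong[OF refl])
    fix a assume a: "a \<in> ?P"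
    have "map2 (-) b b = replicate (length b) 0" for b :: "int list" by (induction b) auto
    from this[of "slack m 0 w"] show "pole_kernel m n (slack m 0 (map2 (-) (slack m 0 w) a)) =
        (if a = slack m 0 w then pole_kernel m n (slack m 0 (replicate n 0)) else 0)"
      using nz[OF a, of w] le[OF a] by (auto simp: n_def)
  qed
  also have "\<dots> \<noteq> 0" using mem pole_kernel_slack_replicate[of m n] by simp
  finally show "sym_kernel m M w \<noteq> 0" by (simp add: expand n_def)
qed

section \<open>Counting staircase words\<close>

definition staircase_words :: "nat \<Rightarrow> nat \<Rightarrow> int \<Rightarrow> int list set"
  where "staircase_words m n s = {w. length w = n \<and> staircase m s w}"

lemma staircase_words_Suc:
  "staircase_words m (Suc n) s = (\<Union>x\<in>{0..s}. (#) x ` staircase_words m n (x + int m))"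
  by (auto simp: staircase_words_def length_Suc_conv)

lemma finite_staircase_words: "finite (staircase_words m n s)"
proof (induction n arbitrary: s)
  case 0
  have "staircase_words m 0 s \<subseteq> {[]}" by (auto simp: staircase_words_def)
  then show ?case by (rule finite_subset) simp
qed (simp add: staircase_words_Suc)

lemma card_staircase_words_Suc:
  "card (staircase_words m (Suc n) s) = (\<Sum>x\<in>{0..s}. card (staircase_words m n (x + int m)))"
  unfolding staircase_words_Suc
  by (subst card_UN_disjoint) (auto simp: finite_staircase_words card_image intro!: sum.cong)

text \<open>The case distinction reads the binomial coefficient with lower index \<open>-1\<close> as \<open>0\<close>.\<close>

definition ballot :: "nat \<Rightarrow> nat \<Rightarrow> nat \<Rightarrow> int"
  where "ballot m n N = int (N choose n) - (case n of 0 \<Rightarrow> 0 | Suc k \<Rightarrow> int m * int (N choose k))"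

lemma ballot_Suc_Suc: "ballot m (Suc n) (Suc N) = ballot m (Suc n) N + ballot m n N"
  by (cases n) (simp_all add: ballot_def algebra_simps)

lemma Suc_times_choose_Suc: "Suc k * (n choose Suc k) = (n - k) * (n choose k)"
  by (metis binomial_absorb_comp binomial_absorption)

text \<open>The value that corresponds to the empty count, for \<open>s = -1\<close>; it starts the recursion in \<open>s\<close>.\<close>

lemma ballot_boundary: "ballot m (Suc n) (Suc m * n + m) = 0"
proof -
  let ?N = "Suc m * n + m"
  have "Suc n * (?N choose Suc n) = (?N - n) * (?N choose n)" by (rule Suc_times_choose_Suc)
  also have "?N - n = Suc n * m" by (simp add: algebra_simps)
  finally have "?N choose Suc n = m * (?N choose n)" by (simp only: mult.assoc nat_mult_eq_cancel1)
  then show ?thesis by (simp add: ballot_def)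
qed

text \<open>Raising the bound on the first entry from \<open>s\<close> to \<open>s + 1\<close> adds the words that start with \<open>s + 1\<close>, so the counts satisfy
  the same Pascal recursion as \<open>ballot\<close>.\<close>

lemma card_staircase_words: "int (card (staircase_words m n (int s))) = ballot m n (Suc m * n + s)"
proof (induction n arbitrary: s)
  case 0
  have "staircase_words m 0 (int s) = {[]}" by (auto simp: staircase_words_def)
  then show ?case by (simp add: ballot_def)
next
  case (Suc n)
  show ?case
  proof (induction s)
    case 0
    have "int (card (staircase_words m (Suc n) (int 0))) = ballot m n (Suc m * n + m)"
      using Suc.IH[of m] by (simp add: card_staircase_words_Suc)
    also have "\<dots> = ballot m (Suc n) (Suc (Suc m * n + m))"
      by (simp add: ballot_Suc_Suc ballot_boundary del: mult_Suc)
    finally show ?case by (simp add: algebra_simps)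
  next
    case (Suc s)
    have "{0..int (Suc s)} = insert (int (Suc s)) {0..int s}" by auto
    then have "int (card (staircase_words m (Suc n) (int (Suc s)))) =
        int (card (staircase_words m (Suc n) (int s))) + int (card (staircase_words m n (int (Suc s + m))))"
      by (simp add: card_staircase_words_Suc add.assoc)
    also have "\<dots> = ballot m (Suc n) (Suc m * Suc n + s) + ballot m n (Suc m * n + (Suc s + m))"
      by (simp only: Suc.IH \<open>\<And>s. int (card (staircase_words m n (int s))) = ballot m n (Suc m * n + s)\<close>)
    also have "\<dots> = ballot m (Suc n) (Suc (Suc m * Suc n + s))"
      by (simp add: ballot_Suc_Suc algebra_simps)
    finally show ?case by simp
  qed
qed

lemma of_nat_card_staircase_words:
  "of_nat (card (staircase_words m n 0)) = fuss_catalan m n"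
proof -
  let ?N = "Suc m * n"
  have "int (card (staircase_words m n 0)) * int (m * n + 1) = int (?N choose n)"
  proof (cases n)
    case 0
    then show ?thesis using card_staircase_words[of m n 0] by (simp add: ballot_def)
  next
    case (Suc k)
    have "Suc k * (?N choose Suc k) = (?N - k) * (?N choose k)" by (rule Suc_times_choose_Suc)
    also have "?N - k = m * n + 1" by (simp add: Suc)
    finally have "int n * int (?N choose n) = int (m * n + 1) * int (?N choose k)"
      by (simp only: Suc flip: of_nat_mult)
    moreover have "int (card (staircase_words m n 0)) = int (?N choose n) - int m * int (?N choose k)"
      using card_staircase_words[of m n 0] by (simp add: ballot_def Suc)
    moreover have "(C - M * K) * (M * N + 1) = C" if "N * C = (M * N + 1) * K" for C M N K :: int
    proof -
      have "(C - M * K) * (M * N + 1) = C + M * (N * C) - M * ((M * N + 1) * K)" by (simp add: algebra_simps)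
      with that show ?thesis by simp
    qed
    ultimately show ?thesis by (simp only: of_nat_add of_nat_mult of_nat_1)
  qed
  then have "card (staircase_words m n 0) * (m * n + 1) = ?N choose n"
    by (metis of_nat_eq_iff of_nat_mult)
  then have "of_nat (card (staircase_words m n 0)) * of_nat (m * n + 1) = (of_nat (?N choose n) :: rat)"
    by (metis of_nat_mult)
  then show ?thesis by (simp add: fuss_catalan_def field_simps del: of_nat_mult of_nat_Suc)
qed

section \<open>Functionals on the induced module\<close>

abbreviation word_vec :: "nat \<Rightarrow> int list \<Rightarrow> ind_elt"
  where "word_vec m w \<equiv> foldl (\<MM>_act m) (vac m) (map (gen m) w)"

lemma module_hom_free_alg: "module_hom CC free_alg W = module_hom CC (free_vs UNIV) W"
  by (simp add: module_hom_def)

lemma finsum_triv: "finite I \<Longrightarrow> (\<Oplus>\<^bsub>triv\<^esub>i\<in>I. f i) = (\<Sum>i\<in>I. f i)"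
proof (induction I rule: finite_induct)
  case empty
  interpret module CC triv by (rule module_triv)
  show ?case by simp
next
  case (insert i I)
  interpret module CC triv by (rule module_triv)
  from insert show ?case by (simp add: Pi_def)
qed

lemma hom_sum_delta:
  assumes W: "module CC W" and h: "h \<in> module_hom CC (free_vs S) W"
    and "finite I" "\<And>i. i \<in> I \<Longrightarrow> x i \<in> S"
  shows "h (\<lambda>y. \<Sum>i\<in>I. c i * delta (x i) y) = (\<Oplus>\<^bsub>W\<^esub>i\<in>I. c i \<odot>\<^bsub>W\<^esub> h (delta (x i)))"
    and "(\<lambda>y. \<Sum>i\<in>I. c i * delta (x i) y) \<in> carrier (free_vs S)"
proof -
  interpret W: module CC W by (rule W)
  interpret h: mod_hom CC "free_vs S" W h
    by (intro mod_hom.intro mod_hom_axioms.intro module_free_vs W h)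
  have "h (\<lambda>y. \<Sum>i\<in>I. c i * delta (x i) y) = (\<Oplus>\<^bsub>W\<^esub>i\<in>I. c i \<odot>\<^bsub>W\<^esub> h (delta (x i))) \<and>
      (\<lambda>y. \<Sum>i\<in>I. c i * delta (x i) y) \<in> carrier (free_vs S)"
    using assms(3,4)
  proof (induction I rule: finite_induct)
    case empty
    show ?case using h.f0_is_0 by (simp add: free_vs_carrier)
  next
    case (insert i I)
    let ?f = "\<lambda>y. \<Sum>i\<in>I. c i * delta (x i) y" and ?g = "\<lambda>y. c i * delta (x i) y"
    have d: "delta (x i) \<in> carrier (free_vs S)" using insert.prems by (simp add: delta_in_free_vs)
    have g: "?g \<in> carrier (free_vs S)" using d by (rule free_vs_smult_closed)
    have f: "?f \<in> carrier (free_vs S)" and hf: "h ?f = (\<Oplus>\<^bsub>W\<^esub>i\<in>I. c i \<odot>\<^bsub>W\<^esub> h (delta (x i)))"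
      using insert by auto
    have "h ?g = c i \<odot>\<^bsub>W\<^esub> h (delta (x i))"
      using module_hom_smult[OF h, of "c i" "delta (x i)"] d by simp
    moreover have "h (\<lambda>y. ?g y + ?f y) = h ?g \<oplus>\<^bsub>W\<^esub> h ?f"
      using module_hom_add[OF h g f] by simp
    moreover have "(\<lambda>i. c i \<odot>\<^bsub>W\<^esub> h (delta (x i))) \<in> insert i I \<rightarrow> carrier W"
      using insert.prems by (intro Pi_I W.smult_closed h.f_im delta_in_free_vs) auto
    ultimately show ?case
      using insert.hyps free_vs_add_closed[OF g f] by (simp add: hf Pi_iff)
  qed
  then show "h (\<lambda>y. \<Sum>i\<in>I. c i * delta (x i) y) = (\<Oplus>\<^bsub>W\<^esub>i\<in>I. c i \<odot>\<^bsub>W\<^esub> h (delta (x i)))"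
    and "(\<lambda>y. \<Sum>i\<in>I. c i * delta (x i) y) \<in> carrier (free_vs S)" by blast+
qed

text \<open>Finite combinations of words are handled as explicit sums, in which multiplication by words acts on each term.\<close>

lemma sandwich_sum_delta:
  "delta u \<otimes>\<^bsub>free_alg\<^esub> (\<lambda>w. \<Sum>i\<in>I. c i * delta (x i) w) \<otimes>\<^bsub>free_alg\<^esub> delta v
     = (\<lambda>w. \<Sum>i\<in>I. c i * delta (u @ x i @ v) w)"
proof -
  have app: "(\<Sum>k\<le>length w. delta u (take k w) * delta v (drop k w)) = delta (u @ v) w" for u v w :: "'x list"
    using fun_cong[OF delta_append[of u v], of w] by simp
  have left: "delta u \<otimes>\<^bsub>free_alg\<^esub> (\<lambda>w. \<Sum>i\<in>I. c i * delta (x i) w) = (\<lambda>w. \<Sum>i\<in>I. c i * delta (u @ x i) w)"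
  proof
    fix w
    have "(delta u \<otimes>\<^bsub>free_alg\<^esub> (\<lambda>w. \<Sum>i\<in>I. c i * delta (x i) w)) w =
        (\<Sum>i\<in>I. c i * (\<Sum>k\<le>length w. delta u (take k w) * delta (x i) (drop k w)))"
      by (simp add: sum_distrib_left mult.left_commute) (rule sum.swap)
    then show "(delta u \<otimes>\<^bsub>free_alg\<^esub> (\<lambda>w. \<Sum>i\<in>I. c i * delta (x i) w)) w = (\<Sum>i\<in>I. c i * delta (u @ x i) w)"
      by (simp only: app)
  qed
  have right: "(\<lambda>w. \<Sum>i\<in>I. c i * delta (u @ x i) w) \<otimes>\<^bsub>free_alg\<^esub> delta v = (\<lambda>w. \<Sum>i\<in>I. c i * delta ((u @ x i) @ v) w)"
  proof
    fix w
    have "((\<lambda>w. \<Sum>i\<in>I. c i * delta (u @ x i) w) \<otimes>\<^bsub>free_alg\<^esub> delta v) w =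
        (\<Sum>i\<in>I. c i * (\<Sum>k\<le>length w. delta (u @ x i) (take k w) * delta v (drop k w)))"
      by (simp add: sum_distrib_left sum_distrib_right mult.assoc) (rule sum.swap)
    then show "((\<lambda>w. \<Sum>i\<in>I. c i * delta (u @ x i) w) \<otimes>\<^bsub>free_alg\<^esub> delta v) w = (\<Sum>i\<in>I. c i * delta ((u @ x i) @ v) w)"
      by (simp only: app)
  qed
  show ?thesis unfolding left right by simp
qed

text \<open>The defining relation as a combination of words. The index \<open>(i, flipped)\<close> stands for one of the two terms of the
  \<open>i\<close>-th bracket: \<open>flipped\<close> selects the term with the factors in opposite order.\<close>

fun rel_word :: "int \<Rightarrow> int \<Rightarrow> nat \<times> bool \<Rightarrow> int list" where
  "rel_word r s (i, flipped) = (if flipped then [s + int i, r - int i] else [r - int i, s + int i])"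

fun rel_coeff :: "nat \<Rightarrow> nat \<times> bool \<Rightarrow> complex" where
  "rel_coeff m (i, flipped) = (-1) ^ i * of_nat (m choose i) * (if flipped then - ((-1) ^ m) else 1)"

lemma gen_rel_sum_delta:
  "gen_rel m r s = (\<lambda>w. \<Sum>k\<in>{..m} \<times> UNIV. rel_coeff m k * delta (rel_word r s k) w)"
  by (simp add: gen_rel_eq sum.cartesian_product' UNIV_bool algebra_simps)

text \<open>The unflipped terms are the coefficient at \<open>r - m, s\<close> of the series cleared by \<open>(z\<^sub>k - z\<^bsub>k+1\<^esub>)\<^sup>m\<close>. Reversing the summation
  order absorbs the sign \<open>(-1)\<^sup>m\<close> and turns the flipped terms into the coefficient at \<open>s, r - m\<close>; the two cancel by symmetry.\<close>

lemma sum_rel_word_eq_0: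
  assumes "mutually_local m c"
  shows "(\<Sum>k\<in>{..m} \<times> UNIV. rel_coeff m k * c (u @ rel_word r s k @ v)) = 0"
proof -
  have "(\<Sum>i\<le>m. (-1) ^ i * of_nat (m choose i) * c (u @ [r - int i, s + int i] @ v)) = cleared m c u (r - int m) s v"
    by (simp add: cleared_def)
  moreover have "(\<Sum>i\<le>m. (-1) ^ i * of_nat (m choose i) * (-1) ^ m * c (u @ [s + int i, r - int i] @ v)) = cleared m c u s (r - int m) v"
    unfolding cleared_def
  proof (rule sum.reindex_bij_witness[of _ "\<lambda>i. m - i" "\<lambda>i. m - i"])
    fix i assume "i \<in> {..m}"
    then have i: "i \<le> m" by simp
    have "(-1) ^ (m - i) = ((-1) ^ i * (-1) ^ m :: complex)" using i by (simp add: minus_one_power_iff)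
    moreover have "m choose (m - i) = m choose i" using i by (simp add: binomial_symmetric[symmetric])
    ultimately show "(-1) ^ (m - i) * of_nat (m choose (m - i)) * c (u @ [s + int m - int (m - i), r - int m + int (m - i)] @ v) =
        (-1) ^ i * of_nat (m choose i) * (-1) ^ m * c (u @ [s + int i, r - int i] @ v)"
      using i by (simp add: of_nat_diff mult_ac)
  qed auto
  moreover have "(\<Sum>k\<in>{..m} \<times> UNIV. rel_coeff m k * c (u @ rel_word r s k @ v)) =
      (\<Sum>i\<le>m. (-1) ^ i * of_nat (m choose i) * c (u @ [r - int i, s + int i] @ v)) -
      (\<Sum>i\<le>m. (-1) ^ i * of_nat (m choose i) * (-1) ^ m * c (u @ [s + int i, r - int i] @ v))"
    by (simp add: sum.cartesian_product' UNIV_bool sum_subtractf[symmetric] algebra_simps)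
  ultimately show ?thesis using assms by (simp add: mutually_local_def)
qed

abbreviation word_functional :: "(int list \<Rightarrow> complex) \<Rightarrow> (int list \<Rightarrow> complex) \<Rightarrow> complex"
  where "word_functional c \<equiv> lin_ext triv c"

lemma word_functional_hom: "word_functional c \<in> module_hom CC \<FF> triv"
  unfolding module_hom_free_alg by (rule lin_ext_hom[OF module_triv]) simp

lemma word_functional_delta: "word_functional c (delta w) = c w"
  by (rule lin_ext_delta[OF module_triv]) simp

lemma zero_hom_triv: "(\<lambda>x. 0) \<in> module_hom CC V triv"
  by (simp add: module_hom_def)

lemma hom_mult:
  fixes W :: "(complex, 'w) module"
  assumes "h \<in> module_hom CC \<FF> W" "g \<in> carrier \<FF>"
  shows "(\<lambda>f. h (f \<otimes>\<^bsub>\<FF>\<^esub> g)) \<in> module_hom CC \<FF> W" "(\<lambda>f. h (g \<otimes>\<^bsub>\<FF>\<^esub> f)) \<in> module_hom CC \<FF> W"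
proof -
  interpret F: ring \<FF> by (rule ring_free_alg)
  note h = module_hom_closed[OF assms(1), THEN Pi_mem] module_hom_add[OF assms(1)] module_hom_smult[OF assms(1)]
  show "(\<lambda>f. h (f \<otimes>\<^bsub>\<FF>\<^esub> g)) \<in> module_hom CC \<FF> W" "(\<lambda>f. h (g \<otimes>\<^bsub>\<FF>\<^esub> f)) \<in> module_hom CC \<FF> W"
    by (intro module_homI; simp add: h assms(2) F.l_distr F.r_distr free_alg_smult_mult del: free_alg_simps CC_simps)+
qed

lemma free_alg_hom_eqI:
  fixes W :: "(complex, 'w) module"
  assumes "module CC W" "h \<in> module_hom CC \<FF> W" "g \<in> module_hom CC \<FF> W"
    and "\<And>w. h (delta w) = g (delta w)" "f \<in> carrier \<FF>"
  shows "h f = g f"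
  using assms hom_free_eqI[of W h UNIV g f] by (simp add: module_hom_free_alg)

text \<open>Linearity in both outer factors reduces the claim to a relation between two words.\<close>

lemma word_functional_rel_ideal:
  assumes local: "mutually_local m c" and x: "x \<in> rel_ideal m"
  shows "word_functional c x = 0"
proof -
  interpret F: ring \<FF> by (rule ring_free_alg)
  let ?L = "word_functional c"
  note L = word_functional_hom[of c]
  have delta: "delta w \<in> carrier \<FF>" for w by (simp add: delta_in_free_vs)
  have L0: "?L \<zero>\<^bsub>\<FF>\<^esub> = 0"
  proof -
    interpret L: mod_hom CC \<FF> triv ?L
      by (intro mod_hom.intro mod_hom_axioms.intro module_free_alg module_triv L)
    show ?thesis using L.f0_is_0 by simp
  qed
  \<comment> \<open>Testing elements between two arbitrary factors makes the set of annihilated elements a two-sided ideal.\<close>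
  define J where "J = {x \<in> carrier \<FF>. \<forall>f\<in>carrier \<FF>. \<forall>g\<in>carrier \<FF>. ?L (f \<otimes>\<^bsub>\<FF>\<^esub> x \<otimes>\<^bsub>\<FF>\<^esub> g) = 0}"
  have "ideal J \<FF>"
  proof (rule idealI[OF F.ring_axioms])
    show "subgroup J (add_monoid \<FF>)"
    proof (rule F.add.subgroupI)
      have "\<zero>\<^bsub>\<FF>\<^esub> \<in> J" using L0 unfolding J_def by (simp del: free_alg_simps)
      then show "J \<noteq> {}" by blast
    next
      fix a assume a: "a \<in> J"
      have "?L (\<ominus>\<^bsub>\<FF>\<^esub> y) = - ?L y" if "y \<in> carrier \<FF>" for y
      proof -
        have "?L (y \<oplus>\<^bsub>\<FF>\<^esub> \<ominus>\<^bsub>\<FF>\<^esub> y) = ?L y + ?L (\<ominus>\<^bsub>\<FF>\<^esub> y)"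
          using module_hom_add[OF L that, of "\<ominus>\<^bsub>\<FF>\<^esub> y"] that by (simp del: free_alg_simps)
        then show ?thesis using that by (simp add: L0 F.r_neg eq_neg_iff_add_eq_0 add.commute del: free_alg_simps)
      qed
      then show "\<ominus>\<^bsub>\<FF>\<^esub> a \<in> J" using a unfolding J_def by (simp add: F.l_minus F.r_minus del: free_alg_simps)
    next
      fix a b assume "a \<in> J" "b \<in> J"
      then show "a \<oplus>\<^bsub>\<FF>\<^esub> b \<in> J"
        unfolding J_def by (simp add: F.l_distr F.r_distr module_hom_add[OF L] del: free_alg_simps)
    qed (auto simp: J_def)
  next
    fix a y assume a: "a \<in> J" and y: "y \<in> carrier \<FF>"
    have ac: "a \<in> carrier \<FF>" using a by (simp add: J_def)
    have *: "?L (f \<otimes>\<^bsub>\<FF>\<^esub> a \<otimes>\<^bsub>\<FF>\<^esub> g) = 0" if "f \<in> carrier \<FF>" "g \<in> carrier \<FF>" for f g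
      using a that by (simp add: J_def del: free_alg_simps)
    have "?L (f \<otimes>\<^bsub>\<FF>\<^esub> (y \<otimes>\<^bsub>\<FF>\<^esub> a) \<otimes>\<^bsub>\<FF>\<^esub> g) = 0" if "f \<in> carrier \<FF>" "g \<in> carrier \<FF>" for f g
      using *[of "f \<otimes>\<^bsub>\<FF>\<^esub> y" g] that y ac by (simp add: F.m_assoc del: free_alg_simps)
    then show "y \<otimes>\<^bsub>\<FF>\<^esub> a \<in> J" using y ac unfolding J_def by (simp del: free_alg_simps)
    have "?L (f \<otimes>\<^bsub>\<FF>\<^esub> (a \<otimes>\<^bsub>\<FF>\<^esub> y) \<otimes>\<^bsub>\<FF>\<^esub> g) = 0" if "f \<in> carrier \<FF>" "g \<in> carrier \<FF>" for f g
      using *[of f "y \<otimes>\<^bsub>\<FF>\<^esub> g"] that y ac by (simp add: F.m_assoc del: free_alg_simps)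
    then show "a \<otimes>\<^bsub>\<FF>\<^esub> y \<in> J" using y ac unfolding J_def by (simp del: free_alg_simps)
  qed
  moreover have "gen_rel m r s \<in> J" for r s
  proof -
    let ?x = "gen_rel m r s"
    note xc = gen_rel_carrier[of m r s]
    have "?L (delta u \<otimes>\<^bsub>\<FF>\<^esub> ?x \<otimes>\<^bsub>\<FF>\<^esub> delta v) = 0" for u v
    proof -
      have "?L (\<lambda>w. \<Sum>k\<in>{..m} \<times> UNIV. rel_coeff m k * delta (u @ rel_word r s k @ v) w) =
          (\<Sum>k\<in>{..m} \<times> UNIV. rel_coeff m k * c (u @ rel_word r s k @ v))"
        by (subst hom_sum_delta(1)[OF module_triv L[unfolded module_hom_free_alg]])
          (simp_all add: finsum_triv word_functional_delta)
      then show ?thesis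
        unfolding gen_rel_sum_delta sandwich_sum_delta using sum_rel_word_eq_0[OF local] by simp
    qed
    then have 1: "?L (delta u \<otimes>\<^bsub>\<FF>\<^esub> ?x \<otimes>\<^bsub>\<FF>\<^esub> g) = 0" if "g \<in> carrier \<FF>" for u g
      using free_alg_hom_eqI[OF module_triv hom_mult(2)[OF L F.m_closed[OF delta xc]] zero_hom_triv _ that] by blast
    have "?L (f \<otimes>\<^bsub>\<FF>\<^esub> (?x \<otimes>\<^bsub>\<FF>\<^esub> g)) = 0" if "f \<in> carrier \<FF>" "g \<in> carrier \<FF>" for f g
    proof -
      have "?L (delta u \<otimes>\<^bsub>\<FF>\<^esub> (?x \<otimes>\<^bsub>\<FF>\<^esub> g)) = 0" for u
        using 1[OF that(2), of u] F.m_assoc[OF delta[of u] xc that(2)] by (simp only:)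
      then show ?thesis
        using free_alg_hom_eqI[OF module_triv hom_mult(1)[OF L F.m_closed[OF xc that(2)]] zero_hom_triv _ that(1)] by blast
    qed
    then have "?L (f \<otimes>\<^bsub>\<FF>\<^esub> ?x \<otimes>\<^bsub>\<FF>\<^esub> g) = 0" if "f \<in> carrier \<FF>" "g \<in> carrier \<FF>" for f g
      using that F.m_assoc[OF that(1) xc that(2)] by (simp only:)
    then show ?thesis using xc unfolding J_def by blast
  qed
  then have "{gen_rel m r s | r s. True} \<subseteq> J" by blast
  ultimately have "x \<in> J" using x unfolding rel_ideal_def genideal_def by blast
  then have xc: "x \<in> carrier \<FF>" and "?L (\<one>\<^bsub>\<FF>\<^esub> \<otimes>\<^bsub>\<FF>\<^esub> x \<otimes>\<^bsub>\<FF>\<^esub> \<one>\<^bsub>\<FF>\<^esub>) = 0"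
    unfolding J_def using F.one_closed by blast+
  then show ?thesis using F.l_one[OF xc] F.r_one[OF xc] by (simp only:)
qed

text \<open>The linear map that sends an element \<open>f\<close> of the free algebra to \<open>v f\<close>.\<close>

definition word_map :: "nat \<Rightarrow> (int list \<Rightarrow> complex) \<Rightarrow> ind_elt"
  where "word_map m f = pure_tensor triv triv_act (\<AA>_pos m) (\<AA> m) 1 (rel_ideal m +>\<^bsub>\<FF>\<^esub> f)"

lemma coset_carrier: "f \<in> carrier \<FF> \<Longrightarrow> rel_ideal m +>\<^bsub>\<FF>\<^esub> f \<in> carrier (\<AA> m)"
  unfolding \<AA>_carrier by blast

lemma word_map_hom: "word_map m \<in> module_hom CC \<FF> (\<MM> m)"
proof (rule module_homI)
  fix f assume f: "f \<in> carrier \<FF>"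
  show "word_map m f \<in> carrier (\<MM> m)"
    unfolding word_map_def \<MM>_def by (rule pure_tensor_closed[OF ind_facts]) (use f coset_carrier in auto)
  show "word_map m (c \<odot>\<^bsub>\<FF>\<^esub> f) = c \<odot>\<^bsub>\<MM> m\<^esub> word_map m f" for c
    unfolding word_map_def \<MM>_def \<AA>_smult[OF f, symmetric]
    by (rule pure_tensor_smult_right[OF ind_facts]) (use f coset_carrier in auto)
  fix g assume g: "g \<in> carrier \<FF>"
  show "word_map m (f \<oplus>\<^bsub>\<FF>\<^esub> g) = word_map m f \<oplus>\<^bsub>\<MM> m\<^esub> word_map m g"
    unfolding word_map_def \<MM>_def \<AA>_add[OF f g, symmetric]
    by (rule pure_tensor_add_right[OF ind_facts]) (use f g coset_carrier in auto)
qed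

lemma word_map_delta: "word_map m (delta w) = word_vec m w"
proof (induction w rule: rev_induct)
  case Nil
  show ?case by (simp add: word_map_def vac_def \<AA>_one)
next
  case (snoc i w)
  have w: "delta w \<in> carrier \<FF>" by (simp add: delta_in_free_vs)
  have "word_vec m (w @ [i]) = \<MM>_act m (word_map m (delta w)) (gen m i)"
    by (simp add: snoc)
  also have "\<dots> = pure_tensor triv triv_act (\<AA>_pos m) (\<AA> m) 1 ((rel_ideal m +>\<^bsub>\<FF>\<^esub> delta w) \<otimes>\<^bsub>\<AA> m\<^esub> gen m i)"
    unfolding word_map_def \<MM>_act_def
    by (rule tensor_act_pure[OF ind_facts]) (simp_all add: gen_carrier coset_carrier w del: free_alg_simps)
  also have "(rel_ideal m +>\<^bsub>\<FF>\<^esub> delta w) \<otimes>\<^bsub>\<AA> m\<^esub> gen m i = rel_ideal m +>\<^bsub>\<FF>\<^esub> delta (w @ [i])"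
    unfolding gen_def \<AA>_mult[OF w free_gen_carrier] delta_append ..
  finally show ?case by (simp add: word_map_def)
qed

lemma word_map_rel_ideal:
  assumes "f \<in> rel_ideal m"
  shows "word_map m f = \<zero>\<^bsub>\<MM> m\<^esub>"
proof -
  interpret h: mod_hom CC \<FF> "\<MM> m" "word_map m"
    by (intro mod_hom.intro mod_hom_axioms.intro module_free_alg module_\<MM> word_map_hom)
  have z: "\<zero>\<^bsub>\<FF>\<^esub> \<in> carrier \<FF>" by (rule ring.ring_simprules(2)[OF ring_free_alg])
  have "rel_ideal m +>\<^bsub>\<FF>\<^esub> (f \<oplus>\<^bsub>\<FF>\<^esub> \<zero>\<^bsub>\<FF>\<^esub>) = rel_ideal m +>\<^bsub>\<FF>\<^esub> \<zero>\<^bsub>\<FF>\<^esub>"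
    by (rule coset_eqI[OF rel_ideal_submodule z assms])
  then have "word_map m f = word_map m \<zero>\<^bsub>\<FF>\<^esub>" by (simp add: word_map_def)
  then show ?thesis using h.f0_is_0 by (simp only:)
qed

text \<open>By locality the functional descends to \<open>\<AA> m\<close>. To descend further to the tensor product over \<open>\<AA>_pos m\<close> it must satisfy
  \<open>\<Phi> (b a) = \<epsilon>(b) \<Phi> a\<close> for \<open>b\<close> in \<open>\<AA>_pos m\<close>, where \<open>\<epsilon>\<close> is the action on the trivial module. The elements \<open>b\<close> with this property
  form a subalgebra, and the vanishing on words with a positive first entry puts the generators into it.\<close>

lemma module_functional:
  assumes local: "mutually_local m c" and pos: "\<And>i w. 0 < i \<Longrightarrow> c (i # w) = 0"
  obtains \<Phi> where "\<Phi> \<in> module_hom CC (\<MM> m) triv" "\<And>w. \<Phi> (word_vec m w) = c w"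
proof -
  let ?L = "word_functional c"
  let ?LA = "quot_map ?L"
  interpret F: ring \<FF> by (rule ring_free_alg)
  interpret AR: ring "\<AA> m" by (rule ring_\<AA>)
  interpret AM: module CC "\<AA> m" by (rule module_\<AA>)
  note L = word_functional_hom[of c]
  have L0: "?L ` rel_ideal m \<subseteq> {\<zero>\<^bsub>triv\<^esub>}" using word_functional_rel_ideal[OF local] by auto
  have LA: "?LA \<in> module_hom CC (\<AA> m) triv"
    unfolding \<AA>_def by (rule quot_map_hom[OF rel_ideal_submodule L module_triv L0])
  have LA_coset: "?LA (rel_ideal m +>\<^bsub>\<FF>\<^esub> f) = ?L f" if "f \<in> carrier \<FF>" for f
    by (rule quot_map_coset[OF rel_ideal_submodule L module_triv L0 that])
  note LA_add = module_hom_add[OF LA, simplified] and LA_smult = module_hom_smult[OF LA, simplified]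
  define B where "B = {b \<in> carrier (\<AA> m). \<forall>a\<in>carrier (\<AA> m). ?LA (b \<otimes>\<^bsub>\<AA> m\<^esub> a) = triv_act 1 b * ?LA a}"
  have triv_act_1: "triv_act z b = z * triv_act 1 b" for z b by (simp add: triv_act_def)
  have smult: "d \<odot>\<^bsub>\<AA> m\<^esub> b \<in> B" if "b \<in> B" for d b
  proof -
    have b: "b \<in> carrier (\<AA> m)" using that by (simp add: B_def)
    have db: "d \<odot>\<^bsub>\<AA> m\<^esub> b \<in> carrier (\<AA> m)" using b by (intro AM.smult_closed) simp_all
    have "triv_act 1 (d \<odot>\<^bsub>\<AA> m\<^esub> b) = d * triv_act 1 b" by (rule triv_act_linear(2)[OF b b])
    then show ?thesis using that db unfolding B_def
      by (simp add: \<AA>_smult_mult(1) LA_smult)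
  qed
  have add: "b \<oplus>\<^bsub>\<AA> m\<^esub> b' \<in> B" if "b \<in> B" "b' \<in> B" for b b'
    using that unfolding B_def by (simp add: AR.l_distr LA_add triv_act_linear(1) algebra_simps)
  have mult: "b \<otimes>\<^bsub>\<AA> m\<^esub> b' \<in> B" if "b \<in> B" "b' \<in> B" for b b'
    using that triv_act_1[of "triv_act 1 b" b'] unfolding B_def
    by (simp add: AR.m_assoc triv_act_mult)
  have one: "\<one>\<^bsub>\<AA> m\<^esub> \<in> B" unfolding B_def by (simp add: triv_act_one)
  have B_sub: "B \<subseteq> carrier (\<AA> m)" by (auto simp: B_def)
  have "subring B (\<AA> m)"
  proof (rule AR.subringI)
    show "\<ominus>\<^bsub>\<AA> m\<^esub> b \<in> B" if "b \<in> B" for b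
    proof -
      have "b \<in> carrier (\<AA> m)" using that B_sub by blast
      then have "(\<ominus>\<^bsub>CC\<^esub> \<one>\<^bsub>CC\<^esub>) \<odot>\<^bsub>\<AA> m\<^esub> b = \<ominus>\<^bsub>\<AA> m\<^esub> b" by (rule AM.smult_minus_1)
      then show ?thesis using smult[OF that, of "\<ominus>\<^bsub>CC\<^esub> \<one>\<^bsub>CC\<^esub>"] by simp
    qed
  qed (use B_sub one add mult in auto)
  moreover have "submodule CC B (\<AA> m)"
  proof (rule submodule.intro[OF module_\<AA>])
    show "\<zero>\<^bsub>\<AA> m\<^esub> \<in> B"
      using smult[OF one, of 0] AM.smult_l_null[OF AR.one_closed] by simp
  qed (use B_sub add smult in auto)
  moreover have "gen m i \<in> B" if "0 < i" for i
  proof -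
    have "?L (delta [i] \<otimes>\<^bsub>\<FF>\<^esub> f) = 0" if "f \<in> carrier \<FF>" for f
      using free_alg_hom_eqI[OF module_triv hom_mult(2)[OF L free_gen_carrier] zero_hom_triv _ that]
      by (simp add: delta_append word_functional_delta pos[OF \<open>0 < i\<close>] del: free_alg_simps)
    then have "?LA (gen m i \<otimes>\<^bsub>\<AA> m\<^esub> a) = 0" if "a \<in> carrier (\<AA> m)" for a
      using that F.m_closed[OF free_gen_carrier] unfolding \<AA>_carrier
      by (auto simp: gen_def \<AA>_mult[OF free_gen_carrier] LA_coset simp del: free_alg_simps)
    then show ?thesis by (simp add: B_def gen_carrier triv_act_gen)
  qed
  then have "{gen m i | i. 0 < i} \<subseteq> B" by blast
  ultimately have "\<AA>_pos m \<subseteq> B" unfolding \<AA>_pos_def gen_subalg_def by blast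
  then have bal: "?LA (b \<otimes>\<^bsub>\<AA> m\<^esub> a) = triv_act 1 b * ?LA a" if "b \<in> \<AA>_pos m" "a \<in> carrier (\<AA> m)" for a b
    using that by (auto simp: B_def)
  have bal': "triv_act x b * ?LA a = x * ?LA (b \<otimes>\<^bsub>\<AA> m\<^esub> a)" if "b \<in> \<AA>_pos m" "a \<in> carrier (\<AA> m)" for x a b
    using triv_act_1[of x b] by (simp add: bal[OF that])
  let ?h = "lin_ext triv (\<lambda>(x, a). x * ?LA a)"
  have h: "?h \<in> module_hom CC (free_vs (carrier triv \<times> carrier (\<AA> m))) triv"
      "?h ` tensor_null triv triv_act (\<AA>_pos m) (\<AA> m) \<subseteq> {\<zero>\<^bsub>triv\<^esub>}"
    by (rule lin_ext_balanced[where N = triv and act = triv_act and B = "\<AA>_pos m" and A = "\<AA> m"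
          and \<phi> = "\<lambda>x a. x * ?LA a", OF ind_facts module_triv];
        simp add: LA_add LA_smult bal' distrib_left distrib_right mult.assoc mult.left_commute)+
  have sub: "submodule CC (tensor_null triv triv_act (\<AA>_pos m) (\<AA> m)) (free_vs (carrier triv \<times> carrier (\<AA> m)))"
    by (rule null_sub[OF ind_facts])
  have "quot_map ?h \<in> module_hom CC (\<MM> m) triv"
    unfolding \<MM>_def tensor_prod_def by (rule quot_map_hom[OF sub h(1) module_triv h(2)])
  moreover have "quot_map ?h (word_vec m w) = c w" for w
  proof -
    have w: "delta w \<in> carrier \<FF>" by (simp add: delta_in_free_vs)
    have "quot_map ?h (word_map m (delta w)) = ?h (delta (1, rel_ideal m +>\<^bsub>\<FF>\<^esub> delta w))"
      unfolding word_map_def pure_tensor_def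
      by (rule quot_map_coset[OF sub h(1) module_triv h(2)])
        (use coset_carrier[OF w] in \<open>intro delta_in_free_vs SigmaI, auto\<close>)
    also have "\<dots> = c w"
      by (subst lin_ext_delta[OF module_triv]) (simp_all add: LA_coset[OF w] word_functional_delta)
    finally show ?thesis by (simp add: word_map_delta)
  qed
  ultimately show thesis by (rule that)
qed

section \<open>Straightening words\<close>

lemma submodule_preimage:
  assumes V: "module CC V" and W: "module CC W" and h: "h \<in> module_hom CC V W" and S: "submodule CC S W"
  shows "submodule CC {x \<in> carrier V. h x \<in> S} V"
proof -
  interpret V: module CC V by (rule V)
  interpret h: mod_hom CC V W h by (intro mod_hom.intro mod_hom_axioms.intro V W h)
  interpret S: submodule CC S W by (rule S)
  show ?thesis
  proof (rule submodule.intro[OF V])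
    show "\<zero>\<^bsub>V\<^esub> \<in> {x \<in> carrier V. h x \<in> S}" using h.f0_is_0 S.zero_closed by simp
    show "c \<odot>\<^bsub>V\<^esub> x \<in> {x \<in> carrier V. h x \<in> S}" if "x \<in> {x \<in> carrier V. h x \<in> S}" "c \<in> carrier CC" for c x
      using that module_hom_smult[OF h, of c x] S.smult_closed[of c "h x"] V.smult_closed[of c x] by simp
  qed (use module_hom_add[OF h] in auto)
qed

lemma submodule_finsum:
  assumes S: "submodule CC S V" and "finite I" "\<And>i. i \<in> I \<Longrightarrow> g i \<in> S"
  shows "(\<Oplus>\<^bsub>V\<^esub>i\<in>I. g i) \<in> S"
proof -
  interpret S: submodule CC S V by (rule S)
  interpret V: module CC V by (rule S.module)
  show ?thesis
    using assms(2,3)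
  proof (induction I rule: finite_induct)
    case (insert i I)
    then have "g \<in> I \<rightarrow> carrier V" "g i \<in> carrier V" using S.subset by auto
    with insert show ?case by simp
  qed simp
qed

text \<open>A relation with all vectors but one in a subspace puts the last one there too, if its coefficient is nonzero.\<close>

lemma submodule_solve:
  assumes S: "submodule CC S V" and "finite I" "k \<in> I" "c k \<noteq> 0" "x k \<in> carrier V"
    and mem: "\<And>i. i \<in> I - {k} \<Longrightarrow> x i \<in> S"
    and zero: "(\<Oplus>\<^bsub>V\<^esub>i\<in>I. c i \<odot>\<^bsub>V\<^esub> x i) = \<zero>\<^bsub>V\<^esub>"
  shows "x k \<in> S"
proof -
  interpret S: submodule CC S V by (rule S)
  interpret V: module CC V by (rule S.module)
  define y where "y = (\<Oplus>\<^bsub>V\<^esub>i\<in>I - {k}. c i \<odot>\<^bsub>V\<^esub> x i)"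
  have y: "y \<in> S"
    unfolding y_def using assms(2) mem by (intro submodule_finsum[OF S]) auto
  then have yc: "y \<in> carrier V" using S.subset by blast
  have xi: "x i \<in> carrier V" if "i \<in> I" for i using that mem assms(5) S.subset by (cases "i = k") auto
  have cx: "c k \<odot>\<^bsub>V\<^esub> x k \<in> carrier V" using assms(5) by (intro V.smult_closed) simp_all
  have "(\<Oplus>\<^bsub>V\<^esub>i\<in>insert k (I - {k}). c i \<odot>\<^bsub>V\<^esub> x i) = c k \<odot>\<^bsub>V\<^esub> x k \<oplus>\<^bsub>V\<^esub> y"
    unfolding y_def using assms(2) xi cx by (intro V.M.finsum_insert) (auto intro!: V.smult_closed)
  moreover have "insert k (I - {k}) = I" using assms(3) by blast
  ultimately have "c k \<odot>\<^bsub>V\<^esub> x k \<oplus>\<^bsub>V\<^esub> y = \<zero>\<^bsub>V\<^esub>" using zero by simp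
  then have "c k \<odot>\<^bsub>V\<^esub> x k = \<ominus>\<^bsub>V\<^esub> y" using cx yc by (metis V.M.minus_equality)
  also have "\<dots> = (\<ominus>\<^bsub>CC\<^esub> \<one>\<^bsub>CC\<^esub>) \<odot>\<^bsub>V\<^esub> y" using V.smult_minus_1[OF yc] by simp
  also have "\<dots> \<in> S" using y by (intro S.smult_closed) simp_all
  finally have "inverse (c k) \<odot>\<^bsub>V\<^esub> (c k \<odot>\<^bsub>V\<^esub> x k) \<in> S" by (rule S.smult_closed[rotated]) simp
  moreover have "inverse (c k) \<odot>\<^bsub>V\<^esub> (c k \<odot>\<^bsub>V\<^esub> x k) = x k"
    using V.smult_assoc1[of "inverse (c k)" "c k" "x k"] V.smult_one[OF assms(5)] assms(4,5) by simp
  ultimately show ?thesis by (simp only:)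
qed

lemma word_vec_closed: "word_vec m w \<in> carrier (\<MM> m)"
  by (intro foldl_act_closed vac_carrier) (auto simp: gen_carrier)

lemma word_vec_relation:
  "(\<Oplus>\<^bsub>\<MM> m\<^esub>k\<in>{..m} \<times> UNIV. rel_coeff m k \<odot>\<^bsub>\<MM> m\<^esub> word_vec m (u @ rel_word r s k @ v)) = \<zero>\<^bsub>\<MM> m\<^esub>"
proof -
  interpret I: ideal "rel_ideal m" \<FF> by (rule rel_ideal)
  have d: "delta w \<in> carrier \<FF>" for w by (simp add: delta_in_free_vs)
  have "gen_rel m r s \<in> rel_ideal m"
    unfolding rel_ideal_def genideal_def by blast
  then have "delta u \<otimes>\<^bsub>\<FF>\<^esub> gen_rel m r s \<otimes>\<^bsub>\<FF>\<^esub> delta v \<in> rel_ideal m"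
    using I.I_l_closed[OF _ d] I.I_r_closed[OF _ d] by blast
  then have "word_map m (\<lambda>w. \<Sum>k\<in>{..m} \<times> UNIV. rel_coeff m k * delta (u @ rel_word r s k @ v) w) = \<zero>\<^bsub>\<MM> m\<^esub>"
    unfolding gen_rel_sum_delta sandwich_sum_delta by (rule word_map_rel_ideal)
  then show ?thesis
    by (subst (asm) hom_sum_delta(1)[OF module_\<MM> word_map_hom[unfolded module_hom_free_alg]])
      (simp_all add: word_map_delta)
qed

lemma word_vec_pos:
  assumes "0 < x"
  shows "word_vec m (x # w) = \<zero>\<^bsub>\<MM> m\<^esub>"
proof -
  have "set (map (gen m) w) \<subseteq> carrier (\<AA> m)" by (auto simp: gen_carrier)
  then interpret h: mod_hom CC "\<MM> m" "\<MM> m" "\<lambda>X. foldl (\<MM>_act m) X (map (gen m) w)"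
    by (intro mod_hom.intro mod_hom_axioms.intro module_\<MM> foldl_act_hom)
  show ?thesis using h.f0_is_0 by (simp add: vac_gen_pos[OF assms])
qed

text \<open>The sum of the entries weighted by their positions, counted from \<open>0\<close>; it is the termination measure of straightening.\<close>

fun position_weight :: "int list \<Rightarrow> int" where
  "position_weight [] = 0"
| "position_weight (x # xs) = sum_list xs + position_weight xs"

lemma position_weight_nonneg: "\<forall>x\<in>set w. 0 \<le> x \<Longrightarrow> 0 \<le> position_weight w"
  by (induction w) (auto intro!: add_nonneg_nonneg sum_list_nonneg)

lemma position_weight_exchange:
  assumes "a + b = a' + b'" "b' < b"
  shows "position_weight (u @ [a', b'] @ v) < position_weight (u @ [a, b] @ v)"
  using assms by (induction u) auto

lemma not_staircase_cases:
  assumes "\<forall>x\<in>set w. 0 \<le> x" "\<not> staircase m s w"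
  shows "(\<exists>x r. w = x # r \<and> s < x) \<or> (\<exists>u a b v. w = u @ [a, b] @ v \<and> a + int m < b)"
  using assms
proof (induction w arbitrary: s)
  case (Cons x w)
  show ?case
  proof (cases "s < x")
    case False
    then have "(\<exists>y r. w = y # r \<and> x + int m < y) \<or> (\<exists>u a b v. w = u @ [a, b] @ v \<and> a + int m < b)"
      using Cons.prems by (intro Cons.IH) auto
    then show ?thesis
    proof (elim disjE exE conjE)
      fix y r assume "w = y # r" "x + int m < y"
      then have "x # w = [] @ [x, y] @ r \<and> x + int m < y" by simp
      then show ?thesis by blast
    next
      fix u a b v assume "w = u @ [a, b] @ v" "a + int m < b"
      then have "x # w = (x # u) @ [a, b] @ v \<and> a + int m < b" by simp
      then show ?thesis by blast
    qed
  qed simp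
qed simp

abbreviation staircase_vecs :: "nat \<Rightarrow> nat \<Rightarrow> ind_elt set"
  where "staircase_vecs m n \<equiv> word_vec m ` staircase_words m n 0"

lemma span_staircase_submodule: "submodule CC (lspan (\<MM> m) (staircase_vecs m n)) (\<MM> m)"
  by (rule lspan_submodule[OF module_\<MM>]) (use word_vec_closed in blast)

text \<open>If \<open>a, b\<close> are adjacent with \<open>b > a + m\<close>, the relation with \<open>r = a + m\<close> and \<open>s = b - m\<close> contains the word itself with
  coefficient \<open>(-1)\<^sup>m\<close>, and every other term replaces \<open>a, b\<close> by \<open>a', b'\<close> in the interval from \<open>a\<close> to \<open>b\<close> with the same sum and
  \<open>b' < b\<close>.\<close>

lemma straightening:
  assumes "\<forall>x\<in>set w. 0 \<le> x" "length w = n"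
  shows "word_vec m w \<in> lspan (\<MM> m) (staircase_vecs m n)"
  using assms
proof (induction "nat (position_weight w)" arbitrary: w rule: less_induct)
  case less
  interpret M: module CC "\<MM> m" by (rule module_\<MM>)
  note S = span_staircase_submodule[of m n]
  interpret S: submodule CC "lspan (\<MM> m) (staircase_vecs m n)" "\<MM> m" by (rule S)
  show ?case
  proof (cases "staircase m 0 w")
    case True
    then have "word_vec m w \<in> staircase_vecs m n" using less.prems by (auto simp: staircase_words_def)
    then show ?thesis using M.in_own_span[of "staircase_vecs m n"] word_vec_closed by blast
  next
    case False
    with not_staircase_cases[OF less.prems(1)] consider
      (first) x r where "w = x # r" "0 < x" | (jump) u a b v where "w = u @ [a, b] @ v" "a + int m < b"
      by blast
    then show ?thesis
    proof cases
      case (first x r)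
      then show ?thesis using word_vec_pos[of x m r] S.zero_closed by simp
    next
      case (jump u a b v)
      let ?r = "a + int m" and ?s = "b - int m"
      let ?x = "\<lambda>k. word_vec m (u @ rel_word ?r ?s k @ v)"
      have "?x (m, False) \<in> lspan (\<MM> m) (staircase_vecs m n)"
      proof (rule submodule_solve[OF S, where c = "rel_coeff m" and x = ?x])
        show "(\<Oplus>\<^bsub>\<MM> m\<^esub>k\<in>{..m} \<times> UNIV. rel_coeff m k \<odot>\<^bsub>\<MM> m\<^esub> ?x k) = \<zero>\<^bsub>\<MM> m\<^esub>"
          by (rule word_vec_relation)
        show "?x (m, False) \<in> carrier (\<MM> m)" by (rule word_vec_closed)
        fix k assume k: "k \<in> {..m} \<times> UNIV - {(m, False)}"
        obtain a' b' where k': "rel_word ?r ?s k = [a', b']" "a' + b' = a + b" "b' < b" "a \<le> a'" "a \<le> b'"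
        proof (cases k)
          case (Pair i flipped)
          show thesis
            by (rule that[of "if flipped then ?s + int i else ?r - int i" "if flipped then ?r - int i else ?s + int i"])
              (use k Pair jump(2) in \<open>auto split: if_splits\<close>)
        qed
        have nonneg: "\<forall>x\<in>set (u @ [a', b'] @ v). 0 \<le> x"
          using less.prems(1) k'(4,5) unfolding jump(1) by auto
        have "position_weight (u @ [a', b'] @ v) < position_weight w"
          unfolding jump(1) using k' by (intro position_weight_exchange) auto
        then have "nat (position_weight (u @ [a', b'] @ v)) < nat (position_weight w)" using position_weight_nonneg[OF nonneg] by simp
        then show "?x k \<in> lspan (\<MM> m) (staircase_vecs m n)"
          unfolding k'(1) using less.prems(2) jump(1) by (intro less.hyps nonneg) auto
      qed auto
      then show ?thesis by (simp add: jump(1))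
    qed
  qed
qed

abbreviation nonneg_vecs :: "nat \<Rightarrow> nat \<Rightarrow> ind_elt set"
  where "nonneg_vecs m n \<equiv> word_vec m ` {w. length w = n \<and> (\<forall>x\<in>set w. 0 \<le> x)}"

lemma foldl_act_in_span:
  assumes "set as \<subseteq> carrier (\<AA>_nonneg m)" "length as = n"
  shows "foldl (\<MM>_act m) (vac m) as \<in> lspan (\<MM> m) (nonneg_vecs m n)"
  using assms
proof (induction as arbitrary: n rule: rev_induct)
  interpret M: module CC "\<MM> m" by (rule module_\<MM>)
  have sub: "nonneg_vecs m n \<subseteq> carrier (\<MM> m)" for n using word_vec_closed by blast
  {
    case Nil
    then have "vac m \<in> nonneg_vecs m n" by force
    then have "vac m \<in> lspan (\<MM> m) (nonneg_vecs m n)" using M.in_own_span[OF sub] by blast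
    then show ?case by (simp only: foldl.simps)
  next
    case (snoc a as)
    let ?S = "lspan (\<MM> m) (nonneg_vecs m n)"
    have S: "submodule CC ?S (\<MM> m)" by (rule lspan_submodule[OF module_\<MM> sub])
    have a: "a \<in> carrier (\<AA>_nonneg m)" using snoc.prems by simp
    then have aA: "a \<in> carrier (\<AA> m)" using submodule.subset[OF \<AA>_nonneg_sub] by blast
    have "word_vec m ` {w. length w = length as \<and> (\<forall>x\<in>set w. 0 \<le> x)} \<subseteq> {X \<in> carrier (\<MM> m). \<MM>_act m X a \<in> ?S}"
    proof clarify
      fix w :: "int list" assume w: "length w = length as" "\<forall>x\<in>set w. 0 \<le> x"
      let ?Y = "word_vec m w"
      have "(\<lambda>a. \<MM>_act m ?Y a) \<in> module_hom CC (\<AA> m) (\<MM> m)"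
      proof (rule module_homI)
        fix c x assume x: "x \<in> carrier (\<AA> m)"
        show "\<MM>_act m ?Y (c \<odot>\<^bsub>\<AA> m\<^esub> x) = c \<odot>\<^bsub>\<MM> m\<^esub> \<MM>_act m ?Y x"
          by (rule \<MM>_act_linear(2)[OF word_vec_closed x x])
      qed (simp_all add: \<MM>_act_closed \<MM>_act_linear(1) word_vec_closed)
      note pre = submodule_preimage[OF module_\<AA> module_\<MM> this S]
      have "{gen m i | i. 0 \<le> i} \<subseteq> {x \<in> carrier (\<AA> m). \<MM>_act m ?Y x \<in> ?S}"
      proof clarify
        fix i :: int assume i: "0 \<le> i"
        have "\<MM>_act m ?Y (gen m i) = word_vec m (w @ [i])" by simp
        moreover have "word_vec m (w @ [i]) \<in> nonneg_vecs m n" using w i snoc.prems(2) by (intro imageI) auto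
        ultimately show "gen m i \<in> carrier (\<AA> m) \<and> \<MM>_act m ?Y (gen m i) \<in> ?S"
          using M.in_own_span[OF sub, of n] gen_carrier by auto
      qed
      then have "lspan (\<AA> m) {gen m i | i. 0 \<le> i} \<subseteq> {x \<in> carrier (\<AA> m). \<MM>_act m ?Y x \<in> ?S}"
        by (rule module.span_is_subset[OF module_\<AA> _ pre])
      then show "?Y \<in> carrier (\<MM> m) \<and> \<MM>_act m ?Y a \<in> ?S"
        using a word_vec_closed by (auto simp: \<AA>_nonneg_def)
    qed
    then have "lspan (\<MM> m) (nonneg_vecs m (length as)) \<subseteq> {X \<in> carrier (\<MM> m). \<MM>_act m X a \<in> ?S}"
      by (rule M.span_is_subset[OF _ submodule_preimage[OF module_\<MM> module_\<MM> \<MM>_act_hom[OF aA] S]])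
    moreover have "foldl (\<MM>_act m) (vac m) as \<in> lspan (\<MM> m) (nonneg_vecs m (length as))"
      using snoc.prems by (intro snoc.IH) auto
    ultimately show ?case by auto
  }
qed

text \<open>One inclusion expands a product of elements of \<open>\<AA>_nonneg m\<close> into words and straightens them; for the other,
  the vector of a staircase word is the image of a pure tensor of generators.\<close>

lemma carrier_\<PP>: "carrier (\<PP> m n) = lspan (\<MM> m) (staircase_vecs m n)"
proof
  interpret M: module CC "\<MM> m" by (rule module_\<MM>)
  let ?S = "lspan (\<MM> m) (staircase_vecs m n)"
  let ?T = "free_vs {xs. length xs = n \<and> set xs \<subseteq> carrier (\<AA>_nonneg m)}"
  note S = span_staircase_submodule[of m n]
  have "lspan (\<MM> m) (nonneg_vecs m n) \<subseteq> ?S"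
    using straightening by (intro M.span_is_subset S) auto
  then have foldl: "foldl (\<MM>_act m) (vac m) as \<in> ?S"
    if "set as \<subseteq> carrier (\<AA>_nonneg m)" "length as = n" for as
    using foldl_act_in_span[OF that] by blast
  show "carrier (\<PP> m n) \<subseteq> ?S"
  proof
    fix X assume "X \<in> carrier (\<PP> m n)"
    then obtain f where f: "f \<in> carrier ?T"
      and X: "X = mult_map m (lspan ?T (multilin_rels n (\<AA>_nonneg m)) +>\<^bsub>?T\<^esub> f)"
      unfolding \<PP>_def tensor_power_def Let_def by (auto simp: quot_carrier)
    have "X = lin_ext (\<MM> m) (\<lambda>as. foldl (\<MM>_act m) (vac m) as) f"
      unfolding X mult_map_def
      by (rule quot_map_coset[OF tensor_power_sub mult_map_lin_ext(1) module_\<MM> mult_map_lin_ext(2) f])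
    also have "\<dots> \<in> ?S"
      unfolding lin_ext_def
    proof (rule submodule_finsum[OF S])
      show "finite {as. f as \<noteq> 0}" using f by (simp add: free_vs_carrier)
      fix as assume "as \<in> {as. f as \<noteq> 0}"
      then have "set as \<subseteq> carrier (\<AA>_nonneg m)" "length as = n" using f by (auto simp: free_vs_carrier)
      then show "f as \<odot>\<^bsub>\<MM> m\<^esub> foldl (\<MM>_act m) (vac m) as \<in> ?S"
        by (intro submodule.smult_closed[OF S] foldl) simp_all
    qed
    finally show "X \<in> ?S" .
  qed
  have "staircase_vecs m n \<subseteq> carrier (\<PP> m n)"
  proof clarify
    fix w assume w: "w \<in> staircase_words m n 0"
    have nonneg: "0 \<le> x" if "staircase m s w" "x \<in> set w" for s x w
      using that by (induction w arbitrary: s) auto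
    interpret A: module CC "\<AA> m" by (rule module_\<AA>)
    have "gen m i \<in> carrier (\<AA>_nonneg m)" if "0 \<le> i" for i
      using that gen_carrier A.in_own_span[of "{gen m i | i. 0 \<le> i}"] by (auto simp: \<AA>_nonneg_def)
    then have as: "length (map (gen m) w) = n" "set (map (gen m) w) \<subseteq> carrier (\<AA>_nonneg m)"
      using w nonneg by (auto simp: staircase_words_def)
    have "delta (map (gen m) w) \<in> carrier ?T" using as by (intro delta_in_free_vs) simp
    then have "mult_map m (lspan ?T (multilin_rels n (\<AA>_nonneg m)) +>\<^bsub>?T\<^esub> delta (map (gen m) w)) \<in> carrier (\<PP> m n)"
      unfolding \<PP>_def tensor_power_def Let_def by (simp add: quot_carrier)
    then show "word_vec m w \<in> carrier (\<PP> m n)" unfolding mult_map_pure[OF as] .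
  qed
  moreover have "submodule CC (carrier (\<PP> m n)) (\<MM> m)"
    using \<PP>_subspace[of m n] by (simp add: subspace_def)
  ultimately show "?S \<subseteq> carrier (\<PP> m n)" by (intro M.span_is_subset)
qed

section \<open>The dimension\<close>

lemma triangular_functional:
  assumes w: "w \<in> staircase_words m n 0"
  obtains \<Phi> where "\<Phi> \<in> module_hom CC (\<MM> m) triv" "\<Phi> (word_vec m w) \<noteq> 0"
    "\<And>w'. w' \<in> staircase_words m n 0 \<Longrightarrow> \<Phi> (word_vec m w') \<noteq> 0 \<Longrightarrow> w' \<le> w"
proof -
  let ?M = "mset (slack m 0 w)"
  have st: "staircase m 0 w" "length w = n" using w by (auto simp: staircase_words_def)
  have pos: "sym_kernel m ?M (i # r) = 0" if "0 < i" for i r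
    using staircase_slack(2)[OF st(1), of _ 0] that by (intro sym_kernel_pos) auto
  from module_functional[OF mutually_local_sym_kernel pos] obtain \<Phi>
    where \<Phi>: "\<Phi> \<in> module_hom CC (\<MM> m) triv" "\<And>w'. \<Phi> (word_vec m w') = sym_kernel m ?M w'" by blast
  show thesis
  proof (rule that[OF \<Phi>(1)])
    show "\<Phi> (word_vec m w) \<noteq> 0" unfolding \<Phi>(2) by (rule sym_kernel_triangular(2)[OF st(1) refl])
    show "w' \<le> w" if "w' \<in> staircase_words m n 0" "\<Phi> (word_vec m w') \<noteq> 0" for w'
      using that sym_kernel_triangular(1)[OF st(1), of w'] st(2) by (simp add: \<Phi>(2) staircase_words_def)
  qed
qed

lemma inj_word_vec: "inj_on (word_vec m) (staircase_words m n 0)"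
proof (rule inj_onI)
  have le: "w' \<le> w" if "w \<in> staircase_words m n 0" "w' \<in> staircase_words m n 0" "word_vec m w = word_vec m w'" for w w'
    using triangular_functional[OF that(1)] that(2,3) by metis
  show "w = w'" if "w \<in> staircase_words m n 0" "w' \<in> staircase_words m n 0" "word_vec m w = word_vec m w'" for w w'
    using le[OF that] le[OF that(2,1) that(3)[symmetric]] by simp
qed

text \<open>In a vanishing combination take the lexicographically least word with a nonzero coefficient. Its triangular
  functional vanishes on all greater words, so it isolates that coefficient.\<close>

lemma lin_indpt_staircase_vecs: "\<not> module.lin_dep CC (\<MM> m) (staircase_vecs m n)"
proof
  interpret M: module CC "\<MM> m" by (rule module_\<MM>)
  let ?W = "staircase_words m n 0"
  assume dep: "M.lin_dep (staircase_vecs m n)"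
  have sub: "staircase_vecs m n \<subseteq> carrier (\<MM> m)" using word_vec_closed by blast
  obtain a X where zero: "M.lincomb a (staircase_vecs m n) = \<zero>\<^bsub>\<MM> m\<^esub>"
    and X: "X \<in> staircase_vecs m n" "a X \<noteq> 0"
    using M.finite_lin_dep[OF _ dep sub] finite_staircase_words[of m n 0] by auto
  define D where "D = {w \<in> ?W. a (word_vec m w) \<noteq> 0}"
  have D: "finite D" "D \<noteq> {}" using X finite_staircase_words[of m n 0] by (auto simp: D_def)
  define w0 where "w0 = Min D"
  have w0: "w0 \<in> ?W" "a (word_vec m w0) \<noteq> 0" and min: "\<And>w. w \<in> D \<Longrightarrow> w0 \<le> w"
    using Min_in[OF D] Min_le[OF D(1)] by (auto simp: w0_def D_def)
  obtain \<Phi> where \<Phi>: "\<Phi> \<in> module_hom CC (\<MM> m) triv" "\<Phi> (word_vec m w0) \<noteq> 0"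
    "\<And>w'. w' \<in> ?W \<Longrightarrow> \<Phi> (word_vec m w') \<noteq> 0 \<Longrightarrow> w' \<le> w0"
    using triangular_functional[OF w0(1)] by metis
  interpret \<Phi>: mod_hom CC "\<MM> m" triv \<Phi>
    by (intro mod_hom.intro mod_hom_axioms.intro module_\<MM> module_triv \<Phi>(1))
  have "0 = \<Phi> (M.lincomb a (staircase_vecs m n))" using \<Phi>.f0_is_0 by (simp add: zero)
  also have "\<dots> = (\<Oplus>\<^bsub>triv\<^esub>X\<in>staircase_vecs m n. \<Phi> (a X \<odot>\<^bsub>\<MM> m\<^esub> X))"
    unfolding M.lincomb_def using sub by (intro \<Phi>.hom_sum) (auto intro!: M.smult_closed)
  also have "\<dots> = (\<Sum>X\<in>staircase_vecs m n. \<Phi> (a X \<odot>\<^bsub>\<MM> m\<^esub> X))"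
    using finite_staircase_words by (intro finsum_triv) blast
  also have "\<dots> = (\<Sum>X\<in>staircase_vecs m n. a X * \<Phi> X)"
    using sub module_hom_smult[OF \<Phi>(1)] by (intro sum.cong) auto
  also have "\<dots> = (\<Sum>w\<in>?W. a (word_vec m w) * \<Phi> (word_vec m w))"
    using inj_word_vec by (simp add: sum.reindex)
  also have "\<dots> = (\<Sum>w\<in>?W. if w = w0 then a (word_vec m w0) * \<Phi> (word_vec m w0) else 0)"
  proof (rule sum.cong[OF refl])
    fix w assume w: "w \<in> ?W"
    show "a (word_vec m w) * \<Phi> (word_vec m w) = (if w = w0 then a (word_vec m w0) * \<Phi> (word_vec m w0) else 0)"
      using \<Phi>(3)[OF w] min[of w] w
      by (cases "w = w0 \<or> a (word_vec m w) = 0 \<or> \<Phi> (word_vec m w) = 0") (auto simp: D_def)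
  qed
  also have "\<dots> \<noteq> 0" using w0 \<Phi>(2) finite_staircase_words by simp
  finally show False by simp
qed

theorem theorem7:
  fixes m n :: nat
  assumes "m \<ge> 1" and "n \<ge> 1"
  shows "vectorspace.fin_dim CC (\<PP> m n)
    \<and> of_nat (vectorspace.dim CC (\<PP> m n)) = fuss_catalan m n"
proof -
  interpret M: module CC "\<MM> m" by (rule module_\<MM>)
  interpret P: vectorspace CC "\<PP> m n" by (rule vectorspace_\<PP>)
  let ?B = "staircase_vecs m n"
  have sub: "submodule CC (carrier (\<PP> m n)) (\<MM> m)"
    using \<PP>_subspace[of m n] by (simp add: subspace_def)
  have BM: "?B \<subseteq> carrier (\<MM> m)" using word_vec_closed by blast
  have B: "?B \<subseteq> carrier (\<PP> m n)"
    unfolding carrier_\<PP> by (rule M.in_own_span[OF BM])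
  have \<PP>_eq: "(\<MM> m)\<lparr>carrier := carrier (\<PP> m n)\<rparr> = \<PP> m n" by (simp add: \<PP>_def)
  have fin: "finite ?B" using finite_staircase_words by blast
  have span: "P.span ?B = carrier (\<PP> m n)"
    using M.span_li_not_depend(1)[OF B sub] carrier_\<PP> unfolding \<PP>_eq by simp
  have "\<not> P.lin_dep ?B"
    using M.span_li_not_depend(2)[OF B sub] lin_indpt_staircase_vecs unfolding \<PP>_eq by simp
  then have "P.basis ?B" unfolding P.basis_def using span B by blast
  then have "P.dim = card ?B" by (rule P.dim_basis[OF fin])
  also have "\<dots> = card (staircase_words m n 0)" by (rule card_image[OF inj_word_vec])
  finally have "of_nat P.dim = fuss_catalan m n" by (simp add: of_nat_card_staircase_words)
  moreover have "P.fin_dim" unfolding P.fin_dim_def using fin B span by blast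
  ultimately show ?thesis by blast
qed

end
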